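(* Let $H,Q$ be locally compact groups and let $p:H\to Q$ be a resolution. Given any subset $X\subset H$, if $(Q,p(X))$ has relative Property (T), then so does $(H,X)$. In particular, if $Q$ is Haagerup, then $(H,X)$ has relative Property (T) if and only if $\overline{p(X)}$ is compact.
   Context: For a locally compact group $G$ and a subset $X\subset G$, the pair $(G,X)$ has relative Property (T) if for every net $(\varphi_i)$ of continuous normalized (i.e. $\varphi_i(1)=1$) positive definite functions on $G$ that converges to $1$ uniformly on compact subsets of $G$, the convergence is uniform on $X$. A locally compact group $G$ is Haagerup if for every compact $K\subset G$ and $\varepsilon>0$ there exists a continuous real-valued normalized positive definite function $\varphi$ on $G$, vanishing at infinity, with $\varphi|_K>1-\varepsilon$. A morphism between topological groups is a continuous group homomorphism. Unitary representations are strongly continuous; a unitary representation $\pi$ of $G$ almost has invariant vectors if for every compact $K\subset G$ and $\varepsilon>0$ there is a nonzero vector $\xi$ with $\sup_{g\in K}\|\pi(g)\xi-\xi\|\le\varepsilon\|\xi\|$. A morphism $f:G\to Q$ with dense image between locally compact groups is a resolution if every unitary representation $\pi$ of $G$ almost having invariant vectors has a nonzero subrepresentation $\rho$ that factors as $\rho=\tilde\rho\circ f$ with $\tilde\rho$ a unitary representation of $Q$ that almost has invariant vectors (as a representation of $Q$). *)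

theory Defs
  imports "HOL-Analysis.Analysis" "HOL-Library.Function_Algebras"
begin

text \<open>
  A Hausdorff topological group is a type of sort \<open>{topological_group_add, t2_space}\<close>.
  The class \<open>group_add\<close> does not assume commutativity; the group law is merely written
  additively, so that \<open>- h + g\<close> stands for \<open>h\<^sup>-\<^sup>1 g\<close> and \<open>0\<close> for the neutral element.
\<close>

section \<open>Positive definite functions, relative Property (T), Haagerup groups\<close>

definition positive_definite :: "('g::group_add \<Rightarrow> complex) \<Rightarrow> bool" where
  "positive_definite \<phi> \<longleftrightarrow>
     (\<forall>(n::nat) (g :: nat \<Rightarrow> 'g) (c :: nat \<Rightarrow> complex).
        (\<Sum>i<n. \<Sum>j<n. c i * cnj (c j) * \<phi> (- g j + g i)) \<in> \<real>\<^sub>\<ge>\<^sub>0)"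

definition normalized_pd :: "('g::topological_group_add \<Rightarrow> complex) \<Rightarrow> bool" where
  "normalized_pd \<phi> \<longleftrightarrow> continuous_on UNIV \<phi> \<and> positive_definite \<phi> \<and> \<phi> 0 = 1"

text \<open>
  Nets of functions are rendered by filters: only the image of the tail filter of a net matters
  for its convergence, and every filter on the space of functions arises in this way. The lemma
  below recovers the formulation with an indexed family.
\<close>

definition relative_property_T :: "'g::topological_group_add set \<Rightarrow> bool" where
  "relative_property_T X \<longleftrightarrow>
     (\<forall>F :: ('g \<Rightarrow> complex) filter.
        (\<forall>\<^sub>F \<phi> in F. normalized_pd \<phi>) \<longrightarrow>
        (\<forall>K. compact K \<longrightarrow> uniform_limit K (\<lambda>\<phi>. \<phi>) (\<lambda>_. 1) F) \<longrightarrow>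
        uniform_limit X (\<lambda>\<phi>. \<phi>) (\<lambda>_. 1) F)"

lemma relative_property_T_net:
  fixes \<phi> :: "'i \<Rightarrow> 'g::topological_group_add \<Rightarrow> complex"
  assumes "relative_property_T X"
    and "\<forall>\<^sub>F i in I. normalized_pd (\<phi> i)"
    and "\<And>K. compact K \<Longrightarrow> uniform_limit K \<phi> (\<lambda>_. 1) I"
  shows "uniform_limit X \<phi> (\<lambda>_. 1) I"
proof -
  have eq: "uniform_limit K (\<lambda>\<psi>. \<psi>) (\<lambda>_. 1) (filtermap \<phi> I) \<longleftrightarrow> uniform_limit K \<phi> (\<lambda>_. 1) I" for K
    by (simp add: filterlim_filtermap)
  have "uniform_limit X (\<lambda>\<psi>. \<psi>) (\<lambda>_. 1) (filtermap \<phi> I)"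
    using assms(1)[unfolded relative_property_T_def, rule_format, of "filtermap \<phi> I"] assms(2,3)
    by (simp add: eq eventually_filtermap)
  then show ?thesis by (simp add: eq)
qed

definition vanishes_at_infinity :: "('g::topological_space \<Rightarrow> real) \<Rightarrow> bool" where
  "vanishes_at_infinity \<phi> \<longleftrightarrow> (\<forall>e>0. \<exists>K. compact K \<and> (\<forall>g. g \<notin> K \<longrightarrow> \<bar>\<phi> g\<bar> < e))"

definition haagerup :: "'g::topological_group_add itself \<Rightarrow> bool" where
  "haagerup _ \<longleftrightarrow>
     (\<forall>(K :: 'g set) (e :: real). compact K \<longrightarrow> e > 0 \<longrightarrow>
        (\<exists>\<phi> :: 'g \<Rightarrow> real. normalized_pd (\<lambda>g. complex_of_real (\<phi> g)) \<and>
            vanishes_at_infinity \<phi> \<and> (\<forall>g\<in>K. \<phi> g > 1 - e)))"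

section \<open>Unitary representations\<close>

text \<open>
  A complex Hilbert space is given by a subspace \<open>V\<close> of some complex vector space
  (an additive group \<open>'v\<close> with scalar multiplication \<open>s\<close>), together with an inner product \<open>ip\<close>
  on \<open>V\<close>, linear in the first variable, for which \<open>V\<close> is complete. The ambient space carries no
  norm, so \<open>ip\<close> is an arbitrary inner product on \<open>V\<close>.
\<close>

definition hnorm :: "('v \<Rightarrow> 'v \<Rightarrow> complex) \<Rightarrow> 'v \<Rightarrow> real" where
  "hnorm ip v = sqrt (Re (ip v v))"

definition hilbert_space ::
    "(complex \<Rightarrow> 'v::ab_group_add \<Rightarrow> 'v) \<Rightarrow> 'v set \<Rightarrow> ('v \<Rightarrow> 'v \<Rightarrow> complex) \<Rightarrow> bool" where
  "hilbert_space s V ip \<longleftrightarrow>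
     vector_space s \<and> module.subspace s V \<and>
     (\<forall>u\<in>V. \<forall>v\<in>V. \<forall>w\<in>V. ip (u + v) w = ip u w + ip v w) \<and>
     (\<forall>c. \<forall>v\<in>V. \<forall>w\<in>V. ip (s c v) w = c * ip v w) \<and>
     (\<forall>v\<in>V. \<forall>w\<in>V. ip w v = cnj (ip v w)) \<and>
     (\<forall>v\<in>V. v \<noteq> 0 \<longrightarrow> Re (ip v v) > 0) \<and>
     (\<forall>f :: nat \<Rightarrow> 'v. range f \<subseteq> V \<longrightarrow>
        (\<forall>e>0. \<exists>N. \<forall>m\<ge>N. \<forall>n\<ge>N. hnorm ip (f m - f n) < e) \<longrightarrow>
        (\<exists>v\<in>V. (\<lambda>n. hnorm ip (f n - v)) \<longlonglongrightarrow> 0))"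

definition unitary_operator ::
    "(complex \<Rightarrow> 'v::ab_group_add \<Rightarrow> 'v) \<Rightarrow> 'v set \<Rightarrow> ('v \<Rightarrow> 'v \<Rightarrow> complex) \<Rightarrow> ('v \<Rightarrow> 'v) \<Rightarrow> bool" where
  "unitary_operator s V ip U \<longleftrightarrow>
     U ` V = V \<and>
     (\<forall>v\<in>V. \<forall>w\<in>V. U (v + w) = U v + U w) \<and>
     (\<forall>c. \<forall>v\<in>V. U (s c v) = s c (U v)) \<and>
     (\<forall>v\<in>V. \<forall>w\<in>V. ip (U v) (U w) = ip v w)"

text \<open>Only the values of \<open>\<pi> g\<close> on \<open>V\<close> matter.\<close>

definition unitary_rep ::
    "(complex \<Rightarrow> 'v::ab_group_add \<Rightarrow> 'v) \<Rightarrow> 'v set \<Rightarrow> ('v \<Rightarrow> 'v \<Rightarrow> complex) \<Rightarrow>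
     ('g::topological_group_add \<Rightarrow> 'v \<Rightarrow> 'v) \<Rightarrow> bool" where
  "unitary_rep s V ip \<pi> \<longleftrightarrow>
     hilbert_space s V ip \<and>
     (\<forall>g. unitary_operator s V ip (\<pi> g)) \<and>
     (\<forall>v\<in>V. \<pi> 0 v = v) \<and>
     (\<forall>g h. \<forall>v\<in>V. \<pi> (g + h) v = \<pi> g (\<pi> h v)) \<and>
     (\<forall>v\<in>V. \<forall>g0. ((\<lambda>g. hnorm ip (\<pi> g v - \<pi> g0 v)) \<longlongrightarrow> 0) (at g0))"

definition almost_invariant_vectors ::
    "'v::ab_group_add set \<Rightarrow> ('v \<Rightarrow> 'v \<Rightarrow> complex) \<Rightarrow> ('g::topological_group_add \<Rightarrow> 'v \<Rightarrow> 'v) \<Rightarrow> bool" where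
  "almost_invariant_vectors V ip \<pi> \<longleftrightarrow>
     (\<forall>(K :: 'g set) (e :: real). compact K \<longrightarrow> e > 0 \<longrightarrow>
        (\<exists>\<xi>\<in>V. \<xi> \<noteq> 0 \<and> (\<forall>g\<in>K. hnorm ip (\<pi> g \<xi> - \<xi>) \<le> e * hnorm ip \<xi>)))"

text \<open>
  The nonzero subrepresentation of \<open>(V, \<pi>)\<close> is \<open>(W, \<pi>)\<close>: as \<open>V\<close> is complete, the subspaces \<open>W\<close> of
  \<open>V\<close> on which \<open>\<pi>\<close> is again a unitary representation are exactly the closed invariant subspaces.
\<close>

definition resolves ::
    "('g::topological_group_add \<Rightarrow> 'q::topological_group_add) \<Rightarrow>
     (complex \<Rightarrow> 'v::ab_group_add \<Rightarrow> 'v) \<Rightarrow> 'v set \<Rightarrow> ('v \<Rightarrow> 'v \<Rightarrow> complex) \<Rightarrow> ('g \<Rightarrow> 'v \<Rightarrow> 'v) \<Rightarrow> bool" where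
  "resolves f s V ip \<pi> \<longleftrightarrow>
     (\<exists>W \<rho>. W \<subseteq> V \<and> W \<noteq> {0} \<and> unitary_rep s W ip \<pi> \<and>
        unitary_rep s W ip \<rho> \<and> (\<forall>g. \<forall>v\<in>W. \<pi> g v = \<rho> (f g) v) \<and>
        almost_invariant_vectors W ip \<rho>)"

section \<open>Resolutions\<close>

text \<open>
  A definition cannot quantify over all types, so the representation spaces range over all
  Hilbert spaces whose vectors are functions \<open>'g set \<times> nat \<times> 'g \<Rightarrow> complex\<close> with pointwise
  operations (and an arbitrary inner product). The theorem \<open>resolution_universal\<close> shows
  that this is no restriction: a resolution has the defining property with respect to unitary
  representations on Hilbert spaces over any type. The reason is that a representation which
  almost has invariant vectors contains a subrepresentation generated by vectors \<open>\<xi> K n\<close>, one for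
  each compact \<open>K\<close> and each natural number \<open>n\<close>, which almost has invariant vectors too.
\<close>

definition fscale :: "complex \<Rightarrow> ('i \<Rightarrow> complex) \<Rightarrow> 'i \<Rightarrow> complex" where
  "fscale c v = (\<lambda>i. c * v i)"

definition resolution ::
    "('g::topological_group_add \<Rightarrow> 'q::topological_group_add) \<Rightarrow> bool" where
  "resolution f \<longleftrightarrow>
     continuous_on UNIV f \<and> (\<forall>x y. f (x + y) = f x + f y) \<and> closure (range f) = UNIV \<and>
     (\<forall>(V :: ('g set \<times> nat \<times> 'g \<Rightarrow> complex) set) ip \<pi>.
        unitary_rep fscale V ip \<pi> \<longrightarrow> almost_invariant_vectors V ip \<pi> \<longrightarrow>
        resolves f fscale V ip \<pi>)"

lemma vector_space_fscale: "vector_space fscale"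
  by unfold_locales (auto simp: fscale_def fun_eq_iff algebra_simps)

context
  fixes s :: "complex \<Rightarrow> 'v::ab_group_add \<Rightarrow> 'v" and V ip
  assumes hilbert: "hilbert_space s V ip"
begin

lemma hs_vs: "vector_space s"
  and hs_sub: "module.subspace s V"
  and hs_add: "u \<in> V \<Longrightarrow> v \<in> V \<Longrightarrow> w \<in> V \<Longrightarrow> ip (u + v) w = ip u w + ip v w"
  and hs_scale: "v \<in> V \<Longrightarrow> w \<in> V \<Longrightarrow> ip (s c v) w = c * ip v w"
  and hs_cnj: "v \<in> V \<Longrightarrow> w \<in> V \<Longrightarrow> ip w v = cnj (ip v w)"
  and hs_pos: "v \<in> V \<Longrightarrow> v \<noteq> 0 \<Longrightarrow> Re (ip v v) > 0"
  and hs_complete: "range f \<subseteq> V \<Longrightarrow> (\<And>e. e > 0 \<Longrightarrow> \<exists>N. \<forall>m\<ge>N. \<forall>n\<ge>N. hnorm ip (f m - f n) < e)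
        \<Longrightarrow> \<exists>v\<in>V. (\<lambda>n::nat. hnorm ip (f n - v)) \<longlonglongrightarrow> 0"
  using hilbert unfolding hilbert_space_def by (blast, blast, metis, metis, metis, blast, simp)

interpretation S: vector_space s by (rule hs_vs)

lemma hs_mem: "0 \<in> V" "u \<in> V \<Longrightarrow> v \<in> V \<Longrightarrow> u + v \<in> V" "v \<in> V \<Longrightarrow> s c v \<in> V"
    "u \<in> V \<Longrightarrow> v \<in> V \<Longrightarrow> u - v \<in> V"
  using hs_sub S.subspace_0 S.subspace_add S.subspace_scale S.subspace_diff by blast+

lemma hs_zero: "w \<in> V \<Longrightarrow> ip 0 w = 0" "w \<in> V \<Longrightarrow> ip w 0 = 0"
  using hs_scale[of 0 w 0] hs_cnj[of 0 w] hs_mem(1) by simp_all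

lemma hs_diff: "u \<in> V \<Longrightarrow> v \<in> V \<Longrightarrow> w \<in> V \<Longrightarrow> ip (u - v) w = ip u w - ip v w"
  using hs_add[of "u - v" v w] hs_mem(4)[of u v] by simp

lemma hs_diff_right: "u \<in> V \<Longrightarrow> v \<in> V \<Longrightarrow> w \<in> V \<Longrightarrow> ip w (u - v) = ip w u - ip w v"
  using hs_diff[of u v w] hs_cnj[of "u - v" w] hs_cnj[of u w] hs_cnj[of v w] hs_mem(4)[of u v]
  by simp

lemma hs_scale_right: "v \<in> V \<Longrightarrow> w \<in> V \<Longrightarrow> ip w (s c v) = cnj c * ip w v"
  using hs_scale[of v w c] hs_cnj[of "s c v" w] hs_cnj[of v w] hs_mem(3)[of v c] by simp

lemma hs_real: "v \<in> V \<Longrightarrow> ip v v = of_real (Re (ip v v))"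
  using hs_cnj[of v v] by (metis complex_cnj_cancel_iff Reals_cnj_iff of_real_Re)

lemma hs_nonneg: "v \<in> V \<Longrightarrow> Re (ip v v) \<ge> 0"
  using hs_pos[of v] hs_zero(1)[of 0] hs_mem(1) by (cases "v = 0") auto

lemma hs_cauchy_schwarz:
  assumes "x \<in> V" "u \<in> V"
  shows "cmod (ip x u) \<le> hnorm ip x * hnorm ip u"
proof (cases "u = 0")
  case True
  then show ?thesis using assms hs_zero hs_nonneg by (auto simp: hnorm_def)
next
  case False
  define a where "a = Re (ip u u)"
  have a: "a > 0" "ip u u = of_real a"
    using hs_pos[OF assms(2) False] hs_real[OF assms(2)] by (auto simp: a_def)
  define c where "c = ip x u / of_real a"
  have cu: "s c u \<in> V" using assms hs_mem by blast
  have "ip (x - s c u) (x - s c u) =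
      ip x x - cnj c * ip x u - (c * ip u x - c * (cnj c * ip u u))"
    using assms cu hs_mem(4)[OF assms(1) cu]
    by (simp add: hs_diff hs_diff_right hs_scale hs_scale_right algebra_simps)
  also have "ip u x = cnj (ip x u)" using hs_cnj assms by blast
  also have "ip x x - cnj c * ip x u - (c * cnj (ip x u) - c * (cnj c * ip u u))
      = ip x x - of_real ((cmod (ip x u))\<^sup>2 / a)"
  proof -
    have n: "ip x u * cnj (ip x u) = of_real ((cmod (ip x u))\<^sup>2)"
      by (rule complex_norm_square[symmetric])
    show ?thesis using a n by (simp add: c_def field_simps)
  qed
  finally have "Re (ip x x) - (cmod (ip x u))\<^sup>2 / a \<ge> 0"
    using hs_nonneg[OF hs_mem(4)[OF assms(1) cu]] by simp
  then have "(cmod (ip x u))\<^sup>2 \<le> Re (ip x x) * a"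
    using a(1) by (simp add: field_simps)
  then have "cmod (ip x u) \<le> sqrt (Re (ip x x) * a)"
    by (rule real_le_rsqrt)
  then show ?thesis by (simp add: hnorm_def a_def real_sqrt_mult)
qed

end

lemma unitary_rep_transport:
  fixes s :: "complex \<Rightarrow> 'v::ab_group_add \<Rightarrow> 'v" and s' :: "complex \<Rightarrow> 'w::ab_group_add \<Rightarrow> 'w"
    and \<pi> :: "'g::topological_group_add \<Rightarrow> 'v \<Rightarrow> 'v"
  assumes rep: "unitary_rep s V ip \<pi>" and vs': "vector_space s'"
    and add: "\<And>u v. u \<in> V \<Longrightarrow> v \<in> V \<Longrightarrow> T (u + v) = T u + T v"
    and scale: "\<And>c v. v \<in> V \<Longrightarrow> T (s c v) = s' c (T v)"
    and inj: "\<And>v. v \<in> V \<Longrightarrow> T v = 0 \<Longrightarrow> v = 0"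
    and ip': "\<And>u v. u \<in> V \<Longrightarrow> v \<in> V \<Longrightarrow> ip' (T u) (T v) = ip u v"
    and \<pi>': "\<And>g v. v \<in> V \<Longrightarrow> \<pi>' g (T v) = T (\<pi> g v)"
  shows "unitary_rep s' (T ` V) ip' \<pi>'"
    and "almost_invariant_vectors V ip \<pi> \<Longrightarrow> almost_invariant_vectors (T ` V) ip' \<pi>'"
proof -
  have H: "hilbert_space s V ip" using rep by (simp add: unitary_rep_def)
  note mem = hs_mem[OF H]
  interpret S': vector_space s' by (rule vs')
  have diff: "T (u - v) = T u - T v" if "u \<in> V" "v \<in> V" for u v
    using add[of "u - v" v] that mem(4)[of u v] by simp
  have zero: "T 0 = 0" using diff[of 0 0] mem(1) by simp
  have norm: "hnorm ip' (T u) = hnorm ip u" if "u \<in> V" for u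
    using ip' that by (simp add: hnorm_def)
  have norm_diff: "hnorm ip' (T u - T v) = hnorm ip (u - v)" if "u \<in> V" "v \<in> V" for u v
    using norm[of "u - v"] diff[of u v] mem(4)[of u v] that by simp
  have inv: "\<pi> g v \<in> V" if "v \<in> V" for g v
    using rep that unfolding unitary_rep_def unitary_operator_def by blast
  have sub: "S'.subspace (T ` V)"
    unfolding S'.subspace_def
    using zero mem add scale by (auto simp: image_iff Ball_def Bex_def) metis+
  have compl: "\<exists>v\<in>T ` V. (\<lambda>n. hnorm ip' (f n - v)) \<longlonglongrightarrow> 0"
    if f: "range f \<subseteq> T ` V" and c: "\<forall>e>0. \<exists>N. \<forall>m\<ge>N. \<forall>n\<ge>N. hnorm ip' (f m - f n) < e"
    for f :: "nat \<Rightarrow> 'w"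
  proof -
    have "\<forall>n. \<exists>v. v \<in> V \<and> f n = T v" using f by blast
    then obtain h where h: "\<And>n. h n \<in> V" "\<And>n. f n = T (h n)" by metis
    have "\<exists>v\<in>V. (\<lambda>n. hnorm ip (h n - v)) \<longlonglongrightarrow> 0"
      using hs_complete[OF H, of h] h c by (auto simp: norm_diff)
    then obtain v where v: "v \<in> V" "(\<lambda>n. hnorm ip (h n - v)) \<longlonglongrightarrow> 0" by blast
    then show ?thesis using h by (intro bexI[of _ "T v"]) (auto simp: norm_diff)
  qed
  have H': "hilbert_space s' (T ` V) ip'"
    unfolding hilbert_space_def
  proof (intro conjI)
    show "\<forall>u\<in>T ` V. \<forall>v\<in>T ` V. \<forall>w\<in>T ` V. ip' (u + v) w = ip' u w + ip' v w"
      using mem by (auto simp: add[symmetric] ip' hs_add[OF H])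
    show "\<forall>c. \<forall>v\<in>T ` V. \<forall>w\<in>T ` V. ip' (s' c v) w = c * ip' v w"
      using mem by (auto simp: scale[symmetric] ip' hs_scale[OF H])
    show "\<forall>v\<in>T ` V. \<forall>w\<in>T ` V. ip' w v = cnj (ip' v w)"
      by (auto simp: ip' intro: hs_cnj[OF H])
    show "\<forall>v\<in>T ` V. v \<noteq> 0 \<longrightarrow> 0 < Re (ip' v v)"
      using zero by (auto simp: ip' intro!: hs_pos[OF H])
  qed (use vs' sub compl in blast)+
  have U: "unitary_operator s V ip (\<pi> g)" for g using rep by (simp add: unitary_rep_def)
  have U': "unitary_operator s' (T ` V) ip' (\<pi>' g)" for g
    unfolding unitary_operator_def
  proof (intro conjI)
    have "\<pi>' g ` T ` V = T ` \<pi> g ` V" by (force simp: \<pi>' image_iff)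
    then show "\<pi>' g ` T ` V = T ` V" using U[of g] by (simp add: unitary_operator_def)
    show "\<forall>v\<in>T ` V. \<forall>w\<in>T ` V. \<pi>' g (v + w) = \<pi>' g v + \<pi>' g w"
      using mem inv U[of g] by (auto simp: add[symmetric] \<pi>' unitary_operator_def)
    show "\<forall>c. \<forall>v\<in>T ` V. \<pi>' g (s' c v) = s' c (\<pi>' g v)"
      using mem inv U[of g] by (auto simp: scale[symmetric] \<pi>' unitary_operator_def)
    show "\<forall>v\<in>T ` V. \<forall>w\<in>T ` V. ip' (\<pi>' g v) (\<pi>' g w) = ip' v w"
      using inv U[of g] by (auto simp: ip' \<pi>' unitary_operator_def)
  qed
  show "unitary_rep s' (T ` V) ip' \<pi>'"
    unfolding unitary_rep_def
    using H' U' rep inv by (auto simp: \<pi>' norm_diff unitary_rep_def)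
  show "almost_invariant_vectors (T ` V) ip' \<pi>'" if aiv: "almost_invariant_vectors V ip \<pi>"
    unfolding almost_invariant_vectors_def
  proof (intro allI impI)
    fix K :: "'g set" and e :: real assume "compact K" "e > 0"
    then obtain \<xi> where \<xi>: "\<xi> \<in> V" "\<xi> \<noteq> 0" "\<forall>g\<in>K. hnorm ip (\<pi> g \<xi> - \<xi>) \<le> e * hnorm ip \<xi>"
      using aiv unfolding almost_invariant_vectors_def by blast
    then show "\<exists>\<xi>\<in>T ` V. \<xi> \<noteq> 0 \<and> (\<forall>g\<in>K. hnorm ip' (\<pi>' g \<xi> - \<xi>) \<le> e * hnorm ip' \<xi>)"
      using inv inj by (intro bexI[of _ "T \<xi>"]) (auto simp: \<pi>' norm norm_diff)
  qed
qed

theorem resolution_universal: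
  fixes f :: "'g::topological_group_add \<Rightarrow> 'q::topological_group_add"
    and s :: "complex \<Rightarrow> 'v::ab_group_add \<Rightarrow> 'v"
  assumes res: "resolution f" and rep: "unitary_rep s V ip \<pi>"
    and aiv: "almost_invariant_vectors V ip \<pi>"
  shows "resolves f s V ip \<pi>"
proof -
  have H: "hilbert_space s V ip" using rep by (simp add: unitary_rep_def)
  note mem = hs_mem[OF H]
  interpret S: vector_space s by (rule hs_vs[OF H])
  have inv: "\<pi> g v \<in> V" if "v \<in> V" for g v
    using rep that unfolding unitary_rep_def unitary_operator_def by blast
  have iso: "ip (\<pi> g u) (\<pi> g v) = ip u v" if "u \<in> V" "v \<in> V" for g u v
    using rep that unfolding unitary_rep_def unitary_operator_def by blast
  have lin: "\<pi> g (u + v) = \<pi> g u + \<pi> g v" "\<pi> g (s c v) = s c (\<pi> g v)"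
    if "u \<in> V" "v \<in> V" for g c u v
    using rep that unfolding unitary_rep_def unitary_operator_def by blast+
  have mult: "\<pi> (g + h) v = \<pi> g (\<pi> h v)" "\<pi> 0 v = v" if "v \<in> V" for g h v
    using rep that unfolding unitary_rep_def by blast+
  have adj: "ip (\<pi> g u) v = ip u (\<pi> (- g) v)" if "u \<in> V" "v \<in> V" for g u v
    using iso[of u "\<pi> (- g) v" g] mult(1)[OF that(2), of g "- g"] mult(2)[OF that(2)] inv that by simp

  define good where "good K n \<xi> \<longleftrightarrow> \<xi> \<noteq> 0 \<and>
    (\<forall>g\<in>K. hnorm ip (\<pi> g \<xi> - \<xi>) \<le> inverse (real (Suc n)) * hnorm ip \<xi>)" for K n \<xi>
  have "\<exists>\<xi>\<in>V. compact K \<longrightarrow> good K n \<xi>" for K n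
  proof (cases "compact K")
    case True
    then show ?thesis
      using aiv[unfolded almost_invariant_vectors_def, rule_format, of K "inverse (real (Suc n))"]
      by (auto simp: good_def)
  qed (use mem in auto)
  then obtain \<xi> where \<xi>: "\<And>K n. \<xi> K n \<in> V" "\<And>K n. compact K \<Longrightarrow> good K n (\<xi> K n)"
    by metis

  define T where "T v = (\<lambda>(K, n, g). ip v (\<pi> g (\<xi> K n)))" for v
  have T0: "T v = 0 \<longleftrightarrow> (\<forall>K n g. ip v (\<pi> g (\<xi> K n)) = 0)" for v
    by (auto simp: T_def fun_eq_iff)
  define W where "W = {v \<in> V. \<forall>u\<in>V. T u = 0 \<longrightarrow> ip v u = 0}"
  have WV: "v \<in> W \<Longrightarrow> v \<in> V" for v by (simp add: W_def)
  have \<xi>W: "\<xi> K n \<in> W" for K n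
  proof -
    have "ip (\<xi> K n) u = 0" if "u \<in> V" "T u = 0" for u
    proof -
      have "ip u (\<pi> 0 (\<xi> K n)) = 0" using that T0 by blast
      then show ?thesis using mult(2)[OF \<xi>(1)] hs_cnj[OF H that(1) \<xi>(1)] by simp
    qed
    then show ?thesis by (simp add: W_def \<xi>)
  qed
  have T_inv: "T (\<pi> g u) = 0" if "u \<in> V" "T u = 0" for g u
    unfolding T0
  proof (intro allI)
    fix K n h
    have "ip (\<pi> g u) (\<pi> h (\<xi> K n)) = ip u (\<pi> (- g + h) (\<xi> K n))"
      using adj[OF that(1) inv[OF \<xi>(1)]] mult(1)[OF \<xi>(1)] by simp
    then show "ip (\<pi> g u) (\<pi> h (\<xi> K n)) = 0" using that T0 by simp
  qed
  have W_inv: "\<pi> g v \<in> W" if "v \<in> W" for g v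
    using that T_inv adj inv by (auto simp: W_def)
  have W_sub: "S.subspace W"
    unfolding S.subspace_def W_def
    using mem hs_zero[OF H] hs_add[OF H] hs_scale[OF H] by auto
  have HW: "hilbert_space s W ip"
    unfolding hilbert_space_def
  proof (intro conjI allI impI)
    fix h :: "nat \<Rightarrow> 'v"
    assume h: "range h \<subseteq> W" and c: "\<forall>e>0. \<exists>N. \<forall>m\<ge>N. \<forall>n\<ge>N. hnorm ip (h m - h n) < e"
    have hW: "h n \<in> W" for n using h by blast
    obtain v where v: "v \<in> V" "(\<lambda>n. hnorm ip (h n - v)) \<longlonglongrightarrow> 0"
      using hs_complete[OF H, of h] c hW WV by (auto simp: image_subset_iff)
    have "ip v u = 0" if u: "u \<in> V" "T u = 0" for u
    proof -
      have "cmod (ip v u) \<le> hnorm ip (h n - v) * hnorm ip u" for n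
      proof -
        have "ip (h n) u = 0" using hW[of n] u by (simp add: W_def)
        then have "ip (h n - v) u = - ip v u" using hs_diff[OF H WV[OF hW] v(1) u(1)] by simp
        then show ?thesis
          using hs_cauchy_schwarz[OF H mem(4)[OF WV[OF hW] v(1)] u(1), of n] by simp
      qed
      moreover have "(\<lambda>n. hnorm ip (h n - v) * hnorm ip u) \<longlonglongrightarrow> 0"
        using tendsto_mult_left_zero[OF v(2)] .
      ultimately have "cmod (ip v u) \<le> 0"
        by (intro LIMSEQ_le_const) auto
      then show ?thesis by simp
    qed
    then show "\<exists>v\<in>W. (\<lambda>n. hnorm ip (h n - v)) \<longlonglongrightarrow> 0"
      using v by (intro bexI[of _ v]) (auto simp: W_def)
  next
    show "vector_space s" by (rule hs_vs[OF H])
    show "S.subspace W" by (rule W_sub)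
    show "\<forall>u\<in>W. \<forall>v\<in>W. \<forall>w\<in>W. ip (u + v) w = ip u w + ip v w"
      using hs_add[OF H] WV by blast
    show "\<forall>v\<in>W. \<forall>w\<in>W. ip (s c v) w = c * ip v w" for c
      using hs_scale[OF H] WV by blast
    show "\<forall>v\<in>W. \<forall>w\<in>W. ip w v = cnj (ip v w)"
      using hs_cnj[OF H] WV by blast
    show "\<forall>v\<in>W. v \<noteq> 0 \<longrightarrow> 0 < Re (ip v v)"
      using hs_pos[OF H] WV by blast
  qed
  have UW: "unitary_operator s W ip (\<pi> g)" for g
  proof -
    have "v \<in> \<pi> g ` W" if "v \<in> W" for v
      using mult(1)[OF WV[OF that], of g "- g"] mult(2)[OF WV[OF that]] W_inv[OF that, of "- g"]
      by (intro image_eqI[of _ _ "\<pi> (- g) v"]) auto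
    then have "\<pi> g ` W = W" using W_inv by blast
    then show ?thesis
      unfolding unitary_operator_def using lin[OF WV WV] iso[OF WV WV] by simp
  qed
  have repW: "unitary_rep s W ip \<pi>"
    using rep HW UW WV unfolding unitary_rep_def by simp
  have aivW: "almost_invariant_vectors W ip \<pi>"
    unfolding almost_invariant_vectors_def
  proof (intro allI impI)
    fix K :: "'g set" and e :: real assume K: "compact K" and e: "e > 0"
    obtain n where n: "inverse (real (Suc n)) < e" using reals_Archimedean[OF e] by blast
    have "hnorm ip (\<xi> K n) \<ge> 0" using hs_nonneg[OF H \<xi>(1)] by (simp add: hnorm_def)
    then have "inverse (real (Suc n)) * hnorm ip (\<xi> K n) \<le> e * hnorm ip (\<xi> K n)"
      using n by (intro mult_right_mono) auto
    then show "\<exists>\<xi>\<in>W. \<xi> \<noteq> 0 \<and> (\<forall>g\<in>K. hnorm ip (\<pi> g \<xi> - \<xi>) \<le> e * hnorm ip \<xi>)"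
      using \<xi>(2)[OF K, of n] \<xi>W[of K n] unfolding good_def by (meson order_trans)
  qed

  have T_add: "T (u + v) = T u + T v" if "u \<in> V" "v \<in> V" for u v
    using hs_add[OF H] that inv \<xi>(1) by (auto simp: T_def fun_eq_iff)
  have T_scale: "T (s c v) = fscale c (T v)" if "v \<in> V" for c v
    using hs_scale[OF H] that inv \<xi>(1) by (auto simp: T_def fscale_def fun_eq_iff)
  have T_inj: "v = 0" if "v \<in> W" "T v = 0" for v
    using that hs_pos[OF H WV[OF that(1)]] by (auto simp: W_def)
  have inj: "inj_on T W"
  proof (rule inj_onI)
    fix u v assume uv: "u \<in> W" "v \<in> W" "T u = T v"
    have d: "u - v \<in> W" using W_sub uv S.subspace_diff by blast
    then have "T u = T (u - v) + T v" using T_add[of "u - v" v] WV uv by simp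
    then have "u - v = 0" using T_inj[OF d] uv by simp
    then show "u = v" by simp
  qed
  define R where "R = inv_into W T"
  have R: "R (T v) = v" if "v \<in> W" for v using inj that by (simp add: R_def)
  define ip' where "ip' a b = ip (R a) (R b)" for a b
  define \<pi>' where "\<pi>' g a = T (\<pi> g (R a))" for g a
  have rep': "unitary_rep fscale (T ` W) ip' \<pi>'" and aiv': "almost_invariant_vectors (T ` W) ip' \<pi>'"
    using unitary_rep_transport[OF repW vector_space_fscale, of T ip' \<pi>']
      aivW T_add T_scale T_inj R WV by (auto simp: ip'_def \<pi>'_def)
  obtain U \<rho> where U: "U \<subseteq> T ` W" "U \<noteq> {0}"
    and repU: "unitary_rep fscale U ip' \<pi>'" and rep\<rho>: "unitary_rep fscale U ip' \<rho>"
    and fac: "\<And>g v. v \<in> U \<Longrightarrow> \<pi>' g v = \<rho> (f g) v"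
    and aiv\<rho>: "almost_invariant_vectors U ip' \<rho>"
    using res rep' aiv' unfolding resolution_def resolves_def by metis
  have UT: "\<exists>v\<in>W. a = T v" if "a \<in> U" for a using that U by blast
  have HU: "hilbert_space fscale U ip'" using repU by (simp add: unitary_rep_def)
  have TR: "T (R a) = a" "R a \<in> W" if "a \<in> U" for a using UT[OF that] R by auto
  have R_add: "R (a + b) = R a + R b" if "a \<in> U" "b \<in> U" for a b
    using R[of "R a + R b"] T_add[of "R a" "R b"] TR that WV W_sub S.subspace_add by metis
  have R_scale: "R (fscale c a) = s c (R a)" if "a \<in> U" for a c
    using R[of "s c (R a)"] T_scale[of "R a"] TR that WV W_sub S.subspace_scale by metis
  have R_inj: "a = 0" if "a \<in> U" "R a = 0" for a
    using TR[OF that(1)] that(2) T_scale[OF mem(1), of 0] by (simp add: fscale_def fun_eq_iff)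
  have R_\<pi>: "\<pi> g (R a) = R (\<pi>' g a)" if "a \<in> U" for g a
    using R W_inv TR that by (simp add: \<pi>'_def)
  define \<sigma> where "\<sigma> q v = R (\<rho> q (T v))" for q v
  have 1: "unitary_rep s (R ` U) ip \<pi>"
    using unitary_rep_transport(1)[OF repU hs_vs[OF H], of R ip \<pi>] R_add R_scale R_inj R_\<pi>
    by (auto simp: ip'_def)
  have 2: "unitary_rep s (R ` U) ip \<sigma>" "almost_invariant_vectors (R ` U) ip \<sigma>"
    using unitary_rep_transport[OF rep\<rho> hs_vs[OF H], of R ip \<sigma>] aiv\<rho> R_add R_scale R_inj TR
    by (auto simp: ip'_def \<sigma>_def)
  have 3: "\<pi> g v = \<sigma> (f g) v" if "v \<in> R ` U" for g v
    using that R_\<pi> fac TR by (auto simp: \<sigma>_def)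
  have "0 \<in> U" using hs_mem(1)[OF HU] .
  then obtain a where "a \<in> U" "a \<noteq> 0" using U(2) by blast
  then have 4: "R ` U \<noteq> {0}" using R_inj by blast
  have 5: "R ` U \<subseteq> V" using TR WV by blast
  show ?thesis unfolding resolves_def using 1 2 3 4 5 by blast
qed

end

theory Submission
  imports Defs "HOL-Library.Poly_Mapping"
begin

text \<open>
  Two approximation steps reduce relative Property (T) of \<open>X\<close> to that of \<open>p ` X\<close>.

  First, let \<open>V\<close> be the direct sum of the GNS representations of all normalized positive definite
  functions on \<open>H\<close>, and let \<open>W\<close> consist of the vectors whose orbit map is continuous for the topology
  that \<open>p\<close> induces on \<open>H\<close>. Since \<open>p\<close> is a resolution and the orthogonal complement of \<open>W\<close> contains no
  nonzero vector of this kind, this complement does not almost have invariant vectors. Hence a cyclic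
  vector which is almost invariant under a suitable compact set is close to \<open>W\<close>, so that every
  positive definite function on \<open>H\<close> close to \<open>1\<close> on that set is uniformly close to a pullback from \<open>Q\<close>.

  Second, if positive definite functions on \<open>Q\<close> tend to \<open>1\<close> uniformly on \<open>p ` K\<close> for all compact \<open>K\<close>,
  then they do so on compact subsets of \<open>Q\<close>. Otherwise there are functions \<open>\<phi> n\<close>, rapidly tending to \<open>1\<close> on
  \<open>p ` K\<close>, and points \<open>v n\<close> of a fixed compact neighbourhood of \<open>0\<close> such that \<open>1 - Re (\<phi> n (v n))\<close> is
  bounded below, while \<open>1 - Re (\<phi> k (v n)) < 2\<^sup>-\<^sup>n\<close> for \<open>k < n\<close>. The infinite products of the \<open>2\<^sup>n\<close>-th
  powers of \<open>(1 + Re (\<phi> n)) / 2\<close> pull back to continuous positive definite functions on \<open>H\<close>; as these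
  approximate \<open>1\<close>, some GNS space contains a vector continuous along \<open>p\<close>. This bounds
  \<open>2\<^sup>n (1 - Re (\<phi> n))\<close> on a neighbourhood of \<open>0\<close> uniformly in \<open>n\<close>, for one of the sequences, which is absurd
  near a cluster point of \<open>v\<close>, since all \<open>\<phi> k\<close> are \<open>1\<close> there.
\<close>

section \<open>Inner products and completions\<close>

text \<open>Definiteness is left out so that the form of a positive definite kernel, which may have
  null vectors, is covered; the carrier \<open>V\<close> makes the same lemmas available on
  completions and on subspaces.\<close>

locale semi_inner =
  fixes s :: "complex \<Rightarrow> 'v::ab_group_add \<Rightarrow> 'v" and V :: "'v set" and ip :: "'v \<Rightarrow> 'v \<Rightarrow> complex"
  assumes vs: "vector_space s" and sub: "module.subspace s V"
    and ip_add: "u \<in> V \<Longrightarrow> v \<in> V \<Longrightarrow> w \<in> V \<Longrightarrow> ip (u + v) w = ip u w + ip v w"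
    and ip_scale: "v \<in> V \<Longrightarrow> w \<in> V \<Longrightarrow> ip (s c v) w = c * ip v w"
    and ip_cnj: "v \<in> V \<Longrightarrow> w \<in> V \<Longrightarrow> ip w v = cnj (ip v w)"
    and ip_nonneg: "v \<in> V \<Longrightarrow> Re (ip v v) \<ge> 0"
begin

sublocale vector_space s by (rule vs)

lemma mem: "0 \<in> V" "u \<in> V \<Longrightarrow> v \<in> V \<Longrightarrow> u + v \<in> V" "v \<in> V \<Longrightarrow> s c v \<in> V"
    "u \<in> V \<Longrightarrow> v \<in> V \<Longrightarrow> u - v \<in> V" "v \<in> V \<Longrightarrow> - v \<in> V"
  by (rule subspace_0[OF sub], erule (1) subspace_add[OF sub], erule subspace_scale[OF sub],
      erule (1) subspace_diff[OF sub], erule subspace_neg[OF sub])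

lemma ip_diff: "u \<in> V \<Longrightarrow> v \<in> V \<Longrightarrow> w \<in> V \<Longrightarrow> ip (u - v) w = ip u w - ip v w"
  using ip_add[of "u - v" v w] mem(4)[of u v] by simp

lemma ip_zero: "w \<in> V \<Longrightarrow> ip 0 w = 0" "w \<in> V \<Longrightarrow> ip w 0 = 0"
  using ip_scale[of 0 w 0] ip_cnj[of 0 w] mem(1) by simp_all

lemma ip_right:
  assumes "u \<in> V" "v \<in> V" "w \<in> V"
  shows "ip w (u + v) = ip w u + ip w v" "ip w (u - v) = ip w u - ip w v"
    "ip w (s c v) = cnj c * ip w v"
  using assms mem ip_cnj[of "u + v" w] ip_cnj[of "u - v" w] ip_cnj[of "s c v" w]
    ip_cnj[of u w] ip_cnj[of v w] by (simp_all add: ip_add ip_diff ip_scale)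

lemma ip_self: "v \<in> V \<Longrightarrow> ip v v = of_real ((hnorm ip v)\<^sup>2)"
  using ip_cnj[of v v] ip_nonneg[of v] by (simp add: hnorm_def complex_eq_iff)

lemma hnorm_nonneg: "v \<in> V \<Longrightarrow> hnorm ip v \<ge> 0"
  using ip_nonneg by (simp add: hnorm_def)

lemma hnorm_zero: "hnorm ip 0 = 0"
  using ip_zero[OF mem(1)] by (simp add: hnorm_def)

lemma hnorm_diff_sq:
  assumes "u \<in> V" "v \<in> V"
  shows "(hnorm ip (u - v))\<^sup>2 = (hnorm ip u)\<^sup>2 + (hnorm ip v)\<^sup>2 - 2 * Re (ip u v)"
proof -
  have "complex_of_real ((hnorm ip (u - v))\<^sup>2) = ip (u - v) (u - v)"
    by (rule ip_self[symmetric]) (use mem(4) assms in simp)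
  also have "\<dots> = of_real ((hnorm ip u)\<^sup>2 + (hnorm ip v)\<^sup>2) - (ip u v + cnj (ip u v))"
    using assms mem(4) ip_cnj[OF assms] by (simp add: ip_diff ip_right ip_self[symmetric] flip: of_real_power)
  finally show ?thesis by (simp add: complex_eq_iff)
qed

lemma hnorm_add_sq:
  assumes "u \<in> V" "v \<in> V"
  shows "(hnorm ip (u + v))\<^sup>2 = (hnorm ip u)\<^sup>2 + (hnorm ip v)\<^sup>2 + 2 * Re (ip u v)"
proof -
  have "complex_of_real ((hnorm ip (u + v))\<^sup>2) = ip (u + v) (u + v)"
    by (rule ip_self[symmetric]) (use mem(2) assms in simp)
  also have "\<dots> = of_real ((hnorm ip u)\<^sup>2 + (hnorm ip v)\<^sup>2) + (ip u v + cnj (ip u v))"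
    using assms mem(2) ip_cnj[OF assms] by (simp add: ip_add ip_right ip_self[symmetric] flip: of_real_power)
  finally show ?thesis by (simp add: complex_eq_iff)
qed

lemma hnorm_scale:
  assumes "v \<in> V"
  shows "hnorm ip (s c v) = cmod c * hnorm ip v"
proof -
  have "ip (s c v) (s c v) = (c * cnj c) * of_real ((hnorm ip v)\<^sup>2)"
    using assms mem(3) by (simp add: ip_scale ip_right ip_self[symmetric] flip: of_real_power)
  also have "\<dots> = of_real ((cmod c * hnorm ip v)\<^sup>2)"
    by (simp add: complex_norm_square[symmetric] power_mult_distrib del: complex_mult_cnj)
  finally show ?thesis
    using hnorm_nonneg[OF assms] by (subst hnorm_def) simp
qed

text \<open>Without definiteness one cannot simply divide by the norm of \<open>v\<close>. Expanding
  the squared norm of \<open>u - t b v\<close> with \<open>b = ip u v\<close> gives an inequality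
  for every real \<open>t\<close>, and \<open>t\<close> is chosen according to whether
  \<open>v\<close> is a null vector.\<close>

lemma cauchy_schwarz:
  assumes "u \<in> V" "v \<in> V"
  shows "cmod (ip u v) \<le> hnorm ip u * hnorm ip v"
proof -
  define a b where "a = (hnorm ip v)\<^sup>2" and "b = ip u v"
  have main: "2 * t * (cmod b)\<^sup>2 \<le> (hnorm ip u)\<^sup>2 + t\<^sup>2 * (cmod b)\<^sup>2 * a" for t :: real
  proof -
    let ?c = "complex_of_real t * b"
    have "0 \<le> (hnorm ip (u - s ?c v))\<^sup>2" by simp
    also have "\<dots> = (hnorm ip u)\<^sup>2 + (cmod ?c * hnorm ip v)\<^sup>2 - 2 * Re (cnj ?c * b)"
      using assms mem(3) by (simp only: hnorm_diff_sq hnorm_scale ip_right(3)[OF assms(2,2,1)] b_def)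
    also have "cnj ?c * b = of_real (t * (cmod b)\<^sup>2)"
      using complex_norm_square[of b] by (simp add: mult.assoc mult.commute)
    also have "(cmod ?c * hnorm ip v)\<^sup>2 = t\<^sup>2 * (cmod b)\<^sup>2 * a"
      by (simp add: norm_mult power_mult_distrib a_def)
    finally show ?thesis by simp
  qed
  have "(cmod b)\<^sup>2 \<le> (hnorm ip u)\<^sup>2 * a"
  proof (cases "a = 0")
    case True
    have "b = 0"
    proof (rule ccontr)
      assume "b \<noteq> 0"
      then show False
        \<comment> \<open>This \<open>t\<close> makes the left side exceed the squared norm of
          \<open>u\<close> by one, while \<open>a = 0\<close> removes the quadratic term on the
          right.\<close>
        using main[of "((hnorm ip u)\<^sup>2 + 1) / (2 * (cmod b)\<^sup>2)"] True by simp
    qed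
    then show ?thesis using True by simp
  next
    case False
    then have "a > 0" by (simp add: a_def)
    then show ?thesis using main[of "1 / a"] by (simp add: field_simps power2_eq_square)
  qed
  then have "(cmod b)\<^sup>2 \<le> (hnorm ip u * hnorm ip v)\<^sup>2"
    by (simp add: a_def power_mult_distrib)
  then show ?thesis
    using assms hnorm_nonneg by (auto simp: b_def intro: power2_le_imp_le)
qed

lemma hnorm_triangle:
  assumes "u \<in> V" "v \<in> V"
  shows "hnorm ip (u + v) \<le> hnorm ip u + hnorm ip v"
proof (rule power2_le_imp_le)
  have "Re (ip u v) \<le> hnorm ip u * hnorm ip v"
    using cauchy_schwarz[OF assms] complex_Re_le_cmod order_trans by blast
  then show "(hnorm ip (u + v))\<^sup>2 \<le> (hnorm ip u + hnorm ip v)\<^sup>2"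
    by (simp add: hnorm_add_sq[OF assms] power2_sum)
qed (use assms hnorm_nonneg in simp)

lemma hnorm_minus: "v \<in> V \<Longrightarrow> hnorm ip (- v) = hnorm ip v"
  using hnorm_scale[of v "-1"] by (simp add: scale_minus_left)

lemma hnorm_minus_commute: "u \<in> V \<Longrightarrow> v \<in> V \<Longrightarrow> hnorm ip (u - v) = hnorm ip (v - u)"
  using hnorm_minus[of "u - v"] mem(4) by simp

lemma hnorm_triangle_diff:
  "u \<in> V \<Longrightarrow> v \<in> V \<Longrightarrow> w \<in> V \<Longrightarrow> hnorm ip (u - w) \<le> hnorm ip (u - v) + hnorm ip (v - w)"
  using hnorm_triangle[of "u - v" "v - w"] mem(4) by simp

lemma hnorm_diff_le: "u \<in> V \<Longrightarrow> v \<in> V \<Longrightarrow> \<bar>hnorm ip u - hnorm ip v\<bar> \<le> hnorm ip (u - v)"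
  using hnorm_triangle_diff[of u v 0] hnorm_triangle_diff[of v u 0] mem(1)
  by (simp add: hnorm_minus_commute)

end

lemma hilbert_semi_inner: "hilbert_space s V ip \<Longrightarrow> semi_inner s V ip"
  by (rule semi_inner.intro)
    (fact hs_vs hs_sub hs_add hs_scale hs_cnj hs_nonneg)+

section \<open>Completion of a space with a semidefinite form by Cauchy sequences\<close>

locale pre_hilbert = semi_inner s UNIV B
  for s :: "complex \<Rightarrow> 'a::ab_group_add \<Rightarrow> 'a" and B :: "'a \<Rightarrow> 'a \<Rightarrow> complex"
begin

abbreviation N :: "'a \<Rightarrow> real" where "N \<equiv> hnorm B"

definition csq :: "(nat \<Rightarrow> 'a) \<Rightarrow> bool" where
  "csq x \<longleftrightarrow> (\<forall>e>0. \<exists>M. \<forall>m\<ge>M. \<forall>n\<ge>M. N (x m - x n) < e)"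

lemma csq_const: "csq (\<lambda>_. a)"
  by (simp add: csq_def hnorm_zero)

text \<open>The shape of the bound lets sums (\<open>c = 1\<close>) and scalar multiples
  (\<open>c\<close> the modulus of the scalar) share one epsilon argument.\<close>

lemma csq_le:
  assumes "csq x" "csq y" and le: "\<And>m n. N (z m - z n) \<le> c * N (x m - x n) + N (y m - y n)"
  shows "csq z"
  unfolding csq_def
proof (intro allI impI)
  fix e :: real assume "e > 0"
  define d where "d = e / 2 / (\<bar>c\<bar> + 1)"
  have "\<bar>c\<bar> + 1 \<noteq> 0" by linarith
  then have "(\<bar>c\<bar> + 1) * d = e / 2" unfolding d_def by (rule nonzero_mult_div_cancel_left[THEN trans[OF times_divide_eq_right]])
  then have d: "\<bar>c\<bar> * d + d = e / 2" by (simp only: distrib_right mult_1)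
  have "d > 0" using \<open>e > 0\<close> by (simp add: d_def)
  obtain M1 where M1: "\<And>m n. m \<ge> M1 \<Longrightarrow> n \<ge> M1 \<Longrightarrow> N (x m - x n) < d"
    using assms(1) \<open>d > 0\<close> unfolding csq_def by blast
  obtain M2 where M2: "\<And>m n. m \<ge> M2 \<Longrightarrow> n \<ge> M2 \<Longrightarrow> N (y m - y n) < d"
    using assms(2) \<open>d > 0\<close> unfolding csq_def by blast
  have "N (z m - z n) < e" if "m \<ge> max M1 M2" "n \<ge> max M1 M2" for m n
  proof -
    have "c * N (x m - x n) \<le> \<bar>c\<bar> * N (x m - x n)"
      using hnorm_nonneg[of "x m - x n"] by (intro mult_right_mono) auto
    also have "\<dots> \<le> \<bar>c\<bar> * d" using M1[of m n] that by (intro mult_left_mono) auto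
    finally have "N (z m - z n) \<le> \<bar>c\<bar> * d + d" using le[of m n] M2[of m n] that by simp
    then show ?thesis using d \<open>e > 0\<close> by simp
  qed
  then show "\<exists>M. \<forall>m\<ge>M. \<forall>n\<ge>M. N (z m - z n) < e" by blast
qed

lemma csq_add: "csq x \<Longrightarrow> csq y \<Longrightarrow> csq (\<lambda>n. x n + y n)"
  by (rule csq_le[of x y _ 1], assumption+)
    (metis UNIV_I add_diff_add hnorm_triangle mult_1)

lemma csq_scale: "csq x \<Longrightarrow> csq (\<lambda>n. s c (x n))"
  by (rule csq_le[of x x _ "cmod c"], assumption+)
    (simp add: scale_right_diff_distrib[symmetric] hnorm_scale hnorm_nonneg)

lemma csq_diff: "csq x \<Longrightarrow> csq y \<Longrightarrow> csq (\<lambda>n. x n - y n)"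
  using csq_add[of x "\<lambda>n. s (-1) (y n)"] csq_scale[of y "-1"] by (simp add: scale_minus_left)

lemma csq_bounded:
  assumes "csq x"
  obtains M where "M > 0" "\<And>n. N (x n) \<le> M"
proof -
  obtain k where k: "\<And>m n. m \<ge> k \<Longrightarrow> n \<ge> k \<Longrightarrow> N (x m - x n) < 1"
    using assms unfolding csq_def by (metis zero_less_one)
  define M where "M = (\<Sum>i\<le>k. N (x i)) + 1"
  have pos: "(\<Sum>i\<le>k. N (x i)) \<ge> 0" by (intro sum_nonneg) (simp add: hnorm_nonneg)
  have le: "N (x n) \<le> (\<Sum>i\<le>k. N (x i))" if "n \<le> k" for n
    using that by (intro member_le_sum) (auto simp: hnorm_nonneg)
  have "N (x n) \<le> M" for n
  proof (cases "n \<le> k")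
    case False
    then have "N (x n - x k) < 1" using k by simp
    then show ?thesis using hnorm_diff_le[of "x n" "x k"] le[of k] by (simp add: M_def)
  qed (use le[of n] in \<open>simp add: M_def\<close>)
  then show ?thesis using that[of M] pos by (simp add: M_def)
qed

lemma B_diff_le:
  "cmod (B u v - B u' v') \<le> N (u - u') * N v + N u' * N (v - v')"
proof -
  have "B u v - B u' v' = B (u - u') v + B u' (v - v')"
    by (simp add: ip_diff ip_right)
  also have "cmod \<dots> \<le> cmod (B (u - u') v) + cmod (B u' (v - v'))"
    by (rule norm_triangle_ineq)
  finally show ?thesis
    using cauchy_schwarz[of "u - u'" v] cauchy_schwarz[of u' "v - v'"] by simp
qed

lemma csq_convergent:
  assumes "csq x" "csq y"
  shows "convergent (\<lambda>n. B (x n) (y n))"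
  unfolding Cauchy_convergent_iff[symmetric]
proof (rule CauchyI)
  fix e :: real assume "e > 0"
  obtain M1 where M1: "M1 > 0" "\<And>n. N (x n) \<le> M1" using csq_bounded[OF assms(1)] by blast
  obtain M2 where M2: "M2 > 0" "\<And>n. N (y n) \<le> M2" using csq_bounded[OF assms(2)] by blast
  \<comment> \<open>Scaling each sequence by the bound for the other turns the two error terms of
    \<open>B_diff_le\<close> into Cauchy differences, to be kept below \<open>e / 2\<close>.\<close>
  have "csq (\<lambda>n. s (of_real M2) (x n))" "csq (\<lambda>n. s (of_real M1) (y n))"
    using assms csq_scale by blast+
  moreover have "N (s (of_real c) (z m) - s (of_real c) (z n)) = c * N (z m - z n)"
    if "c > 0" for c z and m n :: nat
    using that by (simp add: scale_right_diff_distrib[symmetric] hnorm_scale)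
  ultimately obtain k1 k2 where
    k1: "\<And>m n. m \<ge> k1 \<Longrightarrow> n \<ge> k1 \<Longrightarrow> M2 * N (x m - x n) < e / 2" and
    k2: "\<And>m n. m \<ge> k2 \<Longrightarrow> n \<ge> k2 \<Longrightarrow> M1 * N (y m - y n) < e / 2"
    using M1(1) M2(1) \<open>e > 0\<close> unfolding csq_def by (metis half_gt_zero)
  have "cmod (B (x m) (y m) - B (x n) (y n)) < e" if "m \<ge> max k1 k2" "n \<ge> max k1 k2" for m n
  proof -
    have "N (x m - x n) * N (y m) \<le> N (x m - x n) * M2" "N (x n) * N (y m - y n) \<le> M1 * N (y m - y n)"
      using M1(2)[of n] M2(2)[of m] by (auto intro!: mult_left_mono mult_right_mono hnorm_nonneg)
    then show ?thesis
      using B_diff_le[of "x m" "y m" "x n" "y n"] k1[of m n] k2[of m n] that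
      by (simp add: mult.commute)
  qed
  then show "\<exists>M. \<forall>m\<ge>M. \<forall>n\<ge>M. norm (B (x m) (y m) - B (x n) (y n)) < e" by blast
qed

text \<open>
  A vector of the completion is represented by the functional it induces on the dense subspace,
  which identifies equivalent Cauchy sequences.
\<close>

definition emb :: "(nat \<Rightarrow> 'a) \<Rightarrow> 'a \<Rightarrow> complex" where
  "emb x y = lim (\<lambda>n. B (x n) y)"

definition compl :: "('a \<Rightarrow> complex) set" where
  "compl = emb ` {x. csq x}"

text \<open>Representatives are chosen arbitrarily here; \<open>cip_tendsto\<close> shows that all
  Cauchy sequences with the same functionals give the same value.\<close>

definition cip :: "('a \<Rightarrow> complex) \<Rightarrow> ('a \<Rightarrow> complex) \<Rightarrow> complex" where
  "cip f g = (let rep = \<lambda>f. SOME x. csq x \<and> emb x = f in lim (\<lambda>n. B (rep f n) (rep g n)))"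

lemma emb_tendsto: "csq x \<Longrightarrow> (\<lambda>n. B (x n) y) \<longlonglongrightarrow> emb x y"
  using csq_convergent[OF _ csq_const, of x y] by (simp add: emb_def convergent_LIMSEQ_iff)

lemma emb_add: "csq x \<Longrightarrow> csq y \<Longrightarrow> emb (\<lambda>n. x n + y n) = emb x + emb y"
  by (rule ext, rule LIMSEQ_unique[OF emb_tendsto])
    (auto simp: csq_add ip_add intro!: tendsto_add emb_tendsto)

lemma emb_scale: "csq x \<Longrightarrow> emb (\<lambda>n. s c (x n)) = fscale c (emb x)"
  by (rule ext, rule LIMSEQ_unique[OF emb_tendsto])
    (auto simp: csq_scale ip_scale fscale_def intro!: tendsto_mult emb_tendsto)

lemma emb_diff: "csq x \<Longrightarrow> csq y \<Longrightarrow> emb (\<lambda>n. x n - y n) = emb x - emb y"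
  by (rule ext, rule LIMSEQ_unique[OF emb_tendsto])
    (auto simp: csq_diff ip_diff intro!: tendsto_diff emb_tendsto)

text \<open>Passing to functionals identifies only sequences that differ by a null sequence. In
  \<open>B (z n) (z n) = B (z n) (z n - z k) + B (z n) (z k)\<close> the first term is small by the
  Cauchy property and boundedness, the second because \<open>k\<close> is fixed and the functional
  vanishes.\<close>

lemma emb_zero_imp_null:
  assumes z: "csq z" "emb z = 0"
  shows "(\<lambda>n. N (z n)) \<longlonglongrightarrow> 0"
proof (rule LIMSEQ_I)
  fix r :: real assume "r > 0"
  obtain M where M: "M > 0" "\<And>n. N (z n) \<le> M" using csq_bounded[OF z(1)] by blast
  define e where "e = r\<^sup>2 / (2 * M)"
  have e: "e > 0" "M * e = r\<^sup>2 / 2" using \<open>r > 0\<close> M by (simp_all add: e_def)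
  obtain k where k: "\<And>m n. m \<ge> k \<Longrightarrow> n \<ge> k \<Longrightarrow> N (z m - z n) < e"
    using z(1) e unfolding csq_def by blast
  have "(\<lambda>n. B (z n) (z k)) \<longlonglongrightarrow> 0" using emb_tendsto[OF z(1), of "z k"] z(2) by simp
  moreover have "r\<^sup>2 / 2 > 0" using \<open>r > 0\<close> by simp
  ultimately obtain k' where k': "\<And>n. n \<ge> k' \<Longrightarrow> cmod (B (z n) (z k)) < r\<^sup>2 / 2"
    using LIMSEQ_D by (metis diff_zero)
  have "norm (N (z n) - 0) < r" if "n \<ge> max k k'" for n
  proof -
    have "(N (z n))\<^sup>2 = cmod (B (z n) (z n))" by (simp add: ip_self norm_power)
    also have "B (z n) (z n) = B (z n) (z n - z k) + B (z n) (z k)" by (simp add: ip_right)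
    also have "cmod \<dots> \<le> cmod (B (z n) (z n - z k)) + cmod (B (z n) (z k))"
      by (rule norm_triangle_ineq)
    also have "cmod (B (z n) (z n - z k)) \<le> N (z n) * N (z n - z k)"
      by (rule cauchy_schwarz) auto
    also have "\<dots> \<le> M * e"
      using M k[of n k] that by (intro mult_mono) (auto simp: hnorm_nonneg less_imp_le)
    also have "M * e + cmod (B (z n) (z k)) < r\<^sup>2" using k'[of n] that e by simp
    finally have "N (z n) < r" using \<open>r > 0\<close> by (simp add: power2_less_imp_less)
    then show ?thesis using hnorm_nonneg[of "z n"] by simp
  qed
  then show "\<exists>no. \<forall>n\<ge>no. norm (N (z n) - 0) < r" by blast
qed

text \<open>Two Cauchy sequences inducing the same functional differ by a sequence whose norms tend
  to \<open>0\<close>, so \<open>B\<close> has the same limit along both.\<close>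

lemma cip_tendsto:
  assumes "csq x" "csq y"
  shows "(\<lambda>n. B (x n) (y n)) \<longlonglongrightarrow> cip (emb x) (emb y)"
proof -
  define rep where "rep f = (SOME x. csq x \<and> emb x = f)" for f
  have rep: "csq (rep (emb z))" "emb (rep (emb z)) = emb z" if "csq z" for z
    using someI[of "\<lambda>x. csq x \<and> emb x = emb z" z] that unfolding rep_def by auto
  define x' y' where "x' = rep (emb x)" and "y' = rep (emb y)"
  have c: "csq x'" "csq y'" "emb x' = emb x" "emb y' = emb y"
    using rep assms by (simp_all add: x'_def y'_def)
  have nx: "(\<lambda>n. N (x n - x' n)) \<longlonglongrightarrow> 0" and ny: "(\<lambda>n. N (y n - y' n)) \<longlonglongrightarrow> 0"
    using assms c by (auto intro!: emb_zero_imp_null simp: csq_diff emb_diff)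
  obtain M1 where M1: "\<And>n. N (y n) \<le> M1" using csq_bounded[OF assms(2)] by metis
  obtain M2 where M2: "\<And>n. N (x' n) \<le> M2" using csq_bounded[OF c(1)] by metis
  have "(\<lambda>n. B (x n) (y n) - B (x' n) (y' n)) \<longlonglongrightarrow> 0"
  proof (rule Lim_null_comparison)
    show "\<forall>\<^sub>F n in sequentially. norm (B (x n) (y n) - B (x' n) (y' n))
        \<le> N (x n - x' n) * M1 + M2 * N (y n - y' n)"
    proof (intro always_eventually allI)
      fix n
      have "N (x n - x' n) * N (y n) \<le> N (x n - x' n) * M1"
        "N (x' n) * N (y n - y' n) \<le> M2 * N (y n - y' n)"
        using M1 M2 by (auto intro!: mult_left_mono mult_right_mono hnorm_nonneg)
      then show "norm (B (x n) (y n) - B (x' n) (y' n)) \<le> N (x n - x' n) * M1 + M2 * N (y n - y' n)"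
        using B_diff_le[of "x n" "y n" "x' n" "y' n"] by linarith
    qed
    show "(\<lambda>n. N (x n - x' n) * M1 + M2 * N (y n - y' n)) \<longlonglongrightarrow> 0"
      using tendsto_add[OF tendsto_mult_left_zero[OF nx] tendsto_mult_right_zero[OF ny]] by simp
  qed
  moreover have "(\<lambda>n. B (x' n) (y' n)) \<longlonglongrightarrow> cip (emb x) (emb y)"
    using csq_convergent[OF c(1,2)]
    by (simp add: cip_def Let_def x'_def y'_def rep_def convergent_LIMSEQ_iff)
  ultimately show ?thesis using tendsto_add by fastforce
qed

lemma hnorm_cip_tendsto: "csq x \<Longrightarrow> (\<lambda>n. N (x n)) \<longlonglongrightarrow> hnorm cip (emb x)"
  unfolding hnorm_def by (intro tendsto_intros cip_tendsto)

lemma compl_cases: "f \<in> compl \<Longrightarrow> (\<And>x. csq x \<Longrightarrow> f = emb x \<Longrightarrow> thesis) \<Longrightarrow> thesis"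
  by (auto simp: compl_def)

lemma emb_compl: "csq x \<Longrightarrow> emb x \<in> compl"
  by (simp add: compl_def)

sublocale C: semi_inner fscale compl cip
proof unfold_locales
  show "module.subspace fscale compl"
  proof -
    interpret F: vector_space fscale by (rule vector_space_fscale)
    have "emb (\<lambda>_. 0) = 0"
      by (rule ext, rule LIMSEQ_unique[OF emb_tendsto]) (simp_all add: csq_const ip_zero)
    then have "0 \<in> compl" using emb_compl[OF csq_const] by metis
    then show ?thesis
      unfolding F.subspace_def
      by (auto elim!: compl_cases simp flip: emb_add emb_scale intro!: emb_compl csq_add csq_scale)
  qed
  show "cip (u + v) w = cip u w + cip v w" if "u \<in> compl" "v \<in> compl" "w \<in> compl" for u v w
    using that
  proof (elim compl_cases, hypsubst)
    fix x y z assume "csq x" "csq y" "csq z"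
    then show "cip (emb x + emb y) (emb z) = cip (emb x) (emb z) + cip (emb y) (emb z)"
      unfolding emb_add[OF \<open>csq x\<close> \<open>csq y\<close>, symmetric]
      by (intro LIMSEQ_unique[OF cip_tendsto]) (auto simp: ip_add csq_add intro!: tendsto_add cip_tendsto)
  qed
  show "cip (fscale c v) w = c * cip v w" if "v \<in> compl" "w \<in> compl" for c v w
    using that
  proof (elim compl_cases, hypsubst)
    fix x y assume "csq x" "csq y"
    then show "cip (fscale c (emb x)) (emb y) = c * cip (emb x) (emb y)"
      unfolding emb_scale[OF \<open>csq x\<close>, symmetric]
      by (intro LIMSEQ_unique[OF cip_tendsto]) (auto simp: ip_scale csq_scale intro!: tendsto_mult cip_tendsto)
  qed
  show "cip w v = cnj (cip v w)" if "v \<in> compl" "w \<in> compl" for v w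
    using that
  proof (elim compl_cases, hypsubst)
    fix x y assume "csq x" "csq y"
    then show "cip (emb y) (emb x) = cnj (cip (emb x) (emb y))"
      using tendsto_cnj[OF cip_tendsto[of x y]] LIMSEQ_unique[OF cip_tendsto[of y x]]
      by (simp flip: ip_cnj)
  qed
  show "Re (cip v v) \<ge> 0" if "v \<in> compl" for v
    using that
  proof (elim compl_cases, hypsubst)
    fix x assume "csq x"
    then show "Re (cip (emb x) (emb x)) \<ge> 0"
      by (intro LIMSEQ_le_const[OF tendsto_Re[OF cip_tendsto]]) (auto simp: ip_nonneg)
  qed
qed (auto simp: fscale_def fun_eq_iff algebra_simps)

definition inc :: "'a \<Rightarrow> 'a \<Rightarrow> complex" where
  "inc a = emb (\<lambda>_. a)"

lemma inc_compl: "inc a \<in> compl"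
  by (simp add: inc_def emb_compl csq_const)

lemma inc_ip: "cip (inc a) (inc b) = B a b"
  unfolding inc_def by (rule LIMSEQ_unique[OF cip_tendsto]) (auto simp: csq_const)

lemma inc_diff: "inc (a - b) = inc a - inc b"
  unfolding inc_def by (simp add: emb_diff csq_const)

lemma inc_norm: "hnorm cip (inc a) = N a"
  by (simp add: hnorm_def inc_ip)

lemma inc_tendsto:
  assumes "csq x"
  shows "(\<lambda>n. hnorm cip (emb x - inc (x n))) \<longlonglongrightarrow> 0"
proof (rule LIMSEQ_I)
  fix r :: real assume "r > 0"
  then obtain k where k: "\<And>m n. m \<ge> k \<Longrightarrow> n \<ge> k \<Longrightarrow> N (x m - x n) < r / 2"
    using assms unfolding csq_def by (metis half_gt_zero)
  have "hnorm cip (emb x - inc (x n)) \<le> r / 2" if "n \<ge> k" for n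
  proof (rule LIMSEQ_le_const2)
    show "(\<lambda>m. N (x m - x n)) \<longlonglongrightarrow> hnorm cip (emb x - inc (x n))"
      using hnorm_cip_tendsto[OF csq_diff[OF assms csq_const[of "x n"]]] assms
      by (simp add: inc_def emb_diff csq_const)
    show "\<exists>M. \<forall>m\<ge>M. N (x m - x n) \<le> r / 2" using k that by (meson less_imp_le)
  qed
  moreover have "hnorm cip (emb x - inc (x n)) \<ge> 0" for n
    using assms by (intro C.hnorm_nonneg C.mem emb_compl inc_compl)
  ultimately show "\<exists>no. \<forall>n\<ge>no. norm (hnorm cip (emb x - inc (x n)) - 0) < r"
    using \<open>r > 0\<close> by (intro exI[of _ k]) (force simp: abs_of_nonneg)
qed

lemma inc_dense:
  assumes "f \<in> compl" "e > 0"
  obtains a where "hnorm cip (f - inc a) < e"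
proof -
  obtain x where x: "csq x" "f = emb x" using assms(1) by (rule compl_cases)
  have "\<forall>\<^sub>F n in sequentially. hnorm cip (f - inc (x n)) < e"
    using order_tendstoD(2)[OF inc_tendsto[OF x(1)] assms(2)] x(2) by simp
  then show ?thesis using that by (auto simp: eventually_sequentially)
qed

text \<open>By Cauchy-Schwarz a norm null sequence induces the zero functional; this makes
  \<open>cip\<close> definite although \<open>B\<close> may be degenerate.\<close>

lemma hnorm_cip_zero:
  assumes "f \<in> compl" "hnorm cip f = 0"
  shows "f = 0"
proof -
  obtain x where x: "csq x" "f = emb x" using assms(1) by (rule compl_cases)
  have n: "(\<lambda>n. N (x n)) \<longlonglongrightarrow> 0" using hnorm_cip_tendsto[OF x(1)] x(2) assms(2) by simp
  have "f y = 0" for y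
  proof (rule LIMSEQ_unique)
    show "(\<lambda>n. B (x n) y) \<longlonglongrightarrow> f y" using emb_tendsto x by simp
    show "(\<lambda>n. B (x n) y) \<longlonglongrightarrow> 0"
      by (rule Lim_null_comparison[OF _ tendsto_mult_left_zero[OF n, of "N y"]])
        (simp add: cauchy_schwarz)
  qed
  then show ?thesis by (simp add: fun_eq_iff)
qed

text \<open>Completeness is a diagonal argument: each \<open>f n\<close> is replaced by some
  \<open>inc (x n)\<close> within \<open>inverse (real (Suc n))\<close>, and the sequence
  \<open>x\<close> is then Cauchy and represents the limit.\<close>

theorem hilbert_compl: "hilbert_space fscale compl cip"
  unfolding hilbert_space_def
proof (intro conjI allI impI ballI)
  fix f :: "nat \<Rightarrow> 'a \<Rightarrow> complex"
  assume f: "range f \<subseteq> compl" and c: "\<forall>e>0. \<exists>M. \<forall>m\<ge>M. \<forall>n\<ge>M. hnorm cip (f m - f n) < e"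
  have fV: "f n \<in> compl" for n using f by blast
  have "\<exists>a. hnorm cip (f n - inc a) < inverse (real (Suc n))" for n
    by (rule inc_dense[OF fV]) auto
  then obtain x where x: "\<And>n. hnorm cip (f n - inc (x n)) < inverse (real (Suc n))" by metis
  have nul: "(\<lambda>n. hnorm cip (f n - inc (x n))) \<longlonglongrightarrow> 0"
  proof (rule Lim_null_comparison[OF _ LIMSEQ_inverse_real_of_nat])
    have "0 \<le> hnorm cip (f n - inc (x n))" for n
      by (intro C.hnorm_nonneg C.mem fV inc_compl)
    then show "\<forall>\<^sub>F n in sequentially. norm (hnorm cip (f n - inc (x n))) \<le> inverse (real (Suc n))"
      using x by (simp add: less_imp_le)
  qed
  have "csq x"
    unfolding csq_def
  proof (intro allI impI)
    fix e :: real assume "e > 0"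
    then obtain M1 where M1: "\<And>m n. m \<ge> M1 \<Longrightarrow> n \<ge> M1 \<Longrightarrow> hnorm cip (f m - f n) < e / 3"
      using c by (metis divide_pos_pos zero_less_numeral)
    obtain M2 where M2: "\<And>n. n \<ge> M2 \<Longrightarrow> hnorm cip (f n - inc (x n)) < e / 3"
      using order_tendstoD(2)[OF nul, of "e / 3"] \<open>e > 0\<close> by (auto simp: eventually_sequentially)
    have "N (x m - x n) < e" if "m \<ge> max M1 M2" "n \<ge> max M1 M2" for m n
    proof -
      have "N (x m - x n) = hnorm cip (inc (x m) - inc (x n))" by (simp flip: inc_diff add: inc_norm)
      moreover have "\<dots> \<le> hnorm cip (inc (x m) - f m) + hnorm cip (f m - inc (x n))"
        by (intro C.hnorm_triangle_diff inc_compl fV)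
      moreover have "hnorm cip (inc (x m) - f m) = hnorm cip (f m - inc (x m))"
        by (intro C.hnorm_minus_commute inc_compl fV)
      moreover have "hnorm cip (f m - inc (x n)) \<le> hnorm cip (f m - f n) + hnorm cip (f n - inc (x n))"
        by (intro C.hnorm_triangle_diff inc_compl fV)
      ultimately have le: "N (x m - x n) \<le> hnorm cip (f m - inc (x m)) +
        (hnorm cip (f m - f n) + hnorm cip (f n - inc (x n)))" by linarith
      have "M1 \<le> m" "M1 \<le> n" "M2 \<le> m" "M2 \<le> n" using that by simp_all
      then show ?thesis using le M1[of m n] M2[of m] M2[of n] by linarith
    qed
    then show "\<exists>M. \<forall>m\<ge>M. \<forall>n\<ge>M. N (x m - x n) < e" by blast
  qed
  have "(\<lambda>n. hnorm cip (f n - emb x)) \<longlonglongrightarrow> 0"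
  proof (rule Lim_null_comparison[OF _ tendsto_add_zero[OF nul inc_tendsto[OF \<open>csq x\<close>]]])
    have "norm (hnorm cip (f n - emb x)) \<le> hnorm cip (f n - inc (x n)) + hnorm cip (emb x - inc (x n))" for n
      using C.hnorm_triangle_diff[of "f n" "inc (x n)" "emb x"] emb_compl[OF \<open>csq x\<close>] fV inc_compl
        C.hnorm_minus_commute[of "emb x" "inc (x n)"] C.hnorm_nonneg[of "f n - emb x"] C.mem(4)
      by simp
    then show "\<forall>\<^sub>F n in sequentially. norm (hnorm cip (f n - emb x))
        \<le> hnorm cip (f n - inc (x n)) + hnorm cip (emb x - inc (x n))" by simp
  qed
  then show "\<exists>v\<in>compl. (\<lambda>n. hnorm cip (f n - v)) \<longlonglongrightarrow> 0" using emb_compl[OF \<open>csq x\<close>] by blast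
next
  fix v assume v: "v \<in> compl" "v \<noteq> 0"
  then have "hnorm cip v \<noteq> 0" using hnorm_cip_zero by blast
  then show "0 < Re (cip v v)" using C.ip_nonneg[OF v(1)] by (auto simp: hnorm_def)
qed (fact vector_space_fscale C.sub C.ip_add C.ip_scale C.ip_cnj)+

end

section \<open>Isometric group actions and their extension to the completion\<close>

locale pre_hilbert_action = pre_hilbert s B
  for s :: "complex \<Rightarrow> 'a::ab_group_add \<Rightarrow> 'a" and B +
  fixes act :: "'g::topological_group_add \<Rightarrow> 'a \<Rightarrow> 'a"
  assumes act_add: "act g (a + b) = act g a + act g b"
    and act_ip: "B (act g a) (act g b) = B a b"
    and act_0: "act 0 a = a" and act_plus: "act (g + h) a = act g (act h a)"
    and act_cont: "continuous_on UNIV (\<lambda>g. B (act g a) a)"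
begin

text \<open>As vectors of the completion are functionals, the action extends by precomposition with
  the inverse; by \<open>act_adj\<close> this sends \<open>emb x\<close> to the functional of the
  moved sequence.\<close>

definition rep :: "'g \<Rightarrow> ('a \<Rightarrow> complex) \<Rightarrow> 'a \<Rightarrow> complex" where
  "rep g f = (\<lambda>y. f (act (- g) y))"

lemma act_adj: "B (act g a) b = B a (act (- g) b)"
  using act_ip[of g a "act (- g) b"] act_plus[of g "- g" b] act_0 by simp

lemma act_diff: "act g (a - b) = act g a - act g b"
  using act_add[of g "a - b" b] by simp

lemma csq_act: "csq x \<Longrightarrow> csq (\<lambda>n. act g (x n))"
  by (simp add: csq_def hnorm_def act_ip flip: act_diff)

lemma rep_emb: "csq x \<Longrightarrow> rep g (emb x) = emb (\<lambda>n. act g (x n))"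
  unfolding rep_def
  by (rule ext, rule LIMSEQ_unique[OF _ emb_tendsto])
    (auto simp: act_adj intro!: emb_tendsto csq_act)

lemma rep_inc: "rep g (inc a) = inc (act g a)"
  by (simp add: inc_def rep_emb csq_const)

lemma rep_compl: "f \<in> compl \<Longrightarrow> rep g f \<in> compl"
  by (auto elim!: compl_cases simp: rep_emb intro!: emb_compl csq_act)

lemma rep_linear: "rep g (u + v) = rep g u + rep g v" "rep g (u - v) = rep g u - rep g v"
    "rep g (fscale c v) = fscale c (rep g v)"
  by (simp_all add: rep_def fscale_def fun_eq_iff)

lemma rep_group: "rep 0 f = f" "rep (g + h) f = rep g (rep h f)"
  using act_plus[of "- h" "- g"] by (simp_all add: rep_def act_0 minus_add)

lemma rep_ip: "u \<in> compl \<Longrightarrow> v \<in> compl \<Longrightarrow> cip (rep g u) (rep g v) = cip u v"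
proof (elim compl_cases, hypsubst)
  fix x y assume "csq x" "csq y"
  then show "cip (rep g (emb x)) (rep g (emb y)) = cip (emb x) (emb y)"
    using cip_tendsto[OF csq_act csq_act, of x y g g] act_ip
    by (auto simp: rep_emb intro: LIMSEQ_unique cip_tendsto)
qed

lemma rep_norm: "u \<in> compl \<Longrightarrow> hnorm cip (rep g u) = hnorm cip u"
  by (simp add: hnorm_def rep_ip)

text \<open>Isometry expresses the distance of \<open>act g a\<close> and \<open>act h a\<close>
  through the diagonal coefficient at \<open>- h + g\<close>, so continuity of these coefficients
  gives strong continuity.\<close>

lemma act_tendsto: "((\<lambda>g. N (act g a - act h a)) \<longlongrightarrow> 0) (at h)"
proof -
  have eq: "N (act g a - act h a) = sqrt (2 * Re (B a a) - 2 * Re (B (act (- h + g) a) a))" for g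
  proof -
    have "B (act g a) (act h a) = B (act (- h + g) a) a"
      using act_ip[of h "act (- h + g) a" a] by (simp flip: act_plus)
    then have "(N (act g a - act h a))\<^sup>2 = 2 * Re (B a a) - 2 * Re (B (act (- h + g) a) a)"
      using hnorm_diff_sq[of "act g a" "act h a"] by (simp add: hnorm_def[of B "act _ _"] act_ip ip_nonneg)
    then show ?thesis
      using hnorm_nonneg[of "act g a - act h a"] by (metis UNIV_I real_sqrt_unique)
  qed
  have "continuous_on UNIV (\<lambda>g. N (act g a - act h a))"
    unfolding eq by (intro continuous_intros continuous_on_compose2[OF act_cont]) auto
  then have "((\<lambda>g. N (act g a - act h a)) \<longlongrightarrow> N (act h a - act h a)) (at h)"
    unfolding continuous_on_def by blast
  then show ?thesis by (simp only: diff_self hnorm_zero)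
qed

theorem unitary_rep_compl: "unitary_rep fscale compl cip rep"
  unfolding unitary_rep_def
proof (intro conjI allI ballI)
  show "hilbert_space fscale compl cip" by (rule hilbert_compl)
  have "rep g ` compl = compl" for g
  proof
    have "f = rep g (rep (- g) f)" for f by (simp flip: rep_group(2) add: rep_group(1))
    then show "compl \<subseteq> rep g ` compl" using rep_compl by blast
  qed (use rep_compl in blast)
  then show "unitary_operator fscale compl cip (rep g)" for g
    by (simp add: unitary_operator_def rep_linear rep_ip)
  show "((\<lambda>g. hnorm cip (rep g f - rep h f)) \<longlongrightarrow> 0) (at h)" if f: "f \<in> compl" for f h
  proof (rule tendstoI)
    fix e :: real assume "e > 0"
    \<comment> \<open>Strong continuity passes from the dense image of \<open>inc\<close> to all of
      \<open>compl\<close>: two errors of \<open>e / 3\<close> come from replacing \<open>f\<close>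
      by \<open>inc a\<close>, the third from \<open>act_tendsto\<close>.\<close>
    then obtain a where a: "hnorm cip (f - inc a) < e / 3" using inc_dense[OF f, of "e / 3"] by auto
    have "\<forall>\<^sub>F g in at h. N (act g a - act h a) < e / 3"
      using order_tendstoD(2)[OF act_tendsto, of "e / 3"] \<open>e > 0\<close> by simp
    then show "\<forall>\<^sub>F g in at h. dist (hnorm cip (rep g f - rep h f)) 0 < e"
    proof eventually_elim
      case (elim g)
      note m = rep_compl[OF f] rep_compl[OF inc_compl]
      have iso: "hnorm cip (rep k f - rep k (inc a)) = hnorm cip (f - inc a)" for k
        using f inc_compl C.mem(4) by (simp flip: rep_linear(2) add: rep_norm)
      have "hnorm cip (rep g f - rep h f)
        \<le> hnorm cip (rep g f - rep g (inc a)) + hnorm cip (rep g (inc a) - rep h f)"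
        by (intro C.hnorm_triangle_diff m)
      moreover have "hnorm cip (rep g (inc a) - rep h f)
        \<le> hnorm cip (rep g (inc a) - rep h (inc a)) + hnorm cip (rep h (inc a) - rep h f)"
        by (intro C.hnorm_triangle_diff m)
      moreover have "hnorm cip (rep h (inc a) - rep h f) = hnorm cip (rep h f - rep h (inc a))"
        by (intro C.hnorm_minus_commute m)
      moreover have "hnorm cip (rep g (inc a) - rep h (inc a)) = N (act g a - act h a)"
        by (simp add: rep_inc inc_norm flip: inc_diff)
      moreover have "hnorm cip (rep g f - rep h f) \<ge> 0"
        by (intro C.hnorm_nonneg C.mem m)
      ultimately show ?case
        using a elim unfolding dist_real_def iso by linarith
    qed
  qed
qed (simp_all add: rep_group)

end

section \<open>Positive definite kernels and functions\<close>

lemma nonneg_Reals_sum: "(\<And>i. i \<in> A \<Longrightarrow> f i \<in> \<real>\<^sub>\<ge>\<^sub>0) \<Longrightarrow> sum f A \<in> (\<real>\<^sub>\<ge>\<^sub>0 :: complex set)"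
  by (induction A rule: infinite_finite_induct) auto

lemma closed_nonneg_Reals_complex: "closed (\<real>\<^sub>\<ge>\<^sub>0 :: complex set)"
proof -
  have "(\<real>\<^sub>\<ge>\<^sub>0 :: complex set) = {z. Re z \<ge> 0} \<inter> {z. Im z = 0}"
    by (auto simp: complex_nonneg_Reals_iff)
  then show ?thesis
    by (simp add: closed_Int closed_Collect_le closed_Collect_eq continuous_on_Re continuous_on_Im
        continuous_on_id)
qed

definition pd_kernel :: "('s \<Rightarrow> 's \<Rightarrow> complex) \<Rightarrow> bool" where
  "pd_kernel k \<longleftrightarrow>
     (\<forall>F c. finite F \<longrightarrow> (\<Sum>s\<in>F. \<Sum>t\<in>F. c s * cnj (c t) * k s t) \<in> \<real>\<^sub>\<ge>\<^sub>0)"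

abbreviation "keys \<equiv> Poly_Mapping.keys"
abbreviation "lookup \<equiv> Poly_Mapping.lookup"

lemma pd_kernelD:
  "pd_kernel k \<Longrightarrow> finite F \<Longrightarrow> (\<Sum>s\<in>F. \<Sum>t\<in>F. c s * cnj (c t) * k s t) \<in> \<real>\<^sub>\<ge>\<^sub>0"
  by (simp add: pd_kernel_def)

definition pscale :: "complex \<Rightarrow> ('s \<Rightarrow>\<^sub>0 complex) \<Rightarrow> ('s \<Rightarrow>\<^sub>0 complex)" where
  "pscale c = Poly_Mapping.map ((*) c)"

text \<open>Finitely supported functions form the free vector space on the index set, and this is
  the sesquilinear extension of the kernel from basis vectors.\<close>

definition kip :: "('s \<Rightarrow> 's \<Rightarrow> complex) \<Rightarrow> ('s \<Rightarrow>\<^sub>0 complex) \<Rightarrow> ('s \<Rightarrow>\<^sub>0 complex) \<Rightarrow> complex" where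
  "kip k a b = (\<Sum>s\<in>keys a. \<Sum>t\<in>keys b. lookup a s * cnj (lookup b t) * k s t)"

lemma lookup_pscale [simp]: "lookup (pscale c a) s = c * lookup a s"
  by (simp add: pscale_def map.rep_eq when_def)

lemma vector_space_pscale: "vector_space pscale"
  by unfold_locales (auto intro!: poly_mapping_eqI simp: lookup_add algebra_simps)

lemma kip_superset:
  assumes "finite F" "keys a \<subseteq> F" "finite G" "keys b \<subseteq> G"
  shows "kip k a b = (\<Sum>s\<in>F. \<Sum>t\<in>G. lookup a s * cnj (lookup b t) * k s t)"
proof -
  have "kip k a b = (\<Sum>s\<in>F. \<Sum>t\<in>keys b. lookup a s * cnj (lookup b t) * k s t)"
    unfolding kip_def
    by (rule sum.mono_neutral_left) (use assms in \<open>auto simp: in_keys_iff\<close>)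
  also have "\<dots> = (\<Sum>s\<in>F. \<Sum>t\<in>G. lookup a s * cnj (lookup b t) * k s t)"
    by (intro sum.cong refl sum.mono_neutral_left) (use assms in \<open>auto simp: in_keys_iff\<close>)
  finally show ?thesis .
qed

lemma kip_single: "kip k (Poly_Mapping.single s 1) (Poly_Mapping.single t 1) = k s t"
  by (simp add: kip_def)

text \<open>Polarisation: nonnegativity of the form for the coefficient pairs (1,0), (0,1), (1,1)
  and (i,1) forces the relevant imaginary parts to vanish.\<close>

lemma pd_kernel_hermitian:
  assumes "pd_kernel k"
  shows "k t s = cnj (k s t)"
proof (cases "s = t")
  case True
  show ?thesis using True pd_kernelD[OF assms, of "{s}" "\<lambda>_. 1"] by (simp add: complex_nonneg_Reals_iff complex_eq_iff)
next
  case False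
  have main: "c * cnj c * k s s + c * cnj d * k s t + (d * cnj c * k t s + d * cnj d * k t t) \<in> \<real>\<^sub>\<ge>\<^sub>0" for c d
  proof -
    show ?thesis
      using pd_kernelD[OF assms, of "{s, t}" "\<lambda>x. if x = s then c else d"] False by simp
  qed
  have "Im (k s s) = 0" "Im (k t t) = 0" "Im (k s t + k t s) = 0" "Im (\<i> * k s t - \<i> * k t s) = 0"
    using main[of 1 0] main[of 0 1] main[of 1 1] main[of \<i> 1]
    by (auto simp: complex_nonneg_Reals_iff)
  then show ?thesis by (simp add: complex_eq_iff)
qed

lemma pd_kernel_pre_hilbert:
  assumes "pd_kernel k"
  shows "pre_hilbert pscale (kip k)"
  unfolding pre_hilbert_def
proof (rule semi_inner.intro)
  show "vector_space pscale" by (rule vector_space_pscale)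
  interpret vector_space pscale by (rule vector_space_pscale)
  show "subspace UNIV" by (rule subspace_UNIV)
next
  fix u v w :: "'a \<Rightarrow>\<^sub>0 complex" and c
  define F where "F = keys u \<union> keys v \<union> keys w"
  have F: "finite F" "keys u \<subseteq> F" "keys v \<subseteq> F" "keys w \<subseteq> F" "keys (u + v) \<subseteq> F" "keys (pscale c v) \<subseteq> F"
    using Poly_Mapping.keys_add[of u v] by (auto simp: F_def in_keys_iff)
  show "kip k (u + v) w = kip k u w + kip k v w"
    by (simp add: kip_superset[of F _ F] F lookup_add algebra_simps sum.distrib)
  show "kip k (pscale c v) w = c * kip k v w"
    by (simp add: kip_superset[of F _ F] F sum_distrib_left algebra_simps)
  show "kip k w v = cnj (kip k v w)"
  proof -
    have "lookup w s * cnj (lookup v t) * k s t = cnj (lookup v t * cnj (lookup w s) * k t s)" for s t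
      by (simp add: pd_kernel_hermitian[OF assms, of s t])
    then show ?thesis unfolding kip_def by (subst sum.swap) (simp only: cnj_sum)
  qed
  show "Re (kip k v v) \<ge> 0"
    using pd_kernelD[OF assms finite_keys[of v], of "lookup v"] by (simp add: kip_def complex_nonneg_Reals_iff)
qed

definition combo :: "'s set \<Rightarrow> ('s \<Rightarrow> complex) \<Rightarrow> ('s \<Rightarrow>\<^sub>0 complex)" where
  "combo F c = (\<Sum>s\<in>F. Poly_Mapping.single s (c s))"

lemma lookup_combo: "finite F \<Longrightarrow> lookup (combo F c) s = (if s \<in> F then c s else 0)"
  by (simp add: combo_def lookup_sum lookup_single when_def sum.If_cases)

lemma kip_combo:
  assumes "finite F"
  shows "kip k (combo F c) (combo F c) = (\<Sum>s\<in>F. \<Sum>t\<in>F. c s * cnj (c t) * k s t)"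
    and "kip k (combo F c) (Poly_Mapping.single e 1) = (\<Sum>s\<in>F. c s * k s e)"
proof -
  have K: "keys (combo F c) \<subseteq> F" using assms by (auto simp: in_keys_iff lookup_combo split: if_splits)
  show "kip k (combo F c) (combo F c) = (\<Sum>s\<in>F. \<Sum>t\<in>F. c s * cnj (c t) * k s t)"
    by (simp add: kip_superset[OF assms K assms K] lookup_combo assms cong: sum.cong)
  show "kip k (combo F c) (Poly_Mapping.single e 1) = (\<Sum>s\<in>F. c s * k s e)"
    using kip_superset[OF assms K, of "{e}" "Poly_Mapping.single e 1" k] assms
    by (simp add: lookup_combo cong: sum.cong)
qed

text \<open>
  Schur's product theorem: subtracting from \<open>b\<close> its rank one part at a point \<open>e\<close> with \<open>b e e \<noteq> 0\<close>
  (one step of a Cholesky decomposition) makes the diagonal entry at \<open>e\<close> vanish.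
\<close>

lemma pd_kernel_mult:
  assumes a: "pd_kernel a" and b: "pd_kernel b"
  shows "pd_kernel (\<lambda>s t. a s t * b s t)"
  unfolding pd_kernel_def
proof (intro allI impI)
  fix F :: "'a set" and c :: "'a \<Rightarrow> complex" assume fin: "finite F"
  show "(\<Sum>s\<in>F. \<Sum>t\<in>F. c s * cnj (c t) * (a s t * b s t)) \<in> \<real>\<^sub>\<ge>\<^sub>0"
    using b
  \<comment> \<open>The measure counts the nonzero diagonal entries of \<open>b\<close> on
    \<open>F\<close>; when it is zero, Cauchy-Schwarz makes all entries on \<open>F\<close>
    vanish.\<close>
  proof (induction "card {s \<in> F. b s s \<noteq> 0}" arbitrary: b rule: less_induct)
    case less
    interpret pre_hilbert pscale "kip b" by (rule pd_kernel_pre_hilbert[OF less.prems])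
    have nrm: "(hnorm (kip b) (Poly_Mapping.single s 1))\<^sup>2 = Re (b s s)" for s
      using ip_self[of "Poly_Mapping.single s 1"] by (simp add: kip_single complex_eq_iff)
    have cs: "(cmod (kip b x (Poly_Mapping.single e 1)))\<^sup>2 \<le> Re (kip b x x) * Re (b e e)" for x e
      using power_mono[OF cauchy_schwarz[of x "Poly_Mapping.single e 1"], of 2]
      by (simp add: power_mult_distrib nrm ip_self)
    have diag: "b s s = of_real (Re (b s s))" "Re (b s s) \<ge> 0" for s
      using ip_self[of "Poly_Mapping.single s 1"] ip_nonneg[of "Poly_Mapping.single s 1"]
      by (simp_all add: kip_single complex_eq_iff)
    show ?case
    proof (cases "\<exists>e\<in>F. b e e \<noteq> 0")
      case False
      have "b s t = 0" if "s \<in> F" "t \<in> F" for s t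
        using cs[of "Poly_Mapping.single s 1" t] False that by (simp add: kip_single)
      then show ?thesis by simp
    next
      case True
      then obtain e where e: "e \<in> F" "b e e \<noteq> 0" by blast
      define \<beta> where "\<beta> = Re (b e e)"
      have \<beta>: "b e e = of_real \<beta>" "\<beta> > 0" using diag[of e] e(2) by (auto simp: \<beta>_def less_le)
      define b' where "b' s t = b s t - b s e * cnj (b t e) / of_real \<beta>" for s t
      have split: "(\<Sum>s\<in>G. \<Sum>t\<in>G. d s * cnj (d t) * b' s t) =
          (\<Sum>s\<in>G. \<Sum>t\<in>G. d s * cnj (d t) * b s t) -
          of_real ((cmod (\<Sum>s\<in>G. d s * b s e))\<^sup>2 / \<beta>)" for G d
      proof -
        have "of_real ((cmod (\<Sum>s\<in>G. d s * b s e))\<^sup>2) =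
            (\<Sum>s\<in>G. \<Sum>t\<in>G. d s * cnj (d t) * (b s e * cnj (b t e)))"
          unfolding complex_norm_square by (simp add: sum_product algebra_simps)
        then show ?thesis
          by (simp add: b'_def sum_subtractf right_diff_distrib sum_divide_distrib)
      qed
      have b': "pd_kernel b'"
        unfolding pd_kernel_def
      proof (intro allI impI)
        fix G :: "'a set" and d assume G: "finite G"
        have "(cmod (\<Sum>s\<in>G. d s * b s e))\<^sup>2 \<le> Re (\<Sum>s\<in>G. \<Sum>t\<in>G. d s * cnj (d t) * b s t) * \<beta>"
          using cs[of "combo G d" e] by (simp only: kip_combo[OF G] \<beta>_def)
        moreover note pd_kernelD[OF less.prems G, of d]
        moreover have "z - of_real (r / \<beta>) \<in> \<real>\<^sub>\<ge>\<^sub>0" if "r \<le> Re z * \<beta>" "z \<in> \<real>\<^sub>\<ge>\<^sub>0" for r and z :: complex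
          using that \<beta>(2) by (simp add: complex_nonneg_Reals_iff field_simps)
        ultimately show "(\<Sum>s\<in>G. \<Sum>t\<in>G. d s * cnj (d t) * b' s t) \<in> \<real>\<^sub>\<ge>\<^sub>0"
          unfolding split by blast
      qed
      have "{s \<in> F. b' s s \<noteq> 0} \<subseteq> {s \<in> F. b s s \<noteq> 0} - {e}"
      proof -
        have "b' e e = 0" using \<beta> by (simp add: b'_def)
        moreover have "b' s s = 0" if "b s s = 0" for s
          using cs[of "Poly_Mapping.single s 1" e] that by (simp add: kip_single b'_def)
        ultimately show ?thesis by auto
      qed
      then have "{s \<in> F. b' s s \<noteq> 0} \<subset> {s \<in> F. b s s \<noteq> 0}" using e by auto
      then have "card {s \<in> F. b' s s \<noteq> 0} < card {s \<in> F. b s s \<noteq> 0}"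
        using fin by (intro psubset_card_mono) auto
      from less.hyps[OF this b']
      have IH: "(\<Sum>s\<in>F. \<Sum>t\<in>F. c s * cnj (c t) * (a s t * b' s t)) \<in> \<real>\<^sub>\<ge>\<^sub>0" .
      \<comment> \<open>The removed rank one part contributes the form of \<open>a\<close> for the
        altered coefficients \<open>c s * b s e\<close>.\<close>
      have "(\<Sum>s\<in>F. \<Sum>t\<in>F. (c s * b s e) * cnj (c t * b t e) * a s t) \<in> \<real>\<^sub>\<ge>\<^sub>0"
        by (rule pd_kernelD[OF a fin])
      moreover have "inverse (of_real \<beta>) \<in> (\<real>\<^sub>\<ge>\<^sub>0 :: complex set)" using \<beta> by simp
      ultimately have r1: "inverse (of_real \<beta>) *
          (\<Sum>s\<in>F. \<Sum>t\<in>F. (c s * b s e) * cnj (c t * b t e) * a s t) \<in> \<real>\<^sub>\<ge>\<^sub>0"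
        by (rule nonneg_Reals_mult_I[rotated])
      have "(\<Sum>s\<in>F. \<Sum>t\<in>F. c s * cnj (c t) * (a s t * b s t)) =
          (\<Sum>s\<in>F. \<Sum>t\<in>F. c s * cnj (c t) * (a s t * b' s t)) + inverse (of_real \<beta>) *
          (\<Sum>s\<in>F. \<Sum>t\<in>F. (c s * b s e) * cnj (c t * b t e) * a s t)"
        by (simp add: b'_def sum_distrib_left algebra_simps divide_inverse flip: sum.distrib)
      then show ?thesis using IH r1 by simp
    qed
  qed
qed

section \<open>Positive definite functions on groups\<close>

lemma positive_definiteD:
  "positive_definite \<phi> \<Longrightarrow> (\<Sum>i<n. \<Sum>j<n. c i * cnj (c j) * \<phi> (- g j + g i)) \<in> \<real>\<^sub>\<ge>\<^sub>0"
  for n :: nat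
  by (simp add: positive_definite_def)

text \<open>A family \<open>g\<close> may repeat elements, so the kernel is indexed by positions; in
  this form Schur's product theorem for kernels applies to functions on the group.\<close>

lemma positive_definite_kernel:
  "positive_definite \<phi> \<longleftrightarrow> (\<forall>g :: nat \<Rightarrow> _. pd_kernel (\<lambda>i j. \<phi> (- g j + g i)))"
proof safe
  fix g :: "nat \<Rightarrow> 'a" assume pd: "positive_definite \<phi>"
  show "pd_kernel (\<lambda>i j. \<phi> (- g j + g i))"
    unfolding pd_kernel_def
  proof (intro allI impI)
    fix F :: "nat set" and c :: "nat \<Rightarrow> complex" assume "finite F"
    then obtain n where n: "F \<subseteq> {..<n}" by (auto simp: finite_nat_iff_bounded)
    define c' where "c' i = (if i \<in> F then c i else 0)" for i
    have "(\<Sum>i<n. \<Sum>j<n. c' i * cnj (c' j) * \<phi> (- g j + g i)) =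
        (\<Sum>i\<in>F. \<Sum>j\<in>F. c' i * cnj (c' j) * \<phi> (- g j + g i))"
      by (intro sum.mono_neutral_cong_right sum.mono_neutral_right)
        (use n in \<open>auto simp: c'_def\<close>)
    then show "(\<Sum>i\<in>F. \<Sum>j\<in>F. c i * cnj (c j) * \<phi> (- g j + g i)) \<in> \<real>\<^sub>\<ge>\<^sub>0"
      using positive_definiteD[OF pd, where n = n and g = g and c = c'] by (simp add: c'_def cong: sum.cong)
  qed
next
  assume "\<forall>g :: nat \<Rightarrow> _. pd_kernel (\<lambda>i j. \<phi> (- g j + g i))"
  then show "positive_definite \<phi>" by (simp add: positive_definite_def pd_kernelD)
qed

lemma positive_definite_group_kernel:
  assumes "positive_definite \<phi>"
  shows "pd_kernel (\<lambda>g h. \<phi> (- h + g))"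
  unfolding pd_kernel_def
proof (intro allI impI)
  fix F :: "'a set" and c assume "finite F"
  then obtain g where "bij_betw g {..<card F} F"
    using ex_bij_betw_nat_finite[of F] by (auto simp: atLeast0LessThan)
  note b = sum.reindex_bij_betw[OF this]
  have "(\<Sum>s\<in>F. \<Sum>t\<in>F. c s * cnj (c t) * \<phi> (- t + s)) =
      (\<Sum>i<card F. \<Sum>j<card F. c (g i) * cnj (c (g j)) * \<phi> (- g j + g i))"
    by (simp add: b[symmetric])
  then show "(\<Sum>s\<in>F. \<Sum>t\<in>F. c s * cnj (c t) * \<phi> (- t + s)) \<in> \<real>\<^sub>\<ge>\<^sub>0"
    using positive_definiteD[OF assms, where n = "card F" and g = g and c = "\<lambda>i. c (g i)"] by simp
qed

lemma positive_definite_mult: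
  "positive_definite \<phi> \<Longrightarrow> positive_definite \<psi> \<Longrightarrow> positive_definite (\<lambda>g. \<phi> g * \<psi> g)"
  unfolding positive_definite_kernel using pd_kernel_mult by blast

lemma positive_definite_one: "positive_definite (\<lambda>_. 1)"
proof -
  have "(\<Sum>i<n. \<Sum>j<n. c i * cnj (c j)) = of_real ((cmod (\<Sum>i<n. c i))\<^sup>2)" for n and c :: "nat \<Rightarrow> complex"
    unfolding complex_norm_square by (simp add: sum_product)
  then show ?thesis by (simp add: positive_definite_def)
qed

lemma positive_definite_add:
  "positive_definite \<phi> \<Longrightarrow> positive_definite \<psi> \<Longrightarrow> positive_definite (\<lambda>g. \<phi> g + \<psi> g)"
  unfolding positive_definite_def by (simp add: distrib_left sum.distrib)

lemma positive_definite_scale: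
  assumes "positive_definite \<phi>" "r \<ge> 0"
  shows "positive_definite (\<lambda>g. of_real r * \<phi> g)"
proof -
  have "(\<Sum>i<n. \<Sum>j<n. c i * cnj (c j) * (of_real r * \<phi> (- g j + g i))) =
      of_real r * (\<Sum>i<n. \<Sum>j<n. c i * cnj (c j) * \<phi> (- g j + g i))" for n g and c :: "nat \<Rightarrow> complex"
    by (simp add: sum_distrib_left algebra_simps)
  then show ?thesis
    using assms unfolding positive_definite_def by (auto intro!: nonneg_Reals_mult_I)
qed

lemma positive_definite_cnj:
  assumes "positive_definite \<phi>"
  shows "positive_definite (\<lambda>g. cnj (\<phi> g))"
  unfolding positive_definite_def
proof (intro allI)
  fix n g and c :: "nat \<Rightarrow> complex"
  have "cnj z \<in> \<real>\<^sub>\<ge>\<^sub>0" if "z \<in> \<real>\<^sub>\<ge>\<^sub>0" for z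
    using that by (simp add: complex_nonneg_Reals_iff)
  from this[OF positive_definiteD[OF assms, where n = n and g = g and c = "\<lambda>i. cnj (c i)"]]
  show "(\<Sum>i<n. \<Sum>j<n. c i * cnj (c j) * cnj (\<phi> (- g j + g i))) \<in> \<real>\<^sub>\<ge>\<^sub>0" by simp
qed

lemma positive_definite_Re:
  assumes "positive_definite \<phi>"
  shows "positive_definite (\<lambda>g. complex_of_real (Re (\<phi> g)))"
proof -
  have "(\<lambda>g. complex_of_real (Re (\<phi> g))) = (\<lambda>g. of_real (1/2) * (\<phi> g + cnj (\<phi> g)))"
    by (auto simp: complex_eq_iff)
  then show ?thesis
    using positive_definite_scale[OF positive_definite_add[OF assms positive_definite_cnj[OF assms]], of "1/2"]
    by simp
qed

lemma positive_definite_power: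
  "positive_definite \<phi> \<Longrightarrow> positive_definite (\<lambda>g. \<phi> g ^ n)"
  by (induction n) (auto intro: positive_definite_one positive_definite_mult)

lemma positive_definite_prod:
  "(\<And>i. i \<in> A \<Longrightarrow> positive_definite (\<phi> i)) \<Longrightarrow> positive_definite (\<lambda>g. \<Prod>i\<in>A. \<phi> i g)"
  by (induction A rule: infinite_finite_induct) (auto intro: positive_definite_one positive_definite_mult)

lemma positive_definite_limit:
  assumes "\<And>n. positive_definite (\<phi> n)" "\<And>g. (\<lambda>n. \<phi> n g) \<longlonglongrightarrow> \<psi> g"
  shows "positive_definite \<psi>"
  unfolding positive_definite_def
proof (intro allI)
  fix n g and c :: "nat \<Rightarrow> complex"
  show "(\<Sum>i<n. \<Sum>j<n. c i * cnj (c j) * \<psi> (- g j + g i)) \<in> \<real>\<^sub>\<ge>\<^sub>0"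
  proof (rule Lim_in_closed_set[OF closed_nonneg_Reals_complex])
    show "\<forall>\<^sub>F m in sequentially. (\<Sum>i<n. \<Sum>j<n. c i * cnj (c j) * \<phi> m (- g j + g i)) \<in> \<real>\<^sub>\<ge>\<^sub>0"
      using assms(1) unfolding positive_definite_def by simp
    show "(\<lambda>m. \<Sum>i<n. \<Sum>j<n. c i * cnj (c j) * \<phi> m (- g j + g i))
        \<longlonglongrightarrow> (\<Sum>i<n. \<Sum>j<n. c i * cnj (c j) * \<psi> (- g j + g i))"
      by (intro tendsto_intros assms(2))
  qed simp
qed

lemma additive_zero_minus:
  fixes f :: "'a::group_add \<Rightarrow> 'b::group_add"
  assumes "\<And>x y. f (x + y) = f x + f y"
  shows "f 0 = 0" "f (- x) = - f x"
proof -
  show "f 0 = 0" using assms[of 0 0] add_left_cancel[of "f 0" "f 0" 0] by simp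
  then show "f (- x) = - f x" using assms[of "- x" x] by (simp add: eq_neg_iff_add_eq_0)
qed

lemma positive_definite_compose:
  assumes "positive_definite \<phi>" "\<And>x y. f (x + y) = f x + f y"
  shows "positive_definite (\<lambda>h. \<phi> (f h))"
  unfolding positive_definite_def
proof (intro allI)
  fix n and g :: "nat \<Rightarrow> 'b" and c
  show "(\<Sum>i<n. \<Sum>j<n. c i * cnj (c j) * \<phi> (f (- g j + g i))) \<in> \<real>\<^sub>\<ge>\<^sub>0"
    using positive_definiteD[OF assms(1), where n = n and c = c and g = "\<lambda>i. f (g i)"]
    by (simp add: assms(2) additive_zero_minus[of f, OF assms(2)])
qed

context
  fixes \<phi> :: "'g::group_add \<Rightarrow> complex"
  assumes pd: "positive_definite \<phi>" and one: "\<phi> 0 = 1"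
begin

interpretation pre_hilbert pscale "kip (\<lambda>g h. \<phi> (- h + g))"
  by (intro pd_kernel_pre_hilbert positive_definite_group_kernel pd)

private abbreviation \<delta> :: "'g \<Rightarrow> ('g \<Rightarrow>\<^sub>0 complex)" where "\<delta> g \<equiv> Poly_Mapping.single g 1"

private lemma N_\<delta>: "N (\<delta> g) = 1"
  by (simp add: hnorm_def kip_single one)

text \<open>Deficits \<open>1 - Re (\<phi> g)\<close> are thus half squared distances between
  translates of a unit vector; the inequalities below are Cauchy-Schwarz and the triangle inequality
  for these vectors.\<close>

private lemma N_\<delta>_diff: "N (\<delta> g - \<delta> h) = sqrt (2 * (1 - Re (\<phi> (- h + g))))"
proof -
  have "(N (\<delta> g - \<delta> h))\<^sup>2 = 2 * (1 - Re (\<phi> (- h + g)))"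
    by (simp add: hnorm_diff_sq N_\<delta> kip_single)
  then show ?thesis using hnorm_nonneg[of "\<delta> g - \<delta> h"] by (metis UNIV_I real_sqrt_unique)
qed

lemma pd_norm_le: "cmod (\<phi> g) \<le> 1"
  using cauchy_schwarz[of "\<delta> g" "\<delta> 0"] by (simp add: kip_single N_\<delta> del: single_one)

lemma pd_minus: "\<phi> (- g) = cnj (\<phi> g)"
  using pd_kernel_hermitian[OF positive_definite_group_kernel[OF pd], of g 0] by simp

lemma pd_diff_le: "cmod (\<phi> g - \<phi> h) \<le> sqrt (2 * (1 - Re (\<phi> (- h + g))))"
  using cauchy_schwarz[of "\<delta> g - \<delta> h" "\<delta> 0"]
  by (simp add: ip_diff kip_single N_\<delta> N_\<delta>_diff del: single_one)

lemma pd_one_diff_le: "cmod (\<phi> g - 1) \<le> sqrt (2 * (1 - Re (\<phi> g)))"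
  using pd_diff_le[of g 0] by (simp add: one)

text \<open>The triangle inequality through \<open>\<delta> g\<close>; by left invariance the
  distance from there to \<open>\<delta> (g + h)\<close> depends only on \<open>h\<close>.\<close>

lemma pd_sqrt_subadditive: "sqrt (1 - Re (\<phi> (g + h))) \<le> sqrt (1 - Re (\<phi> g)) + sqrt (1 - Re (\<phi> h))"
proof -
  have "N (\<delta> (g + h) - \<delta> 0) \<le> N (\<delta> (g + h) - \<delta> g) + N (\<delta> g - \<delta> 0)"
    by (rule hnorm_triangle_diff) auto
  then have "sqrt 2 * sqrt (1 - Re (\<phi> (g + h))) \<le> sqrt 2 * (sqrt (1 - Re (\<phi> h)) + sqrt (1 - Re (\<phi> g)))"
    by (simp only: N_\<delta>_diff real_sqrt_mult distrib_left) (simp add: add.assoc[symmetric])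
  then show ?thesis by simp
qed

end

text \<open>By \<open>pd_diff_le\<close> the oscillation of \<open>\<phi>\<close> at any
  \<open>h\<close> is controlled by the deficit at \<open>- h + g\<close>, so continuity at the
  identity spreads to the whole group.\<close>

lemma normalized_pdI:
  fixes \<phi> :: "'g::topological_group_add \<Rightarrow> complex"
  assumes pd: "positive_definite \<phi>" and one: "\<phi> 0 = 1" and cont: "(\<phi> \<longlongrightarrow> 1) (nhds 0)"
  shows "normalized_pd \<phi>"
  unfolding normalized_pd_def
proof (intro conjI assms)
  have "(\<phi> \<longlongrightarrow> \<phi> h) (nhds h)" for h
  proof -
    have "filterlim (\<lambda>g. - h + g) (nhds (- h + h)) (nhds h)"
      by (intro tendsto_intros filterlim_ident)
    then have "filterlim (\<lambda>g. - h + g) (nhds 0) (nhds h)" by simp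
    from filterlim_compose[OF cont this]
    have "((\<lambda>g. \<phi> (- h + g)) \<longlongrightarrow> 1) (nhds h)" .
    then have "((\<lambda>g. sqrt (2 * (1 - Re (\<phi> (- h + g))))) \<longlongrightarrow> sqrt (2 * (1 - Re 1))) (nhds h)"
      by (intro tendsto_intros)
    then have "((\<lambda>g. sqrt (2 * (1 - Re (\<phi> (- h + g))))) \<longlongrightarrow> 0) (nhds h)" by simp
    from Lim_null_comparison[OF always_eventually[OF allI[OF pd_diff_le[OF pd one]]] this]
    have "((\<lambda>g. \<phi> g - \<phi> h) \<longlongrightarrow> 0) (nhds h)" .
    then show ?thesis by (simp add: LIM_zero_iff)
  qed
  then show "continuous_on UNIV \<phi>"
    unfolding continuous_on_def using tendsto_mono[OF at_within_le_nhds] by blast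
qed

section \<open>Direct sums of Gelfand--Naimark--Segal representations\<close>

text \<open>Block diagonal, with one block \<open>\<phi> (- h + g)\<close> per member of
  \<open>P\<close>: the resulting Hilbert space is the direct sum of their GNS spaces. Index
  functions outside \<open>P\<close> give null vectors, which disappear in the completion.\<close>

definition family_kernel ::
    "('g::group_add \<Rightarrow> complex) set \<Rightarrow> ('g \<Rightarrow> complex) \<times> 'g \<Rightarrow> ('g \<Rightarrow> complex) \<times> 'g \<Rightarrow> complex" where
  "family_kernel P s t = (if fst s = fst t \<and> fst s \<in> P then fst s (- snd t + snd s) else 0)"

text \<open>\<open>map_key\<close> pulls back along its argument, so the inverse translation appears
  here and the basis vector at \<open>(i, h)\<close> moves to \<open>(i, g + h)\<close>.\<close>

definition shift :: "'g::group_add \<Rightarrow> ('i \<times> 'g \<Rightarrow>\<^sub>0 complex) \<Rightarrow> ('i \<times> 'g \<Rightarrow>\<^sub>0 complex)" where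
  "shift g = Poly_Mapping.map_key (\<lambda>(i, h). (i, - g + h))"

lemma inj_shift: "inj (\<lambda>(i, h :: 'g::group_add). (i, - g + h))"
  by (auto simp: inj_on_def)

lemma lookup_shift [simp]: "lookup (shift g a) (i, h) = lookup a (i, - g + h)"
  by (simp add: shift_def map_key.rep_eq[OF inj_shift])

lemma kip_shift:
  "kip k (shift g a) b = (\<Sum>s\<in>keys a. \<Sum>t\<in>keys b. lookup a s * cnj (lookup b t) * k (fst s, g + snd s) t)"
  unfolding kip_def
  by (rule sum.reindex_bij_witness[where i = "\<lambda>(i, h). (i, g + h)" and j = "\<lambda>(i, h). (i, - g + h)"])
    (auto simp: in_keys_iff add.assoc[symmetric])

lemma pd_family_kernel:
  assumes "\<And>\<phi>. \<phi> \<in> P \<Longrightarrow> positive_definite \<phi>"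
  shows "pd_kernel (family_kernel P)"
  unfolding pd_kernel_def
proof (intro allI impI)
  fix F :: "(('a \<Rightarrow> complex) \<times> 'a) set" and c assume F: "finite F"
  let ?f = "\<lambda>s t. c s * cnj (c t) * family_kernel P s t"
  have "(\<Sum>s\<in>F. \<Sum>t\<in>F. ?f s t) = (\<Sum>\<phi>\<in>fst ` F. \<Sum>s\<in>{s \<in> F. fst s = \<phi>}. \<Sum>t\<in>F. ?f s t)"
    by (rule sum.image_gen[OF F])
  also have "\<dots> \<in> \<real>\<^sub>\<ge>\<^sub>0"
  proof (rule nonneg_Reals_sum)
    fix \<phi> assume "\<phi> \<in> fst ` F"
    define G where "G = {g. (\<phi>, g) \<in> F}"
    have "G = snd ` {s \<in> F. fst s = \<phi>}" by (force simp: G_def)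
    then have G: "finite G" using F by simp
    have eq: "{s \<in> F. fst s = \<phi>} = Pair \<phi> ` G" by (auto simp: G_def)
    have "(\<Sum>s\<in>{s \<in> F. fst s = \<phi>}. \<Sum>t\<in>F. ?f s t) =
        (\<Sum>s\<in>{s \<in> F. fst s = \<phi>}. \<Sum>t\<in>{s \<in> F. fst s = \<phi>}. ?f s t)"
      by (intro sum.cong refl sum.mono_neutral_right) (use F in \<open>auto simp: family_kernel_def\<close>)
    also have "\<dots> = (\<Sum>g\<in>G. \<Sum>h\<in>G. ?f (\<phi>, g) (\<phi>, h))"
      unfolding eq by (simp add: sum.reindex inj_on_def)
    also have "\<dots> \<in> \<real>\<^sub>\<ge>\<^sub>0"
    proof (cases "\<phi> \<in> P")
      case True
      then show ?thesis
        using positive_definite_group_kernel[OF assms[OF True]] G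
        by (simp add: family_kernel_def pd_kernel_def)
    qed (simp add: family_kernel_def)
    finally show "(\<Sum>s\<in>{s \<in> F. fst s = \<phi>}. \<Sum>t\<in>F. ?f s t) \<in> \<real>\<^sub>\<ge>\<^sub>0" .
  qed
  finally show "(\<Sum>s\<in>F. \<Sum>t\<in>F. ?f s t) \<in> \<real>\<^sub>\<ge>\<^sub>0" .
qed

theorem gns_action:
  fixes P :: "('g::topological_group_add \<Rightarrow> complex) set"
  assumes "\<And>\<phi>. \<phi> \<in> P \<Longrightarrow> normalized_pd \<phi>"
  shows "pre_hilbert_action pscale (kip (family_kernel P)) shift"
proof -
  interpret pre_hilbert pscale "kip (family_kernel P)"
    by (intro pd_kernel_pre_hilbert pd_family_kernel) (use assms in \<open>simp add: normalized_pd_def\<close>)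
  show ?thesis
  proof
    show "shift g (a + b) = shift g a + shift g b" for g and a b :: "('g \<Rightarrow> complex) \<times> 'g \<Rightarrow>\<^sub>0 complex"
      by (rule poly_mapping_eqI) (auto simp: lookup_add)
    show "shift 0 a = a" for a :: "('g \<Rightarrow> complex) \<times> 'g \<Rightarrow>\<^sub>0 complex"
      by (rule poly_mapping_eqI) auto
    show shift_plus: "shift (g + h) a = shift g (shift h a)" for g h and a :: "('g \<Rightarrow> complex) \<times> 'g \<Rightarrow>\<^sub>0 complex"
      by (rule poly_mapping_eqI) (simp only: split_paired_all lookup_shift minus_add add.assoc)
    show "kip (family_kernel P) (shift g a) (shift g b) = kip (family_kernel P) a b" for g a b
    proof -
      \<comment> \<open>\<open>kip_shift\<close> unfolds a shift in the first argument only, so the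
        form is conjugated to bring \<open>b\<close> there.\<close>
      have "kip (family_kernel P) (shift g a) (shift g b) = cnj (kip (family_kernel P) (shift g b) (shift g a))"
        by (rule ip_cnj) auto
      also have "\<dots> = (\<Sum>t\<in>keys b. \<Sum>s\<in>keys (shift g a).
          lookup (shift g a) s * cnj (lookup b t) * cnj (family_kernel P (fst t, g + snd t) s))"
        by (simp add: kip_shift[of _ g b] mult_ac)
      also have "\<dots> = (\<Sum>t\<in>keys b. \<Sum>s\<in>keys a.
          lookup a s * cnj (lookup b t) * cnj (family_kernel P (fst t, g + snd t) (fst s, g + snd s)))"
        by (intro sum.cong refl sum.reindex_bij_witness[where i = "\<lambda>(i, h). (i, g + h)" and j = "\<lambda>(i, h). (i, - g + h)"])
          (auto simp: in_keys_iff add.assoc[symmetric])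
      also have "\<dots> = (\<Sum>t\<in>keys b. \<Sum>s\<in>keys a. lookup a s * cnj (lookup b t) * family_kernel P s t)"
      proof (intro sum.cong refl, goal_cases)
        case (1 t s)
        have "cnj (family_kernel P (fst t, g + snd t) (fst s, g + snd s)) = cnj (family_kernel P t s)"
          by (simp only: family_kernel_def fst_conv snd_conv minus_add add.assoc minus_add_cancel)
        also have "\<dots> = family_kernel P s t"
          using ip_cnj[of "Poly_Mapping.single t 1" "Poly_Mapping.single s 1"] by (simp add: kip_single)
        finally show ?case by simp
      qed
      also have "\<dots> = kip (family_kernel P) a b"
        unfolding kip_def by (rule sum.swap)
      finally show ?thesis .
    qed
    show "continuous_on UNIV (\<lambda>g. kip (family_kernel P) (shift g a) a)" for a
    proof -
      have "continuous_on UNIV (\<lambda>g. family_kernel P (fst s, g + snd s) t)" for s t :: "('g \<Rightarrow> complex) \<times> 'g"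
      proof (cases "fst s = fst t \<and> fst s \<in> P")
        case True
        then have "continuous_on UNIV (fst t)" 
          using assms True unfolding normalized_pd_def by metis
        then have "continuous_on UNIV (\<lambda>g. fst t (- snd t + (g + snd s)))"
          by (rule continuous_on_compose2) (auto intro!: continuous_intros)
        then show ?thesis
          by (rule continuous_on_eq) (use True in \<open>auto simp: family_kernel_def\<close>)
      next
        case False
        show ?thesis
          by (rule continuous_on_eq[OF continuous_on_const[of _ 0]])
            (use False in \<open>auto simp: family_kernel_def\<close>)
      qed
      then show ?thesis unfolding kip_shift by (intro continuous_intros)
    qed
  qed
qed

section \<open>Subrepresentations and orthogonal projections\<close>

context semi_inner
begin

lemma ip_sum_left: "(\<And>i. i \<in> A \<Longrightarrow> x i \<in> V) \<Longrightarrow> y \<in> V \<Longrightarrow> ip (sum x A) y = (\<Sum>i\<in>A. ip (x i) y)"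
proof (induction A rule: infinite_finite_induct)
  case (insert a A)
  then show ?case using subspace_sum[OF sub, of A x] by (simp add: ip_add)
qed (simp_all add: ip_zero)

lemma ip_sum_right: "(\<And>i. i \<in> A \<Longrightarrow> x i \<in> V) \<Longrightarrow> y \<in> V \<Longrightarrow> ip y (sum x A) = (\<Sum>i\<in>A. ip y (x i))"
proof (induction A rule: infinite_finite_induct)
  case (insert a A)
  then show ?case using subspace_sum[OF sub, of A x] by (simp add: ip_right)
qed (simp_all add: ip_zero)

definition closed_in_norm :: "'v set \<Rightarrow> bool" where
  "closed_in_norm W \<longleftrightarrow> (\<forall>v\<in>V. (\<forall>e>0. \<exists>w\<in>W. hnorm ip (v - w) < e) \<longrightarrow> v \<in> W)"

end

locale hilbert = semi_inner s V ip
  for s :: "complex \<Rightarrow> 'v::ab_group_add \<Rightarrow> 'v" and V ip +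
  assumes hilbert: "hilbert_space s V ip"
begin

lemma hnorm_eq_0: "v \<in> V \<Longrightarrow> hnorm ip v = 0 \<Longrightarrow> v = 0"
  using hs_pos[OF hilbert, of v] by (auto simp: hnorm_def)

lemma hilbert_subspace:
  assumes W: "W \<subseteq> V" "subspace W" "closed_in_norm W"
  shows "hilbert_space s W ip"
  unfolding hilbert_space_def
proof (intro conjI allI impI)
  fix f :: "nat \<Rightarrow> 'v"
  assume f: "range f \<subseteq> W" and c: "\<forall>e>0. \<exists>N. \<forall>m\<ge>N. \<forall>n\<ge>N. hnorm ip (f m - f n) < e"
  have fV: "f n \<in> V" for n using f W(1) by blast
  obtain v where v: "v \<in> V" "(\<lambda>n. hnorm ip (f n - v)) \<longlonglongrightarrow> 0"
    using hs_complete[OF hilbert, of f] c fV by blast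
  have "\<exists>w\<in>W. hnorm ip (v - w) < e" if "e > 0" for e
  proof -
    have "\<forall>\<^sub>F n in sequentially. hnorm ip (f n - v) < e"
      using order_tendstoD(2)[OF v(2) that] .
    then obtain n where "hnorm ip (f n - v) < e" by (auto simp: eventually_sequentially)
    then have "hnorm ip (v - f n) < e" using hnorm_minus_commute[OF v(1) fV, of n] by simp
    then show ?thesis using f by blast
  qed
  then show "\<exists>v\<in>W. (\<lambda>n. hnorm ip (f n - v)) \<longlonglongrightarrow> 0"
    using v W(3) unfolding closed_in_norm_def by blast
next
  show "vector_space s" by (rule vs)
  show "subspace W" by (rule W(2))
  show "\<forall>u\<in>W. \<forall>v\<in>W. \<forall>w\<in>W. ip (u + v) w = ip u w + ip v w" using ip_add W(1) by blast
  show "\<forall>v\<in>W. \<forall>w\<in>W. ip (s c v) w = c * ip v w" for c using ip_scale W(1) by blast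
  show "\<forall>v\<in>W. \<forall>w\<in>W. ip w v = cnj (ip v w)" using ip_cnj W(1) by blast
  show "\<forall>v\<in>W. v \<noteq> 0 \<longrightarrow> 0 < Re (ip v v)" using hs_pos[OF hilbert] W(1) by blast
qed

lemma parallelogram:
  assumes "a \<in> V" "b \<in> V"
  shows "(hnorm ip (a - b))\<^sup>2 = 2 * (hnorm ip a)\<^sup>2 + 2 * (hnorm ip b)\<^sup>2 - (hnorm ip (a + b))\<^sup>2"
  using hnorm_add_sq[OF assms] hnorm_diff_sq[OF assms] by simp

text \<open>The classical argument: the parallelogram law makes a minimizing sequence Cauchy, and
  optimality of its limit under perturbations inside \<open>W\<close> gives orthogonality.\<close>

lemma orthogonal_projection:
  assumes W: "W \<subseteq> V" "subspace W" "closed_in_norm W" and v: "v \<in> V"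
  obtains w where "w \<in> W" "\<And>u. u \<in> W \<Longrightarrow> ip (v - w) u = 0"
proof -
  define D where "D = (\<lambda>w. (hnorm ip (v - w))\<^sup>2) ` W"
  define d where "d = Inf D"
  have D: "D \<noteq> {}" "bdd_below D"
    using subspace_0[OF W(2)] by (auto simp: D_def bdd_below_def intro!: exI[of _ 0])
  have dle: "d \<le> (hnorm ip (v - w))\<^sup>2" if "w \<in> W" for w
    unfolding d_def using that D(2) by (intro cInf_lower) (auto simp: D_def)
  have "\<exists>w\<in>W. (hnorm ip (v - w))\<^sup>2 < d + inverse (real (Suc n))" for n
    using cInf_lessD[OF D(1), of "d + inverse (real (Suc n))"] by (auto simp: d_def D_def)
  then obtain w where w: "\<And>n. w n \<in> W" "\<And>n. (hnorm ip (v - w n))\<^sup>2 < d + inverse (real (Suc n))"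
    by metis
  have wV: "w n \<in> V" for n using w(1) W(1) by blast
  have est: "(hnorm ip (w m - w n))\<^sup>2 \<le> 2 * inverse (real (Suc m)) + 2 * inverse (real (Suc n))" for m n
  proof -
    \<comment> \<open>The midpoint lies in \<open>W\<close>, so its squared distance from
      \<open>v\<close> is at least \<open>d\<close>, which is what the parallelogram law
      needs.\<close>
    have half: "s (1/2) (w m + w n) \<in> W"
      using W(2) w(1) by (intro subspace_scale subspace_add)
    have "s 2 (v - s (1/2) (w m + w n)) = (v - w n) + (v - w m)"
      using scale_left_distrib[of 1 1 v]
      by (simp add: scale_right_diff_distrib scale_right_distrib)
    then have "(hnorm ip ((v - w n) + (v - w m)))\<^sup>2 = 4 * (hnorm ip (v - s (1/2) (w m + w n)))\<^sup>2"
      using hnorm_scale[of "v - s (1/2) (w m + w n)" 2] mem(4)[OF v] half W(1)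
      by (simp add: power_mult_distrib subset_iff)
    moreover have "w m - w n = (v - w n) - (v - w m)" by simp
    ultimately show ?thesis
      using parallelogram[OF mem(4)[OF v wV] mem(4)[OF v wV], of n m] w(2)[of m] w(2)[of n]
        dle[OF half] by simp
  qed
  have cauchy: "\<exists>N. \<forall>m\<ge>N. \<forall>n\<ge>N. hnorm ip (w m - w n) < e" if e: "e > 0" for e
  proof -
    have "e\<^sup>2 / 4 > 0" using e by simp
    then obtain N where N: "inverse (real (Suc N)) < e\<^sup>2 / 4" using reals_Archimedean by blast
    have "hnorm ip (w m - w n) < e" if "m \<ge> N" "n \<ge> N" for m n
    proof -
      have "inverse (real (Suc m)) \<le> inverse (real (Suc N))" "inverse (real (Suc n)) \<le> inverse (real (Suc N))"
        using that by (auto intro!: le_imp_inverse_le)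
      then have "(hnorm ip (w m - w n))\<^sup>2 < e\<^sup>2" using est[of m n] N by linarith
      then show ?thesis using e by (simp add: power2_less_imp_less)
    qed
    then show ?thesis by blast
  qed
  have "range w \<subseteq> W" using w(1) by blast
  from hs_complete[OF hilbert_subspace[OF W] this cauchy]
  obtain z where z: "z \<in> W" "(\<lambda>n. hnorm ip (w n - z)) \<longlonglongrightarrow> 0" by blast
  have zV: "z \<in> V" using z(1) W(1) by blast
  have zle: "(hnorm ip (v - z))\<^sup>2 \<le> d"
  proof (rule LIMSEQ_le_const)
    have "hnorm ip (v - z) \<le> sqrt (d + inverse (real (Suc n))) + hnorm ip (w n - z)" for n
    proof -
      have "hnorm ip (v - w n) \<le> sqrt (d + inverse (real (Suc n)))"
        using w(2)[of n] by (intro real_le_rsqrt) simp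
      then show ?thesis using hnorm_triangle_diff[OF v wV zV, of n] by linarith
    qed
    then have "(hnorm ip (v - z))\<^sup>2 \<le> (sqrt (d + inverse (real (Suc n))) + hnorm ip (w n - z))\<^sup>2" for n
      using hnorm_nonneg[OF mem(4)[OF v zV]] by (intro power_mono)
    then show "\<exists>N. \<forall>n\<ge>N. (hnorm ip (v - z))\<^sup>2 \<le> (sqrt (d + inverse (real (Suc n))) + hnorm ip (w n - z))\<^sup>2"
      by blast
    have "(\<lambda>n. (sqrt (d + inverse (real (Suc n))) + hnorm ip (w n - z))\<^sup>2) \<longlonglongrightarrow> (sqrt (d + 0) + 0)\<^sup>2"
      by (intro tendsto_intros z(2) LIMSEQ_inverse_real_of_nat)
    moreover have "d \<ge> 0" unfolding d_def by (rule cInf_greatest[OF D(1)]) (auto simp: D_def)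
    ultimately show "(\<lambda>n. (sqrt (d + inverse (real (Suc n))) + hnorm ip (w n - z))\<^sup>2) \<longlonglongrightarrow> d"
      by simp
  qed
  have "ip (v - z) u = 0" if u: "u \<in> W" for u
  proof (rule ccontr)
    define b where "b = ip (v - z) u"
    assume "ip (v - z) u \<noteq> 0"
    then have b: "(cmod b)\<^sup>2 > 0" by (simp add: b_def)
    have uV: "u \<in> V" using u W(1) by blast
    \<comment> \<open>Adding one avoids a division by zero. Perturbing by \<open>s c u\<close> with
      \<open>c = b / M\<close> would lower the squared distance by at least the square of
      \<open>cmod b\<close> over \<open>M\<close>, contradicting minimality.\<close>
    define M where "M = (hnorm ip u)\<^sup>2 + 1"
    have M: "M > 0" "(hnorm ip u)\<^sup>2 \<le> M" by (simp_all add: M_def add_nonneg_pos)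
    define c where "c = of_real (1 / M) * b"
    have cu: "s c u \<in> V" using uV mem by blast
    have "d \<le> (hnorm ip (v - (z + s c u)))\<^sup>2"
      using dle[of "z + s c u"] z u W(2) subspace_add subspace_scale by blast
    also have "v - (z + s c u) = (v - z) - s c u" by simp
    also have "(hnorm ip ((v - z) - s c u))\<^sup>2 =
        (hnorm ip (v - z))\<^sup>2 + (cmod c * hnorm ip u)\<^sup>2 - 2 * Re (cnj c * b)"
      using uV cu mem(4)[OF v zV] by (simp add: hnorm_diff_sq hnorm_scale ip_right(3) b_def)
    also have "cnj c * b = of_real ((cmod b)\<^sup>2 / M)"
      using complex_norm_square[of b] by (simp add: c_def mult.commute)
    finally have "2 * ((cmod b)\<^sup>2 / M) \<le> (cmod c * hnorm ip u)\<^sup>2" using zle by simp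
    also have "\<dots> = (cmod b)\<^sup>2 / M * ((hnorm ip u)\<^sup>2 / M)"
      using M(1) by (simp add: c_def norm_mult norm_divide power_mult_distrib power_divide power2_eq_square)
    also have "\<dots> \<le> (cmod b)\<^sup>2 / M * 1"
      using M b by (intro mult_left_mono) auto
    finally show False using b M(1) by (simp add: field_simps)
  qed
  then show ?thesis using that z(1) by blast
qed

definition orth :: "'v set \<Rightarrow> 'v set" where
  "orth W = {v \<in> V. \<forall>w\<in>W. ip v w = 0}"

lemma orth_closed:
  assumes "W \<subseteq> V"
  shows "orth W \<subseteq> V" "subspace (orth W)" "closed_in_norm (orth W)"
proof -
  show "orth W \<subseteq> V" by (auto simp: orth_def)
  show "subspace (orth W)"
    unfolding subspace_def orth_def using assms mem by (auto simp: ip_zero ip_add ip_scale subset_iff)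
  show "closed_in_norm (orth W)"
    unfolding closed_in_norm_def
  proof (intro ballI impI)
    fix v assume v: "v \<in> V" and cl: "\<forall>e>0. \<exists>w\<in>orth W. hnorm ip (v - w) < e"
    have "ip v w = 0" if w: "w \<in> W" for w
    proof (rule ccontr)
      assume nz: "ip v w \<noteq> 0"
      have wV: "w \<in> V" using w assms by blast
      define M where "M = hnorm ip w + 1"
      have M: "M > 0" "hnorm ip w \<le> M" using hnorm_nonneg[OF wV] by (auto simp: M_def)
      then obtain x where x: "x \<in> orth W" "hnorm ip (v - x) < cmod (ip v w) / M"
        using cl nz by (metis divide_pos_pos zero_less_norm_iff)
      have xV: "x \<in> V" using x(1) by (simp add: orth_def)
      have "ip (v - x) w = ip v w" using x(1) w v xV wV by (simp add: ip_diff orth_def)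
      then have "cmod (ip v w) \<le> hnorm ip (v - x) * hnorm ip w"
        using cauchy_schwarz[OF mem(4)[OF v xV] wV] by simp
      also have "\<dots> \<le> hnorm ip (v - x) * M"
        using M hnorm_nonneg[OF mem(4)[OF v xV]] by (intro mult_left_mono)
      also have "\<dots> < cmod (ip v w)" using x(2) M(1) by (simp add: field_simps)
      finally show False by simp
    qed
    then show "v \<in> orth W" using v by (simp add: orth_def)
  qed
qed

end

section \<open>Unitary representations and their coefficients\<close>

locale unitary_representation = hilbert s V ip
  for s :: "complex \<Rightarrow> 'v::ab_group_add \<Rightarrow> 'v" and V ip +
  fixes \<pi> :: "'g::topological_group_add \<Rightarrow> 'v \<Rightarrow> 'v"
  assumes rep: "unitary_rep s V ip \<pi>"
begin

lemma act_mem: "v \<in> V \<Longrightarrow> \<pi> g v \<in> V"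
  using rep unfolding unitary_rep_def unitary_operator_def by blast

lemma act_ip: "u \<in> V \<Longrightarrow> v \<in> V \<Longrightarrow> ip (\<pi> g u) (\<pi> g v) = ip u v"
  using rep unfolding unitary_rep_def unitary_operator_def by blast

lemma act_add: "u \<in> V \<Longrightarrow> v \<in> V \<Longrightarrow> \<pi> g (u + v) = \<pi> g u + \<pi> g v"
  using rep unfolding unitary_rep_def unitary_operator_def by blast

lemma act_scale: "v \<in> V \<Longrightarrow> \<pi> g (s c v) = s c (\<pi> g v)"
  using rep unfolding unitary_rep_def unitary_operator_def by blast

lemma act_group: "v \<in> V \<Longrightarrow> \<pi> 0 v = v" "v \<in> V \<Longrightarrow> \<pi> (g + h) v = \<pi> g (\<pi> h v)"
  using rep unfolding unitary_rep_def by blast+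

lemma act_diff: "u \<in> V \<Longrightarrow> v \<in> V \<Longrightarrow> \<pi> g (u - v) = \<pi> g u - \<pi> g v"
  using act_add[of "u - v" v] mem(4) by simp

lemma act_norm: "v \<in> V \<Longrightarrow> hnorm ip (\<pi> g v) = hnorm ip v"
  by (simp add: hnorm_def act_ip)

lemma act_adj: "u \<in> V \<Longrightarrow> v \<in> V \<Longrightarrow> ip (\<pi> g u) v = ip u (\<pi> (- g) v)"
  using act_ip[of u "\<pi> (- g) v" g] act_mem[of v "- g"] act_group(1)[of v] act_group(2)[of v g "- g"] by simp

lemma act_norm_diff: "v \<in> V \<Longrightarrow> hnorm ip (\<pi> g v - \<pi> h v) = hnorm ip (\<pi> (- h + g) v - v)"
proof -
  assume v: "v \<in> V"
  have "\<pi> g v - \<pi> h v = \<pi> h (\<pi> (- h + g) v - v)"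
    using v act_mem act_group(2)[OF v, of h "- h + g"] by (simp add: act_diff)
  then show ?thesis using v act_mem mem(4) by (simp add: act_norm)
qed

lemma act_norm_le:
  assumes "u \<in> V" "v \<in> V"
  shows "hnorm ip (\<pi> g u - u) \<le> 2 * hnorm ip (u - v) + hnorm ip (\<pi> g v - v)"
proof -
  have "hnorm ip (\<pi> g u - u) \<le> hnorm ip (\<pi> g u - \<pi> g v) + hnorm ip (\<pi> g v - u)"
    by (intro hnorm_triangle_diff act_mem assms)
  moreover have "hnorm ip (\<pi> g v - u) \<le> hnorm ip (\<pi> g v - v) + hnorm ip (v - u)"
    by (intro hnorm_triangle_diff act_mem assms)
  moreover have "hnorm ip (\<pi> g u - \<pi> g v) = hnorm ip (u - v)"
    using assms mem(4) by (simp add: act_norm flip: act_diff)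
  moreover have "hnorm ip (v - u) = hnorm ip (u - v)"
    by (intro hnorm_minus_commute assms)
  ultimately show ?thesis by linarith
qed

lemma unitary_subrep:
  assumes W: "W \<subseteq> V" "subspace W" "closed_in_norm W" and inv: "\<And>g w. w \<in> W \<Longrightarrow> \<pi> g w \<in> W"
  shows "unitary_rep s W ip \<pi>"
proof -
  have "v \<in> \<pi> g ` W" if "v \<in> W" for g v
    using act_group(2)[of v g "- g"] act_group(1)[of v] that W(1) inv[OF that, of "- g"]
    by (intro image_eqI[of _ _ "\<pi> (- g) v"]) auto
  then have "\<pi> g ` W = W" for g using inv by blast
  then have "unitary_operator s W ip (\<pi> g)" for g
    unfolding unitary_operator_def using W(1) act_add act_scale act_ip by (simp add: subset_iff)
  then show ?thesis
    using rep hilbert_subspace[OF W] W(1) unfolding unitary_rep_def by blast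
qed

text \<open>The quadratic form of the coefficient is the squared norm of the sum of the vectors
  \<open>s (c i) (\<pi> (g i) w)\<close>.\<close>

lemma coefficient_pd:
  assumes w: "w \<in> V"
  shows "positive_definite (\<lambda>h. ip (\<pi> h w) w)"
  unfolding positive_definite_def
proof (intro allI)
  fix n g and c :: "nat \<Rightarrow> complex"
  define x where "x = (\<Sum>i<n. s (c i) (\<pi> (g i) w))"
  have m: "s (c i) (\<pi> (g i) w) \<in> V" "\<pi> h w \<in> V" for i h using w act_mem mem(3) by blast+
  then have xV: "x \<in> V" unfolding x_def by (intro subspace_sum sub)
  have "ip y x = (\<Sum>j<n. cnj (c j) * ip y (\<pi> (g j) w))" if "y \<in> V" for y
    unfolding x_def using m that by (simp add: ip_sum_right ip_right)
  moreover have "ip x x = (\<Sum>i<n. c i * ip (\<pi> (g i) w) x)"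
    by (subst x_def) (use m xV in \<open>simp add: ip_sum_left ip_scale\<close>)
  ultimately have "ip x x = (\<Sum>i<n. \<Sum>j<n. c i * cnj (c j) * ip (\<pi> (g i) w) (\<pi> (g j) w))"
    using m by (simp add: sum_distrib_left mult.assoc)
  moreover have "ip (\<pi> (- h + k) w) w = ip (\<pi> k w) (\<pi> h w)" for h k
    using act_ip[of "\<pi> (- h + k) w" w h] act_group(2)[OF w, of h "- h + k"] m(2) w by simp
  moreover have "ip x x \<in> \<real>\<^sub>\<ge>\<^sub>0"
    unfolding ip_self[OF xV] by (simp only: nonneg_Reals_of_real_iff zero_le_power2)
  ultimately show "(\<Sum>i<n. \<Sum>j<n. c i * cnj (c j) * ip (\<pi> (- g j + g i) w) w) \<in> \<real>\<^sub>\<ge>\<^sub>0"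
    by simp
qed

end

lemma unitary_representationI: "unitary_rep s V ip \<pi> \<Longrightarrow> unitary_representation s V ip \<pi>"
  unfolding unitary_representation_def unitary_representation_axioms_def hilbert_def hilbert_axioms_def
  using hilbert_semi_inner by (auto simp: unitary_rep_def)

section \<open>Approximating positive definite functions along a resolution\<close>

lemma eventually_nhds_uniform:
  fixes q :: "'q::topological_group_add"
  assumes "open U" "0 \<in> U"
  obtains N where "open N" "q \<in> N" "\<And>x y. x \<in> N \<Longrightarrow> y \<in> N \<Longrightarrow> - y + x \<in> U"
proof -
  have "((\<lambda>z. - snd z + fst z) \<longlongrightarrow> - q + q) (nhds q \<times>\<^sub>F nhds q)"
    by (intro tendsto_intros filterlim_fst filterlim_snd)
  then have "\<forall>\<^sub>F z in nhds q \<times>\<^sub>F nhds q. - snd z + fst z \<in> U"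
    using assms by (auto dest: topological_tendstoD)
  then obtain P where P: "eventually P (nhds q)" "\<And>x y. P x \<Longrightarrow> P y \<Longrightarrow> - y + x \<in> U"
    unfolding eventually_prod_same by auto
  then show ?thesis using that unfolding eventually_nhds by metis
qed

lemma dense_meets_open:
  assumes "closure (range p) = UNIV" "open N" "q \<in> N"
  obtains h where "p h \<in> N"
  using assms open_Int_closure_eq_empty[of N "range p"] by blast

text \<open>\<open>\<theta>\<close> is uniformly continuous for the left uniformity pulled back by
  \<open>p\<close>; hence its values along \<open>p h\<close> tending to \<open>q\<close> form a
  Cauchy filter, and completeness of the complex numbers supplies \<open>\<phi> q\<close>.
  Evaluating the limit estimate at \<open>p h\<close> itself gives agreement with
  \<open>\<theta>\<close>.\<close>

lemma extend_from_dense: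
  fixes p :: "'h::topological_group_add \<Rightarrow> 'q::topological_group_add" and \<theta> :: "'h \<Rightarrow> complex"
  assumes dense: "closure (range p) = UNIV"
    and uc: "\<And>e. e > 0 \<Longrightarrow> \<exists>U. open U \<and> 0 \<in> U \<and> (\<forall>h k. - p k + p h \<in> U \<longrightarrow> cmod (\<theta> h - \<theta> k) < e)"
  obtains \<phi> where "continuous_on UNIV \<phi>" "\<And>h. \<phi> (p h) = \<theta> h"
proof -
  have loc: "\<exists>N. open N \<and> q \<in> N \<and> (\<forall>h k. p h \<in> N \<longrightarrow> p k \<in> N \<longrightarrow> cmod (\<theta> h - \<theta> k) < e)"
    if "e > 0" for q e
    using uc[OF that] eventually_nhds_uniform by metis
  have "\<exists>z. \<forall>e>0. \<exists>N. open N \<and> q \<in> N \<and> (\<forall>h. p h \<in> N \<longrightarrow> cmod (\<theta> h - z) \<le> e)" for q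
  proof -
    define F where "F = filtermap \<theta> (filtercomap p (nhds q))"
    have ev: "eventually P F \<longleftrightarrow> (\<exists>N. open N \<and> q \<in> N \<and> (\<forall>h. p h \<in> N \<longrightarrow> P (\<theta> h)))" for P
    proof
      assume "eventually P F"
      then obtain Q where "eventually Q (nhds q)" "\<And>h. Q (p h) \<Longrightarrow> P (\<theta> h)"
        unfolding F_def eventually_filtermap eventually_filtercomap by blast
      then show "\<exists>N. open N \<and> q \<in> N \<and> (\<forall>h. p h \<in> N \<longrightarrow> P (\<theta> h))"
        unfolding eventually_nhds by meson
    next
      assume "\<exists>N. open N \<and> q \<in> N \<and> (\<forall>h. p h \<in> N \<longrightarrow> P (\<theta> h))"
      then obtain N where "open N" "q \<in> N" "\<And>h. p h \<in> N \<Longrightarrow> P (\<theta> h)" by blast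
      then show "eventually P F"
        unfolding F_def eventually_filtermap eventually_filtercomap
        by (intro exI[of _ "\<lambda>x. x \<in> N"]) (auto intro: eventually_nhds_in_open)
    qed
    have "cauchy_filter F"
      unfolding cauchy_filter_metric
    proof (intro allI impI)
      fix e :: real assume "e > 0"
      from loc[OF this, of q] obtain N where
        N: "open N" "q \<in> N" "\<And>h k. p h \<in> N \<Longrightarrow> p k \<in> N \<Longrightarrow> cmod (\<theta> h - \<theta> k) < e" by blast
      then show "\<exists>P. eventually P F \<and> (\<forall>x y. P x \<and> P y \<longrightarrow> dist x y < e)"
        unfolding ev by (intro exI[of _ "\<lambda>z. \<exists>h. p h \<in> N \<and> z = \<theta> h"]) (auto simp: dist_norm)
    qed
    moreover have "F \<noteq> bot"
      unfolding trivial_limit_def ev using dense_meets_open[OF dense] by metis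
    ultimately obtain z where z: "F \<le> nhds z"
      using cauchy_filter_complete_converges[OF _ complete_UNIV] by auto
    have "\<exists>N. open N \<and> q \<in> N \<and> (\<forall>h. p h \<in> N \<longrightarrow> cmod (\<theta> h - z) \<le> e)" if "e > 0" for e
    proof -
      have "eventually (\<lambda>x. dist x z < e) F"
        using z that by (intro filter_leD[OF z]) (auto simp: eventually_nhds_metric)
      then show ?thesis unfolding ev dist_norm by (meson less_imp_le)
    qed
    then show ?thesis by blast
  qed
  then obtain \<phi> where \<phi>:
    "\<And>q e. e > 0 \<Longrightarrow> \<exists>N. open N \<and> q \<in> N \<and> (\<forall>h. p h \<in> N \<longrightarrow> cmod (\<theta> h - \<phi> q) \<le> e)"
    by metis
  have "\<phi> (p h) = \<theta> h" for h
  proof -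
    have "cmod (\<theta> h - \<phi> (p h)) \<le> 0 + e" if "e > 0" for e
      using \<phi>[OF that, of "p h"] by auto
    then have "cmod (\<theta> h - \<phi> (p h)) \<le> 0" by (rule field_le_epsilon)
    then show ?thesis by simp
  qed
  moreover have "(\<phi> \<longlongrightarrow> \<phi> q) (at q)" for q
  proof (rule tendstoI)
    fix e :: real assume "e > 0"
    then have e: "e / 3 > 0" by simp
    from \<phi>[OF this, of q] obtain N where
      N: "open N" "q \<in> N" "\<And>h. p h \<in> N \<Longrightarrow> cmod (\<theta> h - \<phi> q) \<le> e / 3" by blast
    have "dist (\<phi> r) (\<phi> q) < e" if "r \<in> N" for r
    proof -
      from \<phi>[OF e, of r] obtain M where
        M: "open M" "r \<in> M" "\<And>h. p h \<in> M \<Longrightarrow> cmod (\<theta> h - \<phi> r) \<le> e / 3" by blast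
      have "open (N \<inter> M)" "r \<in> N \<inter> M" using N M that by auto
      then obtain h where "p h \<in> N \<inter> M" by (rule dense_meets_open[OF dense])
      then have "dist (\<theta> h) (\<phi> q) \<le> e / 3" "dist (\<theta> h) (\<phi> r) \<le> e / 3"
        using N(3) M(3) by (simp_all add: dist_norm)
      then show ?thesis using dist_triangle3[of "\<phi> r" "\<phi> q" "\<theta> h"] \<open>e > 0\<close> by linarith
    qed
    then show "\<forall>\<^sub>F r in at q. dist (\<phi> r) (\<phi> q) < e"
      unfolding eventually_at_topological using N by blast
  qed
  then have "continuous_on UNIV \<phi>" by (simp add: continuous_on_def)
  ultimately show ?thesis using that by blast
qed

text \<open>Nonnegativity is a closed condition in each argument separately, so the points
  \<open>g i\<close> can be moved from \<open>range p\<close> to arbitrary positions one at a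
  time.\<close>

lemma positive_definite_dense:
  fixes p :: "'h::topological_group_add \<Rightarrow> 'q::topological_group_add"
  assumes dense: "closure (range p) = UNIV" and hom: "\<And>x y. p (x + y) = p x + p y"
    and cont: "continuous_on UNIV \<phi>" and pd: "positive_definite (\<lambda>h. \<phi> (p h))"
  shows "positive_definite \<phi>"
  unfolding positive_definite_def
proof (intro allI)
  fix n and g :: "nat \<Rightarrow> 'q" and c :: "nat \<Rightarrow> complex"
  define S where "S g = (\<Sum>i<n. \<Sum>j<n. c i * cnj (c j) * \<phi> (- g j + g i))" for g :: "nat \<Rightarrow> 'q"
  \<comment> \<open>Entries below \<open>m\<close> are arbitrary and the others lie in
    \<open>range p\<close>; the induction step frees entry \<open>m\<close> by density.\<close>
  have "S g \<in> \<real>\<^sub>\<ge>\<^sub>0" if "\<And>i. i \<ge> m \<Longrightarrow> g i \<in> range p" for m and g :: "nat \<Rightarrow> 'q"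
    using that
  proof (induction m arbitrary: g)
    case 0
    then have "\<forall>i. \<exists>k. g i = p k" by blast
    then obtain k where k: "\<And>i. g i = p (k i)" by metis
    have "S g = (\<Sum>i<n. \<Sum>j<n. c i * cnj (c j) * \<phi> (p (- k j + k i)))"
      by (simp add: S_def k hom additive_zero_minus[of p, OF hom])
    then show ?case using positive_definiteD[OF pd] by simp
  next
    case (Suc m)
    have "continuous_on UNIV (\<lambda>q. if i = m then q else g i)" for i
      by (cases "i = m") (auto intro: continuous_on_id continuous_on_const)
    then have "continuous_on UNIV (\<lambda>q. S (g(m := q)))"
      unfolding S_def fun_upd_def
      by (intro continuous_intros continuous_on_compose2[OF cont]) auto
    from closed_vimage[OF closed_nonneg_Reals_complex this]
    have "closed {q. S (g(m := q)) \<in> \<real>\<^sub>\<ge>\<^sub>0}" by (simp add: vimage_def)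
    moreover have "S (g(m := p h)) \<in> \<real>\<^sub>\<ge>\<^sub>0" for h
    proof (rule Suc.IH)
      show "(g(m := p h)) i \<in> range p" if "i \<ge> m" for i
        using Suc.prems[of i] that by (cases "i = m") auto
    qed
    then have "range p \<subseteq> {q. S (g(m := q)) \<in> \<real>\<^sub>\<ge>\<^sub>0}" by blast
    ultimately have "closure (range p) \<subseteq> {q. S (g(m := q)) \<in> \<real>\<^sub>\<ge>\<^sub>0}"
      by (rule closure_minimal[rotated])
    then have "g m \<in> {q. S (g(m := q)) \<in> \<real>\<^sub>\<ge>\<^sub>0}" using dense by blast
    then show ?case by simp
  qed
  note * = this
  \<comment> \<open>Entries from \<open>n\<close> on do not occur in the sum; the value
    \<open>0 = p 0\<close> places them in \<open>range p\<close>.\<close>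
  define g' where "g' i = (if i < n then g i else 0)" for i
  have "g' i \<in> range p" if "i \<ge> n" for i
    using that additive_zero_minus(1)[of p, OF hom] by (auto simp: g'_def intro: range_eqI[of _ _ 0])
  then have "S g' \<in> \<real>\<^sub>\<ge>\<^sub>0" by (rule *)
  then show "(\<Sum>i<n. \<Sum>j<n. c i * cnj (c j) * \<phi> (- g j + g i)) \<in> \<real>\<^sub>\<ge>\<^sub>0"
    by (simp add: S_def g'_def)
qed

text \<open>Continuity of the orbit map at the identity for the topology pulled back by
  \<open>p\<close>; isometry turns it into the left uniform continuity required by
  \<open>extend_from_dense\<close>.\<close>

definition continuous_along ::
    "('h \<Rightarrow> 'q::{zero,topological_space}) \<Rightarrow> ('v::ab_group_add \<Rightarrow> 'v \<Rightarrow> complex) \<Rightarrow> ('h \<Rightarrow> 'v \<Rightarrow> 'v) \<Rightarrow> 'v \<Rightarrow> bool" where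
  "continuous_along p ip \<pi> v \<longleftrightarrow>
     (\<forall>e>0. \<exists>U. open U \<and> 0 \<in> U \<and> (\<forall>h. p h \<in> U \<longrightarrow> hnorm ip (\<pi> h v - v) < e))"

lemma resolution_hom: "resolution p \<Longrightarrow> p (x + y) = p x + p y"
  and resolution_dense: "resolution p \<Longrightarrow> closure (range p) = UNIV"
  and resolution_continuous: "resolution p \<Longrightarrow> continuous_on UNIV p"
  by (simp_all add: resolution_def)

text \<open>The resolving property enters the proof only here. A vector of the factored
  subrepresentation has an orbit map that is continuous on the target, hence continuous along
  \<open>p\<close>.\<close>

lemma resolution_continuous_vector:
  fixes p :: "'h::topological_group_add \<Rightarrow> 'q::topological_group_add"
  assumes "resolution p" "unitary_rep s V ip \<pi>" "almost_invariant_vectors V ip \<pi>"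
  obtains v where "v \<in> V" "v \<noteq> 0" "continuous_along p ip \<pi> v"
proof -
  obtain W \<rho> where W: "W \<subseteq> V" "W \<noteq> {0}" "unitary_rep s W ip \<rho>"
    and \<rho>: "\<And>h v. v \<in> W \<Longrightarrow> \<pi> h v = \<rho> (p h) v"
    using resolution_universal[OF assms] unfolding resolves_def by metis
  interpret unitary_representation s W ip \<rho> by (rule unitary_representationI[OF W(3)])
  obtain v where v: "v \<in> W" "v \<noteq> 0" using W(2) mem(1) by blast
  have "\<exists>U. open U \<and> 0 \<in> U \<and> (\<forall>h. p h \<in> U \<longrightarrow> hnorm ip (\<pi> h v - v) < e)" if e: "e > 0" for e
  proof -
    have "((\<lambda>q. hnorm ip (\<rho> q v - \<rho> 0 v)) \<longlongrightarrow> 0) (at 0)"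
      using W(3) v(1) unfolding unitary_rep_def by blast
    from order_tendstoD(2)[OF this e] obtain U where U: "open U" "0 \<in> U"
      "\<And>q. q \<in> U \<Longrightarrow> q \<noteq> 0 \<Longrightarrow> hnorm ip (\<rho> q v - v) < e"
      unfolding eventually_at_topological using act_group(1)[OF v(1)] by auto
    have "hnorm ip (\<rho> q v - v) < e" if "q \<in> U" for q
      using U(3)[OF that] act_group(1)[OF v(1)] e by (cases "q = 0") (auto simp: hnorm_zero)
    then show ?thesis using U \<rho>[OF v(1)] by (intro exI[of _ U]) auto
  qed
  then show ?thesis using that v W(1) unfolding continuous_along_def by blast
qed

context unitary_representation
begin

lemma continuous_along_subspace:
  fixes p :: "'g \<Rightarrow> 'q::topological_group_add"
  assumes hom: "\<And>x y. p (x + y) = p x + p y"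
  defines "W \<equiv> {v \<in> V. continuous_along p ip \<pi> v}"
  shows "W \<subseteq> V" "subspace W" "closed_in_norm W" "\<And>g w. w \<in> W \<Longrightarrow> \<pi> g w \<in> W"
proof -
  show "W \<subseteq> V" by (auto simp: W_def)
  \<comment> \<open>Sums use \<open>C = 1\<close>; scalar multiples take \<open>u = v\<close> and
    \<open>C\<close> the modulus of the scalar.\<close>
  have comb: "continuous_along p ip \<pi> w"
    if uv: "u \<in> V" "v \<in> V" and w: "w \<in> V" and c: "continuous_along p ip \<pi> u" "continuous_along p ip \<pi> v"
      and le: "\<And>h. hnorm ip (\<pi> h w - w) \<le> C * hnorm ip (\<pi> h u - u) + hnorm ip (\<pi> h v - v)"
      and C: "C \<ge> 0" for u v w C
    unfolding continuous_along_def
  proof (intro allI impI)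
    fix e :: real assume "e > 0"
    then have "e / 2 / (C + 1) > 0" "e / 2 > 0" using C by simp_all
    then obtain U1 U2 where U: "open U1" "0 \<in> U1" "\<And>h. p h \<in> U1 \<Longrightarrow> hnorm ip (\<pi> h u - u) < e / 2 / (C + 1)"
      "open U2" "0 \<in> U2" "\<And>h. p h \<in> U2 \<Longrightarrow> hnorm ip (\<pi> h v - v) < e / 2"
      using c unfolding continuous_along_def by metis
    have "hnorm ip (\<pi> h w - w) < e" if "p h \<in> U1 \<inter> U2" for h
    proof -
      have "C * hnorm ip (\<pi> h u - u) \<le> (C + 1) * hnorm ip (\<pi> h u - u)"
        using hnorm_nonneg[OF mem(4)[OF act_mem[OF uv(1), of h] uv(1)]] by (simp add: mult_right_mono)
      also have "\<dots> < e / 2" using U(3)[of h] that C by (simp add: field_simps)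
      finally show ?thesis using le[of h] U(6)[of h] that by simp
    qed
    then show "\<exists>U. open U \<and> 0 \<in> U \<and> (\<forall>h. p h \<in> U \<longrightarrow> hnorm ip (\<pi> h w - w) < e)"
      using U by (intro exI[of _ "U1 \<inter> U2"]) auto
  qed
  have zero: "0 \<in> W"
  proof -
    have "\<pi> h 0 = 0" for h using act_diff[of 0 0] mem(1) by simp
    then show ?thesis
      using mem(1) by (auto simp: W_def continuous_along_def hnorm_zero intro!: exI[of _ UNIV])
  qed
  show "subspace W"
    unfolding subspace_def
  proof (intro conjI allI ballI zero)
    fix u v assume "u \<in> W" "v \<in> W"
    then have uv: "u \<in> V" "v \<in> V" "continuous_along p ip \<pi> u" "continuous_along p ip \<pi> v"
      by (auto simp: W_def)
    have "hnorm ip (\<pi> h (u + v) - (u + v)) \<le> 1 * hnorm ip (\<pi> h u - u) + hnorm ip (\<pi> h v - v)" for h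
      using hnorm_triangle[of "\<pi> h u - u" "\<pi> h v - v"] uv mem(4) act_mem
      by (simp add: act_add algebra_simps)
    from comb[OF uv(1,2) mem(2)[OF uv(1,2)] uv(3,4) this] show "u + v \<in> W"
      using mem(2)[OF uv(1,2)] by (simp add: W_def)
  next
    fix c v assume "v \<in> W"
    then have v: "v \<in> V" "continuous_along p ip \<pi> v" by (auto simp: W_def)
    have "hnorm ip (\<pi> h (s c v) - s c v) \<le> cmod c * hnorm ip (\<pi> h v - v) + hnorm ip (\<pi> h v - v)" for h
      using hnorm_scale[of "\<pi> h v - v" c] hnorm_nonneg[of "\<pi> h v - v"] v mem(4) act_mem
      by (simp add: act_scale scale_right_diff_distrib)
    from comb[OF v(1,1) mem(3)[OF v(1)] v(2,2) this] show "s c v \<in> W"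
      using mem(3)[OF v(1)] by (simp add: W_def)
  qed
  show "closed_in_norm W"
    unfolding closed_in_norm_def
  proof (intro ballI impI)
    fix v assume v: "v \<in> V" and cl: "\<forall>e>0. \<exists>w\<in>W. hnorm ip (v - w) < e"
    have "\<exists>U. open U \<and> 0 \<in> U \<and> (\<forall>h. p h \<in> U \<longrightarrow> hnorm ip (\<pi> h v - v) < e)" if "e > 0" for e
    proof -
      have e: "e / 4 > 0" "e / 2 > 0" using that by simp_all
      then obtain w where w: "w \<in> V" "continuous_along p ip \<pi> w" "hnorm ip (v - w) < e / 4"
        using cl unfolding W_def by blast
      then obtain U where U: "open U" "0 \<in> U" "\<And>h. p h \<in> U \<Longrightarrow> hnorm ip (\<pi> h w - w) < e / 2"
        using e unfolding continuous_along_def by blast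
      have "hnorm ip (\<pi> h v - v) < e" if "p h \<in> U" for h
        using act_norm_le[OF v w(1), of h] U(3)[OF that] w(3) by linarith
      then show ?thesis using U by blast
    qed
    then show "v \<in> W" using v by (simp add: W_def continuous_along_def)
  qed
  show "\<pi> g w \<in> W" if "w \<in> W" for g w
  proof -
    have w: "w \<in> V" "continuous_along p ip \<pi> w" using that by (auto simp: W_def)
    have "\<exists>U. open U \<and> 0 \<in> U \<and> (\<forall>h. p h \<in> U \<longrightarrow> hnorm ip (\<pi> h (\<pi> g w) - \<pi> g w) < e)" if e: "e > 0" for e
    proof -
      obtain U where U: "open U" "0 \<in> U" "\<And>h. p h \<in> U \<Longrightarrow> hnorm ip (\<pi> h w - w) < e"
        using w(2) e unfolding continuous_along_def by blast
      \<comment> \<open>The displacement of \<open>\<pi> g w\<close> under \<open>h\<close> is that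
        of \<open>w\<close> under \<open>- g + h + g\<close>, so \<open>U\<close> is pulled back by
        conjugation with \<open>p g\<close>.\<close>
      define U' where "U' = (\<lambda>q. - p g + q + p g) -` U"
      have "open U'" unfolding U'_def by (intro open_vimage U(1) continuous_intros)
      moreover have "0 \<in> U'" using U(2) by (simp add: U'_def)
      moreover have "hnorm ip (\<pi> h (\<pi> g w) - \<pi> g w) < e" if "p h \<in> U'" for h
      proof -
        have "p (- g + (h + g)) \<in> U"
          using that by (simp add: U'_def hom additive_zero_minus[of p, OF hom] add.assoc)
        from U(3)[OF this] show ?thesis
          using act_norm_diff[OF w(1), of "h + g" g] act_group(2)[OF w(1), of h g] by simp
      qed
      ultimately show ?thesis by blast
    qed
    then show ?thesis using act_mem[OF w(1)] by (simp add: W_def continuous_along_def)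
  qed
qed

lemma orth_invariant:
  assumes "W \<subseteq> V" "\<And>g w. w \<in> W \<Longrightarrow> \<pi> g w \<in> W" "v \<in> orth W"
  shows "\<pi> g v \<in> orth W"
  using assms act_adj[of v _ g] act_mem[of v g] by (auto simp: orth_def subset_iff)

end

text \<open>Putting all normalized positive definite functions into one representation makes
  \<open>K\<close> and \<open>d\<close> independent of the function to be approximated. The
  approximant is the coefficient of the projection \<open>w\<close> of its cyclic vector, extended
  to the target and rescaled.\<close>

theorem resolution_approximation:
  fixes p :: "'h::topological_group_add \<Rightarrow> 'q::topological_group_add"
  assumes res: "resolution p" and e: "e > 0"
  obtains K d where "compact K" "d > 0"
    "\<And>\<phi>. normalized_pd \<phi> \<Longrightarrow> (\<And>g. g \<in> K \<Longrightarrow> cmod (\<phi> g - 1) < d) \<Longrightarrow>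
       \<exists>\<psi>. normalized_pd \<psi> \<and> (\<forall>h. cmod (\<phi> h - \<psi> (p h)) < e)"
proof -
  define P where "P = {\<phi> :: 'h \<Rightarrow> complex. normalized_pd \<phi>}"
  interpret G: pre_hilbert_action pscale "kip (family_kernel P)" "shift :: 'h \<Rightarrow> _"
    by (rule gns_action) (simp add: P_def)
  interpret unitary_representation fscale G.compl G.cip G.rep
    by (rule unitary_representationI[OF G.unitary_rep_compl])
  note hom = resolution_hom[OF res]
  define W where "W = {v \<in> G.compl. continuous_along p G.cip G.rep v}"
  note W = continuous_along_subspace[OF hom, folded W_def]
  note O = orth_closed[OF W(1)]
  have repO: "unitary_rep fscale (orth W) G.cip G.rep"
    by (rule unitary_subrep[OF O orth_invariant[OF W(1,4)]])
  have "\<not> almost_invariant_vectors (orth W) G.cip G.rep"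
  proof
    assume "almost_invariant_vectors (orth W) G.cip G.rep"
    from resolution_continuous_vector[OF res repO this]
    obtain v where v: "v \<in> orth W" "v \<noteq> 0" "continuous_along p G.cip G.rep v" .
    then have "v \<in> W" using O(1) by (auto simp: W_def)
    then have "G.cip v v = 0" using v(1) by (simp add: orth_def)
    then show False using hnorm_eq_0[of v] v O(1) by (auto simp: hnorm_def)
  qed
  then obtain K d0 where K: "compact K" "d0 > 0"
    and gap: "\<And>\<xi>. \<xi> \<in> orth W \<Longrightarrow> \<xi> \<noteq> 0 \<Longrightarrow> \<exists>g\<in>K. d0 * hnorm G.cip \<xi> < hnorm G.cip (G.rep g \<xi> - \<xi>)"
    unfolding almost_invariant_vectors_def by (meson not_le)
  \<comment> \<open>With this \<open>d\<close> the orthogonal part has squared norm at most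
    \<open>min e 1 / 4\<close>: the projection stays nonzero, and the errors from dropping that part
    and from rescaling together stay below \<open>e\<close>.\<close>
  define d where "d = min e 1 * d0\<^sup>2 / 8"
  have d: "d > 0" using e K(2) by (simp add: d_def)
  have "\<exists>\<psi>. normalized_pd \<psi> \<and> (\<forall>h. cmod (\<phi> h - \<psi> (p h)) < e)"
    if \<phi>: "normalized_pd \<phi>" and close: "\<And>g. g \<in> K \<Longrightarrow> cmod (\<phi> g - 1) < d" for \<phi>
  proof -
    define v where "v = G.inc (Poly_Mapping.single (\<phi>, 0) 1)"
    have v: "v \<in> G.compl" by (simp add: v_def G.inc_compl)
    have coeff: "G.cip (G.rep h v) v = \<phi> h" for h
    proof -
      have "G.cip (G.rep h v) v =
          kip (family_kernel P) (shift h (Poly_Mapping.single (\<phi>, 0) 1)) (Poly_Mapping.single (\<phi>, 0) 1)"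
        by (simp only: v_def G.rep_inc G.inc_ip)
      also have "\<dots> = \<phi> h" using \<phi> by (simp add: kip_shift family_kernel_def P_def)
      finally show ?thesis .
    qed
    have vnorm: "(hnorm G.cip v)\<^sup>2 = 1"
      using coeff[of 0] \<phi> act_group(1)[OF v] G.C.ip_self[OF v] by (simp add: normalized_pd_def complex_eq_iff)
    obtain w where w: "w \<in> W" "\<And>x. x \<in> W \<Longrightarrow> G.cip (v - w) x = 0"
      using orthogonal_projection[OF W(1-3) v] by blast
    have wV: "w \<in> G.compl" using w(1) W(1) by blast
    define u where "u = v - w"
    have u: "u \<in> orth W" using w(2) G.C.mem(4)[OF v wV] by (simp add: u_def orth_def)
    have uV: "u \<in> G.compl" using u O(1) by blast
    have vwu: "v = w + u" by (simp add: u_def)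
    have perp: "G.cip x y = 0" "G.cip y x = 0" if "x \<in> W" "y \<in> orth W" for x y
      using that W(1) G.C.ip_cnj[of y x] by (auto simp: orth_def)
    define \<eta> where "\<eta> = (hnorm G.cip u)\<^sup>2"
    have wnorm: "(hnorm G.cip w)\<^sup>2 = 1 - \<eta>"
      using vnorm G.C.hnorm_add_sq[OF wV uV] perp(1)[OF w(1) u] by (simp add: vwu \<eta>_def)
    have \<eta>: "\<eta> \<ge> 0" "\<eta> \<le> min e 1 / 4"
    proof -
      show "\<eta> \<ge> 0" by (simp add: \<eta>_def)
      show "\<eta> \<le> min e 1 / 4"
      proof (cases "u = 0")
        case True
        then show ?thesis using e by (simp add: \<eta>_def G.C.hnorm_zero)
      next
        case False
        then obtain g where g: "g \<in> K" "d0 * hnorm G.cip u < hnorm G.cip (G.rep g u - u)"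
          using gap[OF u] by blast
        \<comment> \<open>The displacement of \<open>v\<close> splits orthogonally, so that of
          \<open>u\<close> is no larger; \<open>gap\<close> bounds the latter from below.\<close>
        have "G.rep g w - w \<in> W" "G.rep g u - u \<in> orth W"
          using W(2,4) O(2) w(1) u orth_invariant[OF W(1,4) u] by (auto intro: G.C.subspace_diff)
        moreover have "G.rep g v - v = (G.rep g w - w) + (G.rep g u - u)"
          using wV uV by (simp add: vwu act_add)
        ultimately have "(hnorm G.cip (G.rep g u - u))\<^sup>2 \<le> (hnorm G.cip (G.rep g v - v))\<^sup>2"
          using G.C.hnorm_add_sq[of "G.rep g w - w" "G.rep g u - u"] perp W(1) O(1) by (simp add: subset_iff)
        also have "\<dots> = 2 - 2 * Re (\<phi> g)"
          using G.C.hnorm_diff_sq[OF act_mem[OF v] v, of g] by (simp add: act_norm[OF v] vnorm coeff)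
        also have "\<dots> \<le> 2 * d"
          using close[OF g(1)] abs_Re_le_cmod[of "\<phi> g - 1"] by simp
        finally have "(hnorm G.cip (G.rep g u - u))\<^sup>2 \<le> 2 * d" .
        moreover have "(d0 * hnorm G.cip u)\<^sup>2 \<le> (hnorm G.cip (G.rep g u - u))\<^sup>2"
          using g(2) K(2) G.C.hnorm_nonneg[OF uV] by (intro power_mono) auto
        ultimately have "d0\<^sup>2 * \<eta> \<le> d0\<^sup>2 * (min e 1 / 4)"
          by (simp add: \<eta>_def d_def power_mult_distrib mult.commute)
        then show ?thesis using K(2) by simp
      qed
    qed
    \<comment> \<open>\<open>r\<close> is the squared norm of \<open>w\<close>, that is, the value
      of the coefficient at the identity; division by it normalizes.\<close>
    define r where "r = 1 - \<eta>"
    have r: "r > 0" "r \<le> 1" using \<eta> by (auto simp: r_def)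
    define \<theta> where "\<theta> h = G.cip (G.rep h w) w" for h
    have \<theta>_le: "cmod (\<theta> h) \<le> r" for h
      using G.C.cauchy_schwarz[OF act_mem[OF wV] wV, of h] wnorm
      by (simp add: \<theta>_def r_def act_norm[OF wV] flip: power2_eq_square)
    have \<theta>_close: "cmod (\<phi> h - \<theta> h) \<le> \<eta>" for h
    proof -
      have "\<phi> h = \<theta> h + G.cip (G.rep h u) u"
        using perp[OF W(4)[OF w(1)] u] perp[OF w(1) orth_invariant[OF W(1,4) u]] wV uV act_mem
        by (simp add: coeff[symmetric] \<theta>_def vwu act_add G.C.ip_add G.C.ip_right G.C.mem)
      then show ?thesis
        using G.C.cauchy_schwarz[OF act_mem[OF uV] uV, of h]
        by (simp add: \<eta>_def act_norm[OF uV] flip: power2_eq_square)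
    qed
    have uc: "\<exists>U. open U \<and> 0 \<in> U \<and> (\<forall>h k. - p k + p h \<in> U \<longrightarrow> cmod (\<theta> h - \<theta> k) < a)" if a: "a > 0" for a
    proof -
      obtain U where U: "open U" "0 \<in> U" "\<And>h. p h \<in> U \<Longrightarrow> hnorm G.cip (G.rep h w - w) < a"
        using w(1) a unfolding W_def continuous_along_def by blast
      have "cmod (\<theta> h - \<theta> k) < a" if "- p k + p h \<in> U" for h k
      proof -
        have "p (- k + h) \<in> U" using that by (simp add: hom additive_zero_minus[of p, OF hom])
        then have "hnorm G.cip (G.rep h w - G.rep k w) < a"
          using U(3) act_norm_diff[OF wV] by simp
        moreover have "hnorm G.cip w \<le> 1"
          by (rule power2_le_imp_le) (use wnorm \<eta>(1) in auto)
        moreover have "cmod (\<theta> h - \<theta> k) \<le> hnorm G.cip (G.rep h w - G.rep k w) * hnorm G.cip w"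
          using G.C.cauchy_schwarz[of "G.rep h w - G.rep k w" w] wV act_mem G.C.mem(4) by (simp add: \<theta>_def G.C.ip_diff)
        ultimately show ?thesis
          using mult_left_mono[of "hnorm G.cip w" 1 "hnorm G.cip (G.rep h w - G.rep k w)"]
            G.C.hnorm_nonneg[OF G.C.mem(4)[OF act_mem[OF wV] act_mem[OF wV]], of h k] by simp
      qed
      then show ?thesis using U by blast
    qed
    obtain \<tau> where \<tau>: "continuous_on UNIV \<tau>" "\<And>h. \<tau> (p h) = \<theta> h"
      using extend_from_dense[OF resolution_dense[OF res] uc] by blast
    have "positive_definite \<tau>"
      using coefficient_pd[OF wV] by (intro positive_definite_dense[OF resolution_dense[OF res] hom \<tau>(1)])
        (simp add: \<tau>(2) \<theta>_def)
    then have pd: "positive_definite (\<lambda>q. of_real (1 / r) * \<tau> q)"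
      using r by (intro positive_definite_scale) auto
    have "\<tau> 0 = of_real r"
      using \<tau>(2)[of 0] additive_zero_minus(1)[of p, OF hom] act_group(1)[OF wV] G.C.ip_self[OF wV] wnorm
      by (simp add: \<theta>_def r_def)
    then have "normalized_pd (\<lambda>q. of_real (1 / r) * \<tau> q)"
      using pd \<tau>(1) r by (auto simp: normalized_pd_def intro!: continuous_intros)
    moreover have "cmod (\<phi> h - of_real (1 / r) * \<tau> (p h)) < e" for h
    proof -
      have "\<theta> h - of_real (1 / r) * \<theta> h = of_real (- (\<eta> / r)) * \<theta> h"
        using r by (simp add: r_def field_simps)
      then have "cmod (\<theta> h - of_real (1 / r) * \<theta> h) = \<eta> / r * cmod (\<theta> h)"
        using r \<eta>(1) by (simp add: norm_mult norm_divide)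
      also have "\<dots> \<le> \<eta> / r * r" using \<theta>_le[of h] r \<eta>(1) by (intro mult_left_mono) auto
      finally have "cmod (\<theta> h - of_real (1 / r) * \<theta> h) \<le> \<eta>" using r by simp
      then have "cmod (\<phi> h - of_real (1 / r) * \<theta> h) \<le> \<eta> + \<eta>"
        using norm_triangle_ineq[of "\<phi> h - \<theta> h" "\<theta> h - of_real (1 / r) * \<theta> h"] \<theta>_close[of h] by simp
      then show ?thesis using \<eta> e by (simp add: \<tau>(2))
    qed
    ultimately show ?thesis by blast
  qed
  then show ?thesis using that K(1) d by blast
qed

section \<open>Convergence on compact subsets of the target\<close>

text \<open>A vector continuous along \<open>p\<close> is close to a finite combination
  \<open>a\<close> of translated cyclic vectors, and the coefficient of \<open>a\<close> stays away
  from \<open>0\<close> on the preimage of \<open>U\<close>. This coefficient is a finite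
  combination of translates of members of \<open>P\<close>, so at each such point one of finitely
  many translates is bounded below.\<close>

theorem resolution_coefficients:
  fixes p :: "'h::topological_group_add \<Rightarrow> 'q::topological_group_add"
  assumes res: "resolution p" and P: "\<And>\<phi>. \<phi> \<in> P \<Longrightarrow> normalized_pd \<phi>"
    and approx: "\<And>K d. compact K \<Longrightarrow> d > 0 \<Longrightarrow> \<exists>\<phi>\<in>P. \<forall>h\<in>K. cmod (\<phi> h - 1) < d"
  obtains U r F where "open U" "0 \<in> U" "r > 0" "finite F" "F \<subseteq> P \<times> UNIV"
    "\<And>h. p h \<in> U \<Longrightarrow> \<exists>(\<phi>, g, k)\<in>F. r \<le> cmod (\<phi> (g + h + k))"
proof -
  interpret G: pre_hilbert_action pscale "kip (family_kernel P)" "shift :: 'h \<Rightarrow> _"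
    by (rule gns_action) (rule P)
  interpret unitary_representation fscale G.compl G.cip G.rep
    by (rule unitary_representationI[OF G.unitary_rep_compl])
  have shift_norm: "G.N (shift h a) = G.N a" for h a
    by (simp add: hnorm_def G.act_ip)
  have "almost_invariant_vectors G.compl G.cip G.rep"
    unfolding almost_invariant_vectors_def
  proof (intro allI impI)
    fix K :: "'h set" and e :: real assume "compact K" "e > 0"
    then obtain \<phi> where \<phi>: "\<phi> \<in> P" "\<And>h. h \<in> K \<Longrightarrow> cmod (\<phi> h - 1) < e\<^sup>2 / 2"
      \<comment> \<open>The cyclic vector of \<open>\<phi>\<close> has norm one and squared
        displacement \<open>2 - 2 * Re (\<phi> h)\<close>, whence this constant.\<close>
      using approx[of K "e\<^sup>2 / 2"] by auto
    define v where "v = Poly_Mapping.single (\<phi>, 0 :: 'h) (1 :: complex)"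
    have coeff: "kip (family_kernel P) (shift h v) v = \<phi> h" for h
      using \<phi>(1) by (simp add: v_def kip_shift family_kernel_def)
    have n1: "(G.N v)\<^sup>2 = 1"
      using coeff[of 0] P[OF \<phi>(1)] G.ip_self[of v] by (simp add: G.act_0 normalized_pd_def complex_eq_iff)
    then have n: "G.N v = 1" using G.hnorm_nonneg[of v] by (simp add: power2_eq_1_iff)
    have "hnorm G.cip (G.rep h (G.inc v) - G.inc v) \<le> e * hnorm G.cip (G.inc v)" if "h \<in> K" for h
    proof -
      have "(G.N (shift h v - v))\<^sup>2 = 2 - 2 * Re (\<phi> h)"
        using G.hnorm_diff_sq[of "shift h v" v] by (simp add: shift_norm coeff n)
      also have "\<dots> \<le> e\<^sup>2" using \<phi>(2)[OF that] abs_Re_le_cmod[of "\<phi> h - 1"] by simp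
      finally have "G.N (shift h v - v) \<le> e" by (rule power2_le_imp_le) (use \<open>e > 0\<close> in simp)
      then show ?thesis by (simp add: G.rep_inc G.inc_norm n flip: G.inc_diff)
    qed
    moreover have "G.inc v \<noteq> 0"
      using n G.C.hnorm_zero G.inc_norm[of v] by auto
    ultimately show "\<exists>\<xi>\<in>G.compl. \<xi> \<noteq> 0 \<and> (\<forall>h\<in>K. hnorm G.cip (G.rep h \<xi> - \<xi>) \<le> e * hnorm G.cip \<xi>)"
      using G.inc_compl by blast
  qed
  from resolution_continuous_vector[OF res rep this]
  obtain \<xi> where \<xi>: "\<xi> \<in> G.compl" "\<xi> \<noteq> 0" "continuous_along p G.cip G.rep \<xi>" .
  define m where "m = hnorm G.cip \<xi>"
  have m: "m > 0" using \<xi> hnorm_eq_0 G.C.hnorm_nonneg[OF \<xi>(1)] by (force simp: m_def)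
  \<comment> \<open>With errors \<open>m / 8\<close> here and \<open>m / 4\<close> below,
    \<open>a\<close> has norm at least \<open>7 / 8 * m\<close> and is displaced by at most
    \<open>m / 2\<close>, so the real part of its coefficient is at least \<open>41 / 64\<close> of
    the square of \<open>m\<close>.\<close>
  obtain a where a: "hnorm G.cip (\<xi> - G.inc a) < m / 8"
    using G.inc_dense[OF \<xi>(1), of "m / 8"] m by auto
  obtain U where U: "open U" "0 \<in> U" "\<And>h. p h \<in> U \<Longrightarrow> hnorm G.cip (G.rep h \<xi> - \<xi>) < m / 4"
    using \<xi>(3) m unfolding continuous_along_def by (metis divide_pos_pos zero_less_numeral)
  have big: "m\<^sup>2 / 2 < cmod (kip (family_kernel P) (shift h a) a)" if h: "p h \<in> U" for h
  proof -
    have "G.N a \<ge> 7 / 8 * m"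
      using G.C.hnorm_diff_le[OF \<xi>(1) G.inc_compl[of a]] a by (simp add: m_def G.inc_norm)
    then have "(7 / 8 * m)\<^sup>2 \<le> (G.N a)\<^sup>2" using m by (intro power_mono) auto
    moreover have "G.N (shift h a - a) \<le> 1 / 2 * m"
      using act_norm_le[OF G.inc_compl[of a] \<xi>(1), of h] U(3)[OF h] a
        G.C.hnorm_minus_commute[OF \<xi>(1) G.inc_compl[of a]]
      by (simp add: G.rep_inc G.inc_norm flip: G.inc_diff)
    then have "(G.N (shift h a - a))\<^sup>2 \<le> (1 / 2 * m)\<^sup>2"
      by (intro power_mono) (simp_all add: G.hnorm_nonneg)
    moreover have "(G.N (shift h a - a))\<^sup>2 = 2 * (G.N a)\<^sup>2 - 2 * Re (kip (family_kernel P) (shift h a) a)"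
      using G.hnorm_diff_sq[of "shift h a" a] by (simp add: shift_norm)
    ultimately have "Re (kip (family_kernel P) (shift h a) a) \<ge> 41 / 64 * m\<^sup>2"
      by (simp add: power_mult_distrib power_divide)
    moreover have "41 / 64 * m\<^sup>2 > m\<^sup>2 / 2" using m by simp
    ultimately show ?thesis using complex_Re_le_cmod order_trans by (meson less_le_trans)
  qed
  define M where "M = (\<Sum>s\<in>keys a. \<Sum>t\<in>keys a. cmod (lookup a s) * cmod (lookup a t))"
  define r where "r = m\<^sup>2 / 2 / (M + 1)"
  have M: "M \<ge> 0" unfolding M_def by (intro sum_nonneg mult_nonneg_nonneg norm_ge_zero)
  have r: "r > 0" "M * r \<le> m\<^sup>2 / 2"
    using M m by (auto simp: r_def divide_simps zero_less_mult_iff algebra_simps)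
  \<comment> \<open>For equal index functions the entry for \<open>s\<close> and \<open>t\<close> at
    \<open>h\<close> is \<open>\<phi> (- snd t + h + snd s)\<close>; index functions outside
    \<open>P\<close> contribute nothing.\<close>
  define F where "F = (\<lambda>(s, t). (fst s, - snd t, snd s)) ` (keys a \<times> keys a) \<inter> P \<times> UNIV"
  have "\<exists>(\<phi>, g, k)\<in>F. r \<le> cmod (\<phi> (g + h + k))" if h: "p h \<in> U" for h
  proof (rule ccontr)
    assume neg: "\<not> (\<exists>(\<phi>, g, k)\<in>F. r \<le> cmod (\<phi> (g + h + k)))"
    have small: "cmod (family_kernel P (fst s, h + snd s) t) \<le> r" if st: "s \<in> keys a" "t \<in> keys a" for s t
    proof (cases "fst s = fst t \<and> fst s \<in> P")
      case True
      then have "(fst s, - snd t, snd s) \<in> F" using st by (auto simp: F_def intro!: image_eqI[of _ _ "(s, t)"])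
      then have "cmod (fst s (- snd t + h + snd s)) < r" using neg by fastforce
      then show ?thesis using True by (auto simp: family_kernel_def add.assoc)
    next
      case False
      then have "family_kernel P (fst s, h + snd s) t = 0" by (simp only: family_kernel_def fst_conv if_False)
      then show ?thesis using r by simp
    qed
    have "cmod (kip (family_kernel P) (shift h a) a) \<le>
        (\<Sum>s\<in>keys a. \<Sum>t\<in>keys a. cmod (lookup a s) * cmod (lookup a t) * r)"
      unfolding kip_shift
      by (intro sum_norm_le order_trans[OF norm_sum] sum_mono)
        (auto simp: norm_mult intro!: mult_left_mono small)
    also have "\<dots> = M * r" by (simp add: M_def sum_distrib_right)
    finally show False using big[OF h] r by simp
  qed
  moreover have "finite F" "F \<subseteq> P \<times> UNIV" by (auto simp: F_def)
  ultimately show ?thesis using that[OF U(1,2) r(1)] by blast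
qed

text \<open>A finite Baire argument: either \<open>U\<close> lies in the first set, or removing that
  closed set leaves a nonempty open set covered by the others.\<close>

lemma finite_closed_cover_interior:
  assumes "finite F" "\<And>x. x \<in> F \<Longrightarrow> closed (T x)" "open U" "U \<noteq> {}" "U \<subseteq> (\<Union>x\<in>F. T x)"
  shows "\<exists>x\<in>F. interior (T x) \<noteq> {}"
  using assms
proof (induction F arbitrary: U rule: finite_induct)
  case (insert a F)
  show ?case
  proof (cases "U \<subseteq> T a")
    case True
    then show ?thesis using insert.prems interior_maximal[of U "T a"] by blast
  next
    case False
    have "\<exists>x\<in>F. interior (T x) \<noteq> {}"
    proof (rule insert.IH)
      show "open (U - T a)" using insert.prems by (intro open_Diff) auto
    qed (use insert.prems False in auto)
    then show ?thesis by blast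
  qed
qed simp

text \<open>
  The limit need not be continuous on \<open>Q\<close>; continuity returns only after pulling back along \<open>p\<close>.
\<close>

definition dyadic_product :: "(nat \<Rightarrow> 'q \<Rightarrow> complex) \<Rightarrow> 'q \<Rightarrow> real" where
  "dyadic_product \<phi> q = lim (\<lambda>N. \<Prod>n<N. ((1 + Re (\<phi> n q)) / 2) ^ (2 ^ n))"

section \<open>Infinite products with dyadic exponents\<close>

context
  fixes \<phi> :: "nat \<Rightarrow> 'q::topological_group_add \<Rightarrow> complex"
  assumes npd: "\<And>n. normalized_pd (\<phi> n)"
begin

private abbreviation "u n q \<equiv> (1 + Re (\<phi> n q)) / 2"
private abbreviation "prd N q \<equiv> (\<Prod>n<N. u n q ^ (2 ^ n))"

private lemma pd: "positive_definite (\<phi> n)" and one: "\<phi> n 0 = 1"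
  using npd[of n] by (auto simp: normalized_pd_def)

private lemma u: "0 \<le> u n q" "u n q \<le> 1"
  using pd_norm_le[OF pd one, of n q] abs_Re_le_cmod[of "\<phi> n q"] by auto

private lemma prd_bounds: "0 \<le> prd N q" "prd N q \<le> 1"
  using u by (auto intro!: prod_nonneg prod_le_1 power_le_one)

private lemma prd_decseq: "decseq (\<lambda>N. prd N q)"
  unfolding decseq_Suc_iff using u prd_bounds by (auto intro!: mult_right_le_one_le power_le_one)

lemma dyadic_product_tendsto: "(\<lambda>N. prd N q) \<longlonglongrightarrow> dyadic_product \<phi> q"
proof -
  have "convergent (\<lambda>N. prd N q)"
    using decseq_convergent[OF prd_decseq, of 0 q] prd_bounds unfolding convergent_def by metis
  then show ?thesis by (simp add: dyadic_product_def convergent_LIMSEQ_iff)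
qed

lemma dyadic_product_le: "dyadic_product \<phi> q \<le> prd N q"
  using decseq_ge[OF prd_decseq dyadic_product_tendsto] .

lemma dyadic_product_zero: "dyadic_product \<phi> 0 = 1"
  using LIMSEQ_unique[OF dyadic_product_tendsto[of 0], of 1] by (simp add: one)

lemma dyadic_product_bounds: "0 \<le> dyadic_product \<phi> q" "dyadic_product \<phi> q \<le> 1"
  using LIMSEQ_le_const[OF dyadic_product_tendsto, of 0] prd_bounds dyadic_product_le[of q 0] by auto

lemma dyadic_product_pd: "positive_definite (\<lambda>q. complex_of_real (dyadic_product \<phi> q))"
proof (rule positive_definite_limit)
  show "positive_definite (\<lambda>q. \<Prod>n<N. (of_real (1 / 2) * (1 + complex_of_real (Re (\<phi> n q)))) ^ (2 ^ n))" for N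
    by (intro positive_definite_prod positive_definite_power positive_definite_scale
        positive_definite_add positive_definite_one positive_definite_Re pd) simp
  have "(\<Prod>n<N. (of_real (1 / 2) * (1 + complex_of_real (Re (\<phi> n q)))) ^ (2 ^ n)) = of_real (prd N q)" for N q
    by (simp add: power_divide)
  then show "(\<lambda>N. \<Prod>n<N. (of_real (1 / 2) * (1 + complex_of_real (Re (\<phi> n q)))) ^ (2 ^ n))
      \<longlonglongrightarrow> complex_of_real (dyadic_product \<phi> q)" for q
    by (simp only: tendsto_of_real dyadic_product_tendsto)
qed

text \<open>Since all factors lie between 0 and 1, a lower bound for the product bounds each factor
  from below; \<open>u n q \<le> exp (u n q - 1)\<close> turns the exponent \<open>2 ^ n\<close>
  into a linear weight on the deficit.\<close>

lemma dyadic_product_decay: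
  assumes "r > 0" "r \<le> dyadic_product \<phi> q"
  shows "2 ^ n * (1 - Re (\<phi> n q)) \<le> - 2 * ln r"
proof -
  have "r \<le> prd (Suc n) q" using assms dyadic_product_le[of q "Suc n"] by simp
  also have "\<dots> \<le> u n q ^ (2 ^ n)"
    using prd_bounds[of q n] u[of n q] by (auto intro!: mult_left_le_one_le)
  also have "\<dots> \<le> exp (u n q - 1) ^ (2 ^ n)"
  proof (rule power_mono)
    show "u n q \<le> exp (u n q - 1)" using exp_ge_add_one_self[of "u n q - 1"] by linarith
  qed (rule u)
  also have "\<dots> = exp (2 ^ n * (u n q - 1))" by (simp flip: exp_of_nat_mult)
  finally have "ln r \<le> 2 ^ n * (u n q - 1)" using assms(1) by (simp add: ln_le_cancel_iff[symmetric] del: ln_le_cancel_iff)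
  also have "\<dots> = - (2 ^ n * (1 - Re (\<phi> n q))) / 2" by (simp add: field_simps)
  finally show ?thesis by simp
qed

text \<open>Bernoulli's inequality bounds the loss \<open>1 - u M q ^ (2 ^ M)\<close> by
  \<open>d * (1 / 2) ^ Suc M\<close>, so the corrected partial products \<open>f\<close> increase.
  The rate \<open>(1 / 4) ^ n\<close> is what beats the exponents \<open>2 ^ n\<close>.\<close>

lemma dyadic_product_ge:
  assumes d: "\<And>n. 1 - Re (\<phi> n q) \<le> d * (1 / 4) ^ n"
  shows "prd N q - d * (1 / 2) ^ N \<le> dyadic_product \<phi> q"
proof -
  define f where "f M = prd M q - d * (1 / 2) ^ M" for M
  have "f M \<le> f (Suc M)" for M
  proof -
    have "1 - u M q = (1 - Re (\<phi> M q)) / 2" by (simp add: field_simps)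
    then have "1 - u M q \<le> d * (1 / 4) ^ M / 2" using d[of M] by simp
    then have "2 ^ M * (1 - u M q) \<le> 2 ^ M * (d * (1 / 4) ^ M / 2)" by (intro mult_left_mono) auto
    also have "\<dots> = d * (1 / 2) ^ Suc M"
      by (simp add: power_divide field_simps flip: power_mult_distrib)
    also have "2 ^ M * (1 - u M q) = - (2 ^ M * (u M q - 1))"
      by (simp only: minus_diff_eq mult_minus_right[symmetric])
    finally have "1 + 2 ^ M * (u M q - 1) \<ge> 1 - d * (1 / 2) ^ Suc M" by linarith
    moreover have "1 + real (2 ^ M) * (u M q - 1) \<le> (1 + (u M q - 1)) ^ (2 ^ M)"
      by (rule Bernoulli_inequality) (use u[of M q] in simp)
    then have "1 + 2 ^ M * (u M q - 1) \<le> u M q ^ (2 ^ M)"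
      by (simp only: of_nat_power of_nat_numeral add_diff_cancel_left' diff_add_cancel add.commute[of 1])
    ultimately have "1 - u M q ^ (2 ^ M) \<le> d * (1 / 2) ^ Suc M" by simp
    moreover have "prd M q * (1 - u M q ^ (2 ^ M)) \<le> 1 * (1 - u M q ^ (2 ^ M))"
      using prd_bounds[of q M] u[of M q] by (intro mult_right_mono) (auto intro: power_le_one)
    ultimately show ?thesis by (simp add: f_def algebra_simps)
  qed
  then have "incseq f" by (rule incseq_SucI)
  moreover have "f \<longlonglongrightarrow> dyadic_product \<phi> q - d * 0"
    unfolding f_def by (intro tendsto_intros dyadic_product_tendsto LIMSEQ_power_zero) simp
  ultimately have "f N \<le> dyadic_product \<phi> q" using incseq_le by fastforce
  then show ?thesis by (simp add: f_def)
qed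

text \<open>The tail bound of \<open>dyadic_product_ge\<close> is uniform on \<open>A\<close>, so
  continuity of the partial products gives continuity at the identity, which
  \<open>normalized_pdI\<close> spreads.\<close>

lemma dyadic_product_normalized:
  fixes p :: "'h::topological_group_add \<Rightarrow> 'q"
  assumes hom: "\<And>x y. p (x + y) = p x + p y" and cont: "continuous_on UNIV p"
    and N: "open A" "0 \<in> A" and d: "\<And>n h. h \<in> A \<Longrightarrow> 1 - Re (\<phi> n (p h)) \<le> d * (1 / 4) ^ n"
  shows "normalized_pd (\<lambda>h. complex_of_real (dyadic_product \<phi> (p h)))"
proof (rule normalized_pdI)
  show "positive_definite (\<lambda>h. complex_of_real (dyadic_product \<phi> (p h)))"
    by (rule positive_definite_compose[OF dyadic_product_pd hom])
  have p0: "p 0 = 0" by (rule additive_zero_minus(1)[of p, OF hom])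
  then show "complex_of_real (dyadic_product \<phi> (p 0)) = 1" by (simp add: dyadic_product_zero)
  have "((\<lambda>h. dyadic_product \<phi> (p h)) \<longlongrightarrow> 1) (nhds 0)"
  proof (rule order_tendstoI)
    fix a :: real assume "a < 1"
    have "(\<lambda>M. d * (1 / 2) ^ M) \<longlonglongrightarrow> d * 0"
      by (intro tendsto_intros LIMSEQ_power_zero) simp
    then have "\<forall>\<^sub>F M in sequentially. d * (1 / 2) ^ M < (1 - a) / 2"
      using \<open>a < 1\<close> by (intro order_tendstoD(2)) auto
    \<comment> \<open>Half of \<open>1 - a\<close> is spent on the tail, the other half on the
      partial product.\<close>
    then obtain M where M: "d * (1 / 2) ^ M < (1 - a) / 2" by (auto simp: eventually_sequentially)
    have "continuous_on UNIV (\<lambda>h. prd M (p h))"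
      using npd by (intro continuous_intros continuous_on_compose2[OF _ cont]) (auto simp: normalized_pd_def)
    then have "open ((\<lambda>h. prd M (p h)) -` {(1 + a) / 2<..})" by (intro open_vimage) auto
    moreover have "0 \<in> (\<lambda>h. prd M (p h)) -` {(1 + a) / 2<..}" using \<open>a < 1\<close> by (simp add: p0 one)
    ultimately have "\<forall>\<^sub>F h in nhds 0. h \<in> (\<lambda>h. prd M (p h)) -` {(1 + a) / 2<..} \<inter> A"
      using N by (intro eventually_nhds_in_open open_Int) auto
    then show "\<forall>\<^sub>F h in nhds 0. a < dyadic_product \<phi> (p h)"
    proof eventually_elim
      case (elim h)
      then have "(1 + a) / 2 < prd M (p h)" "h \<in> A"
        by (simp_all only: Int_iff vimage_eq greaterThan_iff)
      moreover from d[OF this(2)] have "prd M (p h) - d * (1 / 2) ^ M \<le> dyadic_product \<phi> (p h)"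
        by (rule dyadic_product_ge)
      ultimately show ?case using M by argo
    qed
  next
    fix a :: real assume "1 < a"
    then show "\<forall>\<^sub>F h in nhds 0. dyadic_product \<phi> (p h) < a"
      using dyadic_product_bounds(2) by (intro always_eventually allI) (meson le_less_trans)
  qed
  then show "((\<lambda>h. complex_of_real (dyadic_product \<phi> (p h))) \<longlongrightarrow> 1) (nhds 0)"
    using tendsto_of_real by fastforce
qed

end

lemma locally_compact_neighbourhood:
  assumes "locally_compact_space (euclidean :: 'a::{zero,topological_space} topology)"
  obtains A K :: "'a::{zero,topological_space} set" where "open A" "0 \<in> A" "A \<subseteq> K" "compact K"
proof -
  have "\<exists>A K. open A \<and> compact K \<and> 0 \<in> A \<and> A \<subseteq> (K :: 'a set)"
    using assms unfolding locally_compact_space_def by auto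
  then show ?thesis using that by blast
qed

text \<open>Without first countability a compact set need not provide convergent subsequences; the
  filter characterization of compactness still yields a cluster point.\<close>

lemma compact_sequence_cluster:
  assumes "compact L" "\<And>n :: nat. v n \<in> L"
  obtains x where "x \<in> L" "\<And>A m. open A \<Longrightarrow> x \<in> A \<Longrightarrow> \<exists>n\<ge>m. v n \<in> A"
proof -
  obtain x where x: "x \<in> L" "inf (nhds x) (filtermap v sequentially) \<noteq> bot"
    using assms(1)[unfolded compact_filter, rule_format, of "filtermap v sequentially"] assms(2)
    by (auto simp: eventually_filtermap filtermap_bot_iff)
  have "\<exists>n\<ge>m. v n \<in> A" if A: "open A" "x \<in> A" for A m
  proof (rule ccontr)
    assume "\<not> (\<exists>n\<ge>m. v n \<in> A)"
    then have "eventually (\<lambda>y. y \<notin> A) (filtermap v sequentially)"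
      by (auto simp: eventually_filtermap eventually_sequentially)
    then have "eventually (\<lambda>_. False) (inf (nhds x) (filtermap v sequentially))"
      using eventually_nhds_in_open[OF A] unfolding eventually_inf by blast
    then show False using x(2) by (simp add: trivial_limit_def)
  qed
  then show ?thesis using that x(1) by blast
qed

section \<open>Refuting a failure of convergence on compact subsets\<close>

context
  fixes p :: "'h::topological_group_add \<Rightarrow> 'q::topological_group_add" and L L' A' :: "'q set" and e :: real
  assumes res: "resolution p"
    and L': "open A'" "0 \<in> A'" "A' \<subseteq> L'" "compact L'"
    and L: "compact L" and e: "e > 0"
    and fails: "\<And>K d. compact K \<Longrightarrow> d > 0 \<Longrightarrow> \<exists>\<phi>. normalized_pd \<phi> \<and>
      (\<forall>h\<in>K. cmod (\<phi> (p h) - 1) < d) \<and> (\<exists>l\<in>L. cmod (\<phi> l - 1) \<ge> e)"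
begin

text \<open>Finitely many translates by points of the dense image cover \<open>L\<close>. Including
  those points in the compact set makes \<open>\<phi>\<close> close to \<open>1\<close> there, so by
  \<open>pd_sqrt_subadditive\<close> a failure at \<open>l = p f + v\<close> is passed on to the
  small element \<open>v\<close>.\<close>

private lemma fails_near_zero:
  assumes K: "compact K" and d: "d > 0" and U: "open U" "0 \<in> U"
  shows "\<exists>\<phi> v. normalized_pd \<phi> \<and> (\<forall>h\<in>K. cmod (\<phi> (p h) - 1) < d) \<and> v \<in> U \<and> v \<in> L' \<and>
    e\<^sup>2 / 8 \<le> 1 - Re (\<phi> v)"
proof -
  define N where "N h = (\<lambda>q. - p h + q) -` (U \<inter> A')" for h
  have "open (N h)" for h
    unfolding N_def using U L' by (intro open_vimage continuous_intros) auto
  moreover have "L \<subseteq> (\<Union>h\<in>UNIV. N h)"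
  proof
    fix l
    have "open ((\<lambda>q. - q + l) -` (U \<inter> A'))"
      using U L' by (intro open_vimage continuous_intros) auto
    moreover have "l \<in> (\<lambda>q. - q + l) -` (U \<inter> A')" using U L' by simp
    ultimately obtain h where "p h \<in> (\<lambda>q. - q + l) -` (U \<inter> A')"
      by (rule dense_meets_open[OF resolution_dense[OF res]])
    then show "l \<in> (\<Union>h\<in>UNIV. N h)" by (auto simp: N_def)
  qed
  ultimately obtain F where F: "finite F" "L \<subseteq> (\<Union>h\<in>F. N h)"
    using compactE_image[OF L, of UNIV N] by auto
  \<comment> \<open>Two deficits below \<open>e\<^sup>2 / 8\<close> combine to one below
    \<open>e\<^sup>2 / 2\<close> at \<open>l\<close>, and \<open>pd_one_diff_le\<close> would then
    put \<open>\<phi> l\<close> within \<open>e\<close> of \<open>1\<close>.\<close>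
  have "compact (K \<union> F)" "min d (e\<^sup>2 / 8) > 0" using K d e F(1) by (auto intro: finite_imp_compact)
  from fails[OF this] obtain \<phi> l where \<phi>: "normalized_pd \<phi>"
    "\<And>h. h \<in> K \<union> F \<Longrightarrow> cmod (\<phi> (p h) - 1) < min d (e\<^sup>2 / 8)" and l: "l \<in> L" "cmod (\<phi> l - 1) \<ge> e"
    by blast
  have pd: "positive_definite \<phi>" "\<phi> 0 = 1" using \<phi>(1) by (auto simp: normalized_pd_def)
  obtain f where f: "f \<in> F" "l \<in> N f" using F l by blast
  define v where "v = - p f + l"
  have v: "v \<in> U" "v \<in> L'" "l = p f + v" using f L' by (auto simp: N_def v_def)
  have "e\<^sup>2 / 8 \<le> 1 - Re (\<phi> v)"
  proof (rule ccontr)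
    assume "\<not> e\<^sup>2 / 8 \<le> 1 - Re (\<phi> v)"
    then have "sqrt (1 - Re (\<phi> v)) < sqrt (e\<^sup>2 / 8)" by simp
    moreover have "1 - Re (\<phi> (p f)) < e\<^sup>2 / 8"
      using \<phi>(2)[of f] f(1) complex_Re_le_cmod[of "1 - \<phi> (p f)"] by (simp add: norm_minus_commute)
    then have "sqrt (1 - Re (\<phi> (p f))) < sqrt (e\<^sup>2 / 8)" by simp
    ultimately have "sqrt (1 - Re (\<phi> l)) < 2 * sqrt (e\<^sup>2 / 8)"
      using pd_sqrt_subadditive[OF pd, of "p f" v] unfolding v(3) by linarith
    also have "2 * sqrt (e\<^sup>2 / 8) = sqrt (e\<^sup>2 / 2)"
      using real_sqrt_mult[of 4 "e\<^sup>2 / 8"] by simp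
    finally have "2 * (1 - Re (\<phi> l)) < e\<^sup>2" by simp
    then have "sqrt (2 * (1 - Re (\<phi> l))) < e" using e by (intro real_less_lsqrt) auto
    then show False using l(2) pd_one_diff_le[OF pd, of l] by simp
  qed
  then show ?thesis using \<phi> v by (intro exI[of _ \<phi>] exI[of _ v]) auto
qed

text \<open>Neither the compact set nor the rate of convergence is recorded, so that sequences built
  for different \<open>K\<close> and \<open>d\<close> belong to one family in
  \<open>no_failure\<close>.\<close>

private definition bad_sequence :: "(nat \<Rightarrow> ('q \<Rightarrow> complex) \<times> 'q) \<Rightarrow> bool" where
  "bad_sequence f \<longleftrightarrow> (\<forall>n. normalized_pd (fst (f n)) \<and> snd (f n) \<in> L' \<and>
     (\<forall>k<n. 1 - Re (fst (f k) (snd (f n))) < (1 / 2) ^ n) \<and> e\<^sup>2 / 8 \<le> 1 - Re (fst (f n) (snd (f n))))"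

private lemma bad_sequence_exists:
  assumes K: "compact K" and d: "d > 0"
  obtains f where "bad_sequence f" "\<And>n h. h \<in> K \<Longrightarrow> 1 - Re (fst (f n) (p h)) \<le> d * (1 / 4) ^ n"
proof -
  define Q where "Q f n x \<longleftrightarrow> normalized_pd (fst x) \<and> (\<forall>h\<in>K. cmod (fst x (p h) - 1) < d * (1 / 4) ^ n) \<and>
    snd x \<in> L' \<and> (\<forall>k<n. 1 - Re (fst (f k) (snd x)) < (1 / 2) ^ n) \<and> e\<^sup>2 / 8 \<le> 1 - Re (fst x (snd x))"
    for f :: "nat \<Rightarrow> ('q \<Rightarrow> complex) \<times> 'q" and n x
  have "\<exists>f. \<forall>n. Q f n (f n)"
  proof (rule dependent_wellorder_choice)
    show "Q f n x = Q g n x" if "\<And>k. k < n \<Longrightarrow> f k = g k" for f g n x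
      using that by (simp add: Q_def)
  next
    fix n f assume IH: "\<And>k. k < n \<Longrightarrow> Q f k (f k)"
    define U where "U = (\<Inter>k<n. {q. 1 - Re (fst (f k) q) < (1 / 2) ^ n})"
    have "open {q. 1 - Re (fst (f k) q) < (1 / 2) ^ n}" if "k < n" for k
      using IH[OF that] by (intro open_Collect_less continuous_intros) (auto simp: Q_def normalized_pd_def)
    then have "open U" unfolding U_def by (intro open_INT) auto
    moreover have "0 \<in> U" using IH by (auto simp: U_def Q_def normalized_pd_def)
    ultimately obtain \<phi> v where "normalized_pd \<phi>" "\<forall>h\<in>K. cmod (\<phi> (p h) - 1) < d * (1 / 4) ^ n"
      "v \<in> U" "v \<in> L'" "e\<^sup>2 / 8 \<le> 1 - Re (\<phi> v)"
      using fails_near_zero[OF K, of "d * (1 / 4) ^ n" U] d by auto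
    then have "Q f n (\<phi>, v)" by (auto simp: Q_def U_def)
    then show "\<exists>x. Q f n x" by blast
  qed
  then obtain f where f: "\<And>n. Q f n (f n)" by blast
  have "1 - Re (fst (f n) (p h)) \<le> d * (1 / 4) ^ n" if "h \<in> K" for n h
    using f[of n] that abs_Re_le_cmod[of "fst (f n) (p h) - 1"] by (force simp: Q_def)
  moreover have "bad_sequence f" using f by (simp add: bad_sequence_def Q_def)
  ultimately show ?thesis using that by blast
qed

text \<open>At a cluster point \<open>x\<close> of the points \<open>snd (f n)\<close> every
  function has real part at least \<open>1\<close>, so by subadditivity translating a point by
  \<open>- x\<close> does not lower its deficit. A bound \<open>C\<close> near \<open>0\<close>
  would then force some deficits at points near \<open>x\<close> down to
  \<open>C * (1 / 2) ^ n\<close>, below the fixed \<open>e\<^sup>2 / 8\<close>.\<close>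

lemma bad_sequence_not_small:
  assumes f: "bad_sequence f" and V: "open V" "0 \<in> V"
  shows "\<exists>n. \<exists>q\<in>V. C < 2 ^ n * (1 - Re (fst (f n) q))"
proof (rule ccontr)
  assume "\<not> ?thesis"
  then have small: "2 ^ n * (1 - Re (fst (f n) q)) \<le> C" if "q \<in> V" for n q using that by (meson not_less)
  have f': "normalized_pd (fst (f n))" "snd (f n) \<in> L'" "e\<^sup>2 / 8 \<le> 1 - Re (fst (f n) (snd (f n)))"
    "\<And>k. k < n \<Longrightarrow> 1 - Re (fst (f k) (snd (f n))) < (1 / 2) ^ n" for n
    using f by (auto simp: bad_sequence_def)
  have pd: "positive_definite (fst (f n))" "fst (f n) 0 = 1" and cont: "continuous_on UNIV (fst (f n))" for n
    using f'(1)[of n] by (auto simp: normalized_pd_def)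
  obtain x where x: "x \<in> L'" "\<And>A m. open A \<Longrightarrow> x \<in> A \<Longrightarrow> \<exists>n\<ge>m. snd (f n) \<in> A"
    using compact_sequence_cluster[OF L'(4), of "\<lambda>n. snd (f n)"] f'(2) by blast
  have null: "1 - Re (fst (f k) x) \<le> 0" for k
  proof (rule ccontr)
    assume "\<not> 1 - Re (fst (f k) x) \<le> 0"
    then obtain m where m: "(1 / 2) ^ m < 1 - Re (fst (f k) x)"
      using real_arch_pow_inv[of "1 - Re (fst (f k) x)" "1 / 2"] by auto
    have "open {q. (1 / 2) ^ m < 1 - Re (fst (f k) q)}"
      by (intro open_Collect_less continuous_intros cont)
    \<comment> \<open>The index must exceed \<open>k\<close> for \<open>f k\<close> to be controlled
      at that point, and be at least \<open>m\<close> for the control to be sharp enough.\<close>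
    from x(2)[OF this, of "max (Suc k) m"] m
    obtain n where n: "n > k" "n \<ge> m" "(1 / 2) ^ m < 1 - Re (fst (f k) (snd (f n)))"
      by (auto simp: Suc_le_eq)
    have "(1 / 2 :: real) ^ n \<le> (1 / 2) ^ m" using n(2) by (intro power_decreasing) auto
    then show False using f'(4)[OF n(1)] n(3) by linarith
  qed
  obtain m where m: "C * (1 / 2) ^ m < e\<^sup>2 / 8" "C \<ge> 0"
  proof -
    have "C \<ge> 0" using small[OF V(2), of 0] pd(2) by simp
    moreover have "(\<lambda>m. C * (1 / 2) ^ m) \<longlonglongrightarrow> C * 0"
      by (intro tendsto_intros LIMSEQ_power_zero) simp
    then have "\<forall>\<^sub>F m in sequentially. C * (1 / 2) ^ m < e\<^sup>2 / 8"
      using e by (intro order_tendstoD(2)) auto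
    ultimately show ?thesis using that by (auto simp: eventually_sequentially)
  qed
  have "open ((\<lambda>q. - x + q) -` V)" "x \<in> (\<lambda>q. - x + q) -` V"
    using V by (auto intro!: open_vimage continuous_intros)
  from x(2)[OF this, of m] obtain n where n: "n \<ge> m" "- x + snd (f n) \<in> V" by auto
  have "sqrt (1 - Re (fst (f n) (snd (f n)))) \<le> sqrt (1 - Re (fst (f n) x)) + sqrt (1 - Re (fst (f n) (- x + snd (f n))))"
    using pd_sqrt_subadditive[OF pd, of n x "- x + snd (f n)"] by (simp add: add.assoc[symmetric])
  then have "1 - Re (fst (f n) (snd (f n))) \<le> 1 - Re (fst (f n) (- x + snd (f n)))"
    using null[of n] real_sqrt_le_0_iff[of "1 - Re (fst (f n) x)"]
      real_sqrt_le_iff[of "1 - Re (fst (f n) (snd (f n)))" "1 - Re (fst (f n) (- x + snd (f n)))"] by linarith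
  also have "\<dots> \<le> C * (1 / 2) ^ n" using small[OF n(2), of n] by (simp add: field_simps)
  also have "\<dots> \<le> C * (1 / 2) ^ m" using n(1) m(2) by (intro mult_left_mono power_decreasing) auto
  also have "\<dots> < e\<^sup>2 / 8" by (rule m(1))
  finally show False using f'(3)[of n] by simp
qed

text \<open>The products pulled back along \<open>p\<close> form a family as required by
  \<open>resolution_coefficients\<close>, which leaves finitely many bad sequences. Their
  boundedness conditions are closed and, by density, cover a neighbourhood of \<open>0\<close>; so
  one of them holds on a nonempty open set, and differences carry it to a neighbourhood of
  \<open>0\<close>, against \<open>bad_sequence_not_small\<close>.\<close>

lemma no_failure:
  assumes H: "locally_compact_space (euclidean :: 'h topology)"
  shows False
proof -
  note hom = resolution_hom[OF res]
  obtain A K0 :: "'h set" where A: "open A" "0 \<in> A" "A \<subseteq> K0" "compact K0"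
    using locally_compact_neighbourhood[OF H] .
  define D where "D f = (\<lambda>h. complex_of_real (dyadic_product (\<lambda>n. fst (f n)) (p h)))"
    for f :: "nat \<Rightarrow> ('q \<Rightarrow> complex) \<times> 'q"
  \<comment> \<open>Continuity of \<open>D f\<close> depends on the rate that
    \<open>bad_sequence\<close> forgets, so it is kept as a separate condition.\<close>
  define P where "P = {D f |f. bad_sequence f \<and> normalized_pd (D f)}"
  have approx: "\<exists>\<phi>\<in>P. \<forall>h\<in>K. cmod (\<phi> h - 1) < d" if K: "compact K" and d: "d > 0" for K d
  proof -
    have "compact (K \<union> K0)" "d / 2 > 0" using K A(4) d by (simp_all add: compact_Un)
    from bad_sequence_exists[OF this]
    obtain f where f: "bad_sequence f" "\<And>n h. h \<in> K \<union> K0 \<Longrightarrow> 1 - Re (fst (f n) (p h)) \<le> d / 2 * (1 / 4) ^ n"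
      by blast
    have npd: "normalized_pd (fst (f n))" for n using f(1) by (simp add: bad_sequence_def)
    have "normalized_pd (D f)"
      unfolding D_def
      by (rule dyadic_product_normalized[OF npd hom resolution_continuous[OF res] A(1,2), where d = "d / 2"])
        (use f(2) A(3) in auto)
    moreover have "cmod (D f h - 1) < d" if "h \<in> K" for h
    proof -
      have "1 - d / 2 \<le> dyadic_product (\<lambda>n. fst (f n)) (p h)"
        using dyadic_product_ge[of "\<lambda>n. fst (f n)" "p h" "d / 2" 0, OF npd] f(2)[of h] that by simp
      moreover have "dyadic_product (\<lambda>n. fst (f n)) (p h) \<le> 1"
        by (rule dyadic_product_bounds(2)[OF npd])
      moreover have "cmod (D f h - 1) = \<bar>dyadic_product (\<lambda>n. fst (f n)) (p h) - 1\<bar>"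
        unfolding D_def by (metis norm_of_real of_real_1 of_real_diff)
      ultimately show ?thesis using d by simp
    qed
    ultimately show ?thesis using f(1) by (auto simp: P_def)
  qed
  obtain U r F where U: "open U" "0 \<in> U" "r > 0" "finite F" "F \<subseteq> P \<times> UNIV"
    "\<And>h. p h \<in> U \<Longrightarrow> \<exists>(\<phi>, g, k)\<in>F. r \<le> cmod (\<phi> (g + h + k))"
    using resolution_coefficients[OF res _ approx] unfolding P_def by blast
  have "fst x \<in> P" if "x \<in> F" for x using U(5) that by auto
  then have "\<forall>x\<in>F. \<exists>f. bad_sequence f \<and> fst x = D f" unfolding P_def by blast
  then obtain f where f: "\<And>x. x \<in> F \<Longrightarrow> bad_sequence (f x)" "\<And>x. x \<in> F \<Longrightarrow> fst x = D (f x)" by metis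
  have npd: "normalized_pd (fst (f x n))" if "x \<in> F" for x n
    using f(1)[OF that] by (simp add: bad_sequence_def)
  define C where "C = - 2 * ln r"
  \<comment> \<open>\<open>dyadic_product_decay\<close> puts \<open>q = p h\<close> here once the
    translate of \<open>D (f x)\<close> is at least \<open>r\<close>. These conditions are closed in
    \<open>q\<close>, as each \<open>fst (f x n)\<close> is continuous even where the product is
    not.\<close>
  define T where "T x = {q. \<forall>n. 2 ^ n * (1 - Re (fst (f x n) (p (fst (snd x)) + q + p (snd (snd x))))) \<le> C}" for x
  have closed: "closed (T x)" if "x \<in> F" for x
  proof -
    have "continuous_on UNIV (\<lambda>q. fst (f x n) (p (fst (snd x)) + q + p (snd (snd x))))" for n
      by (rule continuous_on_compose2[of UNIV "fst (f x n)"])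
        (use npd[OF that] in \<open>auto simp: normalized_pd_def intro!: continuous_intros\<close>)
    then have "closed {q. 2 ^ n * (1 - Re (fst (f x n) (p (fst (snd x)) + q + p (snd (snd x))))) \<le> C}" for n
      by (intro closed_Collect_le continuous_intros)
    then have "closed (\<Inter>n. {q. 2 ^ n * (1 - Re (fst (f x n) (p (fst (snd x)) + q + p (snd (snd x))))) \<le> C})"
      by (intro closed_INT) auto
    moreover have "(\<Inter>n. {q. 2 ^ n * (1 - Re (fst (f x n) (p (fst (snd x)) + q + p (snd (snd x))))) \<le> C}) = T x"
      by (auto simp: T_def)
    ultimately show ?thesis by simp
  qed
  have "U \<inter> range p \<subseteq> (\<Union>x\<in>F. T x)"
  proof
    fix q assume "q \<in> U \<inter> range p"
    then obtain h where h: "q = p h" "p h \<in> U" by blast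
    then obtain x where x: "x \<in> F" "r \<le> cmod (fst x (fst (snd x) + h + snd (snd x)))"
      using U(6)[OF h(2)] by fastforce
    then have "r \<le> dyadic_product (\<lambda>n. fst (f x n)) (p (fst (snd x) + h + snd (snd x)))"
      using dyadic_product_bounds(1)[of "\<lambda>n. fst (f x n)", OF npd[OF x(1)]] by (simp add: f(2) D_def)
    then have "q \<in> T x"
      using dyadic_product_decay[of "\<lambda>n. fst (f x n)", OF npd[OF x(1)] U(3)] by (simp add: T_def C_def h(1) hom)
    then show "q \<in> (\<Union>x\<in>F. T x)" using x(1) by blast
  qed
  moreover have "closed (\<Union>x\<in>F. T x)" using U(4) closed by (intro closed_UN) auto
  ultimately have "closure (U \<inter> range p) \<subseteq> (\<Union>x\<in>F. T x)" by (rule closure_minimal)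
  moreover have "U \<subseteq> closure (U \<inter> range p)"
    using open_Int_closure_subset[OF U(1), of "range p"] resolution_dense[OF res] by simp
  ultimately have "U \<subseteq> (\<Union>x\<in>F. T x)" by (rule order_trans[rotated])
  moreover have "U \<noteq> {}" using U(2) by blast
  ultimately obtain x where x: "x \<in> F" "interior (T x) \<noteq> {}"
    using finite_closed_cover_interior[OF U(4) closed U(1)] by meson
  then obtain y where y: "y \<in> interior (T x)" by blast
  define g k where "g = p (fst (snd x))" and "k = p (snd (snd x))"
  \<comment> \<open>Translated to \<open>0\<close>, the open set around \<open>y\<close> becomes
    \<open>V\<close>: for \<open>w\<close> in \<open>V\<close> the deficits at \<open>z + w\<close>
    and \<open>- z\<close> are both controlled by \<open>C\<close>, and
    \<open>w = - z + (z + w)\<close>.\<close>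
  define z where "z = g + y + k"
  define V where "V = (\<lambda>w. - g + (z + w) + - k) -` interior (T x)"
  have "open V" unfolding V_def by (intro open_vimage continuous_intros) auto
  moreover have "0 \<in> V" using y by (simp add: V_def z_def add.assoc)
  \<comment> \<open>Adding two square roots of deficits bounded by \<open>C / 2 ^ n\<close> gives a
    factor \<open>4\<close> after squaring.\<close>
  ultimately obtain n w where nw: "w \<in> V" "4 * C < 2 ^ n * (1 - Re (fst (f x n) w))"
    using bad_sequence_not_small[OF f(1)[OF x(1)]] by blast
  have pd: "positive_definite (fst (f x n))" "fst (f x n) 0 = 1"
    using npd[OF x(1), of n] by (auto simp: normalized_pd_def)
  have "- g + (z + w) + - k \<in> T x" using nw(1) interior_subset by (auto simp: V_def)
  then have 1: "2 ^ n * (1 - Re (fst (f x n) (z + w))) \<le> C"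
    by (simp add: T_def g_def k_def add.assoc)
  have "y \<in> T x" using y interior_subset by blast
  then have 2: "2 ^ n * (1 - Re (fst (f x n) (- z))) \<le> C"
    using pd_minus[OF pd] by (simp add: T_def z_def g_def k_def)
  have "sqrt (1 - Re (fst (f x n) w)) \<le> sqrt (1 - Re (fst (f x n) (- z))) + sqrt (1 - Re (fst (f x n) (z + w)))"
    using pd_sqrt_subadditive[OF pd, of "- z" "z + w"] by simp
  also have "\<dots> \<le> sqrt (C / 2 ^ n) + sqrt (C / 2 ^ n)"
    using 1 2 by (intro add_mono real_sqrt_le_mono) (simp_all add: field_simps)
  also have "\<dots> = sqrt (4 * (C / 2 ^ n))" unfolding real_sqrt_mult by simp
  finally have "1 - Re (fst (f x n) w) \<le> 4 * (C / 2 ^ n)" by simp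
  then show False using nw(2) by (simp add: field_simps)
qed

end

theorem resolution_compact_convergence:
  fixes p :: "'h::topological_group_add \<Rightarrow> 'q::topological_group_add"
  assumes "locally_compact_space (euclidean :: 'h topology)"
    and Q: "locally_compact_space (euclidean :: 'q topology)"
    and res: "resolution p" and L: "compact L" and e: "e > 0"
  shows "\<exists>K d. compact K \<and> d > 0 \<and> (\<forall>\<phi>. normalized_pd \<phi> \<longrightarrow>
    (\<forall>h\<in>K. cmod (\<phi> (p h) - 1) < d) \<longrightarrow> (\<forall>l\<in>L. cmod (\<phi> l - 1) < e))"
proof (rule ccontr)
  assume neg: "\<not> ?thesis"
  obtain A' L' :: "'q set" where A': "open A'" "0 \<in> A'" "A' \<subseteq> L'" "compact L'"
    using locally_compact_neighbourhood[OF Q] .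
  have "\<exists>\<phi>. normalized_pd \<phi> \<and> (\<forall>h\<in>K. cmod (\<phi> (p h) - 1) < d) \<and> (\<exists>l\<in>L. cmod (\<phi> l - 1) \<ge> e)"
    if "compact K" "d > 0" for K d
    using neg that by (meson not_less)
  from no_failure[OF res A' L e this assms(1)] show False .
qed

section \<open>Relative Property (T) and resolutions\<close>

text \<open>For the forward direction it suffices to test one universal filter, generated by the
  sets \<open>C b\<close> of functions close to \<open>1\<close> on a compact set.\<close>

lemma relative_property_T_iff:
  "relative_property_T X \<longleftrightarrow> (\<forall>e>0. \<exists>K d. compact K \<and> d > 0 \<and>
     (\<forall>\<phi>. normalized_pd \<phi> \<longrightarrow> (\<forall>g\<in>K. cmod (\<phi> g - 1) < d) \<longrightarrow> (\<forall>x\<in>X. cmod (\<phi> x - 1) < e)))"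
proof
  assume T: "relative_property_T X"
  define B where "B = {(K :: 'a set, d :: real). compact K \<and> d > 0}"
  define C where "C b = {\<phi> :: 'a \<Rightarrow> complex. normalized_pd \<phi> \<and> (\<forall>g\<in>fst b. cmod (\<phi> g - 1) < snd b)}" for b
  define F where "F = (INF b\<in>B. principal (C b))"
  have ev: "eventually P F \<longleftrightarrow> (\<exists>b\<in>B. \<forall>\<phi>\<in>C b. P \<phi>)" for P
    unfolding F_def
  proof (subst eventually_INF_base)
    show "B \<noteq> {}" by (auto simp: B_def intro!: exI[of _ "{}"] exI[of _ 1])
    show "\<exists>c\<in>B. principal (C c) \<le> inf (principal (C a)) (principal (C b))" if "a \<in> B" "b \<in> B" for a b
      using that
      by (intro bexI[of _ "(fst a \<union> fst b, min (snd a) (snd b))"]) (auto simp: B_def C_def compact_Un)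
  qed (simp add: eventually_principal)
  have "uniform_limit K (\<lambda>\<phi>. \<phi>) (\<lambda>_. 1) F" if "compact K" for K
    unfolding uniform_limit_iff ev dist_norm
  proof (intro allI impI)
    fix e :: real assume "e > 0"
    then show "\<exists>b\<in>B. \<forall>\<phi>\<in>C b. \<forall>x\<in>K. cmod (\<phi> x - 1) < e"
      using that by (intro bexI[of _ "(K, e)"]) (auto simp: B_def C_def)
  qed
  moreover have "eventually normalized_pd F"
    unfolding ev by (intro bexI[of _ "({}, 1)"]) (auto simp: B_def C_def)
  ultimately have "uniform_limit X (\<lambda>\<phi>. \<phi>) (\<lambda>_. 1) F"
    using T unfolding relative_property_T_def by blast
  then have "\<forall>e>0. \<exists>b\<in>B. \<forall>\<phi>\<in>C b. \<forall>x\<in>X. cmod (\<phi> x - 1) < e"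
    unfolding uniform_limit_iff ev dist_norm .
  then show "\<forall>e>0. \<exists>K d. compact K \<and> d > 0 \<and>
     (\<forall>\<phi>. normalized_pd \<phi> \<longrightarrow> (\<forall>g\<in>K. cmod (\<phi> g - 1) < d) \<longrightarrow> (\<forall>x\<in>X. cmod (\<phi> x - 1) < e))"
    by (fastforce simp: B_def C_def)
next
  assume R: "\<forall>e>0. \<exists>K d. compact K \<and> d > 0 \<and>
     (\<forall>\<phi>. normalized_pd \<phi> \<longrightarrow> (\<forall>g\<in>K. cmod (\<phi> g - 1) < d) \<longrightarrow> (\<forall>x\<in>X. cmod (\<phi> x - 1) < e))"
  show "relative_property_T X"
    unfolding relative_property_T_def
  proof (intro allI impI)
    fix F :: "('a \<Rightarrow> complex) filter"
    assume F: "eventually normalized_pd F" "\<forall>K. compact K \<longrightarrow> uniform_limit K (\<lambda>\<phi>. \<phi>) (\<lambda>_. 1) F"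
    show "uniform_limit X (\<lambda>\<phi>. \<phi>) (\<lambda>_. 1) F"
      unfolding uniform_limit_iff dist_norm
    proof (intro allI impI)
      fix e :: real assume "e > 0"
      then obtain K d where K: "compact K" "d > 0"
        "\<And>\<phi>. normalized_pd \<phi> \<Longrightarrow> \<forall>g\<in>K. cmod (\<phi> g - 1) < d \<Longrightarrow> \<forall>x\<in>X. cmod (\<phi> x - 1) < e"
        using R by meson
      have "\<forall>\<^sub>F \<phi> in F. \<forall>g\<in>K. cmod (\<phi> g - 1) < d"
        using F(2) K(1,2) unfolding uniform_limit_iff dist_norm by blast
      with F(1) show "\<forall>\<^sub>F \<phi> in F. \<forall>x\<in>X. cmod (\<phi> x - 1) < e"
        by eventually_elim (rule K(3))
    qed
  qed
qed

text \<open>For \<open>\<phi>\<close> close to \<open>1\<close>,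
  \<open>resolution_approximation\<close> provides \<open>\<psi>\<close> on the target. It inherits
  closeness to \<open>1\<close> on the image of \<open>K\<close>,
  \<open>resolution_compact_convergence\<close> extends this to \<open>L\<close>, and Property (T)
  of the image of \<open>X\<close> carries it there and so back to \<open>\<phi>\<close> on
  \<open>X\<close>.\<close>

lemma resolution_relative_property_T:
  fixes p :: "'h::topological_group_add \<Rightarrow> 'q::topological_group_add"
  assumes H: "locally_compact_space (euclidean :: 'h topology)"
    and Q: "locally_compact_space (euclidean :: 'q topology)"
    and res: "resolution p" and T: "relative_property_T (p ` X)"
  shows "relative_property_T X"
  unfolding relative_property_T_iff
proof (intro allI impI)
  fix e :: real assume "e > 0"
  then have e2: "e / 2 > 0" by simp
  then obtain L a where L: "compact L" "a > 0"
    "\<And>\<psi>. normalized_pd \<psi> \<Longrightarrow> \<forall>l\<in>L. cmod (\<psi> l - 1) < a \<Longrightarrow> \<forall>x\<in>p ` X. cmod (\<psi> x - 1) < e / 2"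
    using T unfolding relative_property_T_iff by meson
  obtain K b where K: "compact K" "b > 0"
    "\<And>\<psi>. normalized_pd \<psi> \<Longrightarrow> \<forall>h\<in>K. cmod (\<psi> (p h) - 1) < b \<Longrightarrow> \<forall>l\<in>L. cmod (\<psi> l - 1) < a"
    using resolution_compact_convergence[OF H Q res L(1,2)] by meson
  \<comment> \<open>The half of \<open>b\<close> leaves room for the passage from
    \<open>\<phi>\<close> to \<open>\<psi>\<close> on \<open>K\<close>, the half of \<open>e\<close>
    for the passage back on \<open>X\<close>.\<close>
  have "min (e / 2) (b / 2) > 0" using e2 K(2) by simp
  from resolution_approximation[OF res this] obtain M c where M: "compact M" "c > 0"
    "\<And>\<phi>. normalized_pd \<phi> \<Longrightarrow> (\<And>g. g \<in> M \<Longrightarrow> cmod (\<phi> g - 1) < c) \<Longrightarrow>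
       \<exists>\<psi>. normalized_pd \<psi> \<and> (\<forall>h. cmod (\<phi> h - \<psi> (p h)) < min (e / 2) (b / 2))"
    by blast
  have "\<forall>x\<in>X. cmod (\<phi> x - 1) < e"
    if \<phi>: "normalized_pd \<phi>" "\<forall>g\<in>K \<union> M. cmod (\<phi> g - 1) < min c (b / 2)" for \<phi>
  proof
    obtain \<psi> where \<psi>: "normalized_pd \<psi>" "\<And>h. cmod (\<phi> h - \<psi> (p h)) < min (e / 2) (b / 2)"
      using M(3)[OF \<phi>(1)] \<phi>(2) by auto
    have "cmod (\<psi> (p h) - 1) < b" if "h \<in> K" for h
    proof -
      have "cmod (\<phi> h - 1) < b / 2" using \<phi>(2) that by simp
      then show ?thesis
        using norm_triangle_ineq4[of "\<phi> h - 1" "\<phi> h - \<psi> (p h)"] \<psi>(2)[of h] by simp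
    qed
    then have *: "\<forall>x\<in>p ` X. cmod (\<psi> x - 1) < e / 2" using K(3) L(3) \<psi>(1) by blast
    fix x assume "x \<in> X"
    then have "cmod (\<psi> (p x) - 1) < e / 2" using * by blast
    then show "cmod (\<phi> x - 1) < e"
      using norm_triangle_ineq[of "\<phi> x - \<psi> (p x)" "\<psi> (p x) - 1"] \<psi>(2)[of x] by simp
  qed
  moreover have "compact (K \<union> M)" "min c (b / 2) > 0" using K M by (simp_all add: compact_Un)
  ultimately show "\<exists>K d. compact K \<and> d > 0 \<and> (\<forall>\<phi>. normalized_pd \<phi> \<longrightarrow>
      (\<forall>g\<in>K. cmod (\<phi> g - 1) < d) \<longrightarrow> (\<forall>x\<in>X. cmod (\<phi> x - 1) < e))"
    by blast
qed

text \<open>Relative Property (T) makes the pullback of some function vanishing at infinity exceed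
  \<open>1 / 2\<close> on \<open>X\<close>, so the image of \<open>X\<close> lies in one compact
  set, which is closed as the target is Hausdorff.\<close>

lemma haagerup_relative_property_T:
  fixes p :: "'h::topological_group_add \<Rightarrow> 'q::{topological_group_add, t2_space}"
  assumes cont: "continuous_on UNIV p" and hom: "\<And>x y. p (x + y) = p x + p y"
    and haag: "haagerup TYPE('q)" and T: "relative_property_T X"
  shows "compact (closure (p ` X))"
proof -
  obtain K d where K: "compact K" "d > 0"
    "\<And>\<phi>. normalized_pd \<phi> \<Longrightarrow> \<forall>g\<in>K. cmod (\<phi> g - 1) < d \<Longrightarrow> \<forall>x\<in>X. cmod (\<phi> x - 1) < 1 / 2"
    using T[unfolded relative_property_T_iff, rule_format, of "1 / 2"] by auto
  have "compact (p ` K)"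
    by (rule compact_continuous_image[OF continuous_on_subset[OF cont subset_UNIV] K(1)])
  then obtain \<phi> :: "'q \<Rightarrow> real" where \<phi>: "normalized_pd (\<lambda>q. complex_of_real (\<phi> q))"
    "vanishes_at_infinity \<phi>" "\<And>h. h \<in> K \<Longrightarrow> \<phi> (p h) > 1 - d"
    using haag K(2) unfolding haagerup_def by (metis imageI)
  have pd: "positive_definite (\<lambda>q. complex_of_real (\<phi> q))" "complex_of_real (\<phi> 0) = 1"
    "continuous_on UNIV (\<lambda>q. complex_of_real (\<phi> q))"
    using \<phi>(1) by (auto simp: normalized_pd_def)
  have norm: "cmod (complex_of_real (\<phi> q) - 1) = \<bar>\<phi> q - 1\<bar>" for q
    by (metis norm_of_real of_real_1 of_real_diff)
  have "normalized_pd (\<lambda>h. complex_of_real (\<phi> (p h)))"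
    unfolding normalized_pd_def
  proof (intro conjI)
    show "continuous_on UNIV (\<lambda>h. complex_of_real (\<phi> (p h)))"
      by (rule continuous_on_compose2[OF pd(3) cont]) simp
    show "positive_definite (\<lambda>h. complex_of_real (\<phi> (p h)))"
      by (rule positive_definite_compose[OF pd(1) hom])
    show "complex_of_real (\<phi> (p 0)) = 1" using pd(2) additive_zero_minus(1)[of p, OF hom] by simp
  qed
  moreover have "cmod (complex_of_real (\<phi> (p h)) - 1) < d" if "h \<in> K" for h
    using \<phi>(3)[OF that] pd_norm_le[OF pd(1,2), of "p h"] K(2) by (simp add: norm)
  ultimately have near: "\<bar>\<phi> (p x) - 1\<bar> < 1 / 2" if "x \<in> X" for x using K(3) norm that by metis
  obtain C where C: "compact C" "\<And>g. g \<notin> C \<Longrightarrow> \<bar>\<phi> g\<bar> < 1 / 2"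
    using \<phi>(2)[unfolded vanishes_at_infinity_def, rule_format, of "1 / 2"] by auto
  have "p ` X \<subseteq> C"
  proof
    fix q assume "q \<in> p ` X"
    then have "\<bar>\<phi> q - 1\<bar> < 1 / 2" using near by blast
    then have "\<not> \<bar>\<phi> q\<bar> < 1 / 2" by linarith
    then show "q \<in> C" using C(2) by blast
  qed
  then have "closure (p ` X) \<subseteq> C" using C(1) by (simp add: closure_minimal compact_imp_closed)
  then show ?thesis using compact_Int_closed[OF C(1), of "closure (p ` X)"] by (simp add: Int_absorb1)
qed

theorem proposition1p11:
  fixes p :: "'h::{topological_group_add, t2_space} \<Rightarrow> 'q::{topological_group_add, t2_space}"
    and X :: "'h set"
  assumes "locally_compact_space (euclidean :: 'h topology)"
    and "locally_compact_space (euclidean :: 'q topology)"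
    and "resolution p"
  shows "(relative_property_T (p ` X) \<longrightarrow> relative_property_T X) \<and>
         (haagerup TYPE('q) \<longrightarrow> (relative_property_T X \<longleftrightarrow> compact (closure (p ` X))))"
proof (intro conjI impI iffI)
  show lift: "relative_property_T X" if "relative_property_T (p ` X)"
    by (rule resolution_relative_property_T[OF assms that])
  show "compact (closure (p ` X))" if "haagerup TYPE('q)" "relative_property_T X"
    by (rule haagerup_relative_property_T[OF resolution_continuous[OF assms(3)] resolution_hom[OF assms(3)] that])
  show "relative_property_T X" if "compact (closure (p ` X))"
  proof (rule lift)
    show "relative_property_T (p ` X)"
      \<comment> \<open>The closure itself serves as the compact set, with
        \<open>d = e\<close>.\<close>
      unfolding relative_property_T_iff using that closure_subset[of "p ` X"] by blast
  qed
qed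

end
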